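(* Let $B$ be the ($d$-dimensional) canonical $G$-Brownian motion on $\Omega=C([0,\infty);\mathbb R^d)$ and let $\tau:\Omega\to[0,\infty)$ be an optional time (no further assumption on $\tau$). Then $$\widetilde B_t:=2B_{t\wedge\tau}-B_t=B_{t\wedge\tau}-(B_t-B_\tau)I_{\{t>\tau\}},\qquad t\ge0,$$ is still a $G$-Brownian motion.
   Context: $C_{b.Lip}(\mathbb{R}^k)$: bounded Lipschitz functions. A sublinear expectation space is a triple (set, $\mathcal H$, $\tilde{\mathbb E}$) with $\mathcal H$ a linear space of real functions on the set closed under composition with $C_{b.Lip}$ functions of finitely many elements, and $\tilde{\mathbb E}:\mathcal H\to\mathbb R$ monotone, constant preserving, sub-additive and positively homogeneous. $X_1\overset{d}{=}X_2$ means equality of the (sublinear) expectations of $\varphi(X_1)$ and $\varphi(X_2)$ for all $\varphi\in C_{b.Lip}$; $Y$ is independent from $X$ if $\tilde{\mathbb E}[\varphi(X,Y)]=\tilde{\mathbb E}[\tilde{\mathbb E}[\varphi(x,Y)]_{x=X}]$ for all $\varphi\in C_{b.Lip}$. A $d$-dimensional $X$ is $G$-normally distributed if $aX+b\bar X\overset{d}{=}\sqrt{a^2+b^2}X$ for all $a,b\ge0$, where $\bar X\overset{d}{=}X$ is independent from $X$, and $G(A)=\frac12\tilde{\mathbb E}[\langle AX,X\rangle]$ for $A\in\mathbb S(d)$ (symmetric $d\times d$ matrices). Fix a monotone sublinear $G:\mathbb S(d)\to\mathbb R$. $\Omega$ carries the topology of locally uniform convergence, $B_t(\omega)=\omega_t$,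 $\mathcal F_t=\sigma(B_s:s\le t)$, $\mathcal F=\bigvee_t\mathcal F_t$. $L_{ip}(\Omega)$ is the set of $X=\varphi(B_{t_1},B_{t_2}-B_{t_1},\dots,B_{t_n}-B_{t_{n-1}})$, $\varphi\in C_{b.Lip}$, $0\le t_1<\dots<t_n<\infty$, and $\hat{\mathbb E}[X]:=\tilde{\mathbb E}[\varphi(\sqrt{t_1}\xi_1,\dots,\sqrt{t_n-t_{n-1}}\xi_n)]$ with $\xi_i$ identically distributed, $G$-normal, $\xi_{i+1}$ independent from $(\xi_1,\dots,\xi_i)$. $L^1_G(\Omega)$ is the completion of $L_{ip}(\Omega)$ under $\hat{\mathbb E}[|\cdot|]$. There is a weakly compact family $\mathcal P$ of probability measures on $(\Omega,\mathcal F)$ with $\hat{\mathbb E}[X]=\sup_{P\in\mathcal P}E_P[X]$ on $L^1_G(\Omega)$; fix it, and define $\hat{\mathbb E}[X]:=\sup_{P\in\mathcal P}E_P[X]$ for every $\mathcal F$-measurable $X$ for which $E_P[X]$ exists for each $P\in\mathcal P$. Random variables equal outside a set of capacity zero, where $c(A)=\sup_{P\in\mathcal P}P(A)$, are identified. A $d$-dimensional process $(Y_t)_{t\ge0}$ on $(\Omega,\mathcal F)$ is a $G$-Brownian motion (under $\hat{\mathbb E}$) if $Y_0=0$; for all $t,s\ge0$, $Y_{t+s}-Y_t$ is independent from $(Y_{t_1},\dots,Y_{t_n})$ for all $0\le t_1\le\dots\le t_n\le t$; and $Y_{t+s}-Y_t\overset{d}{=}\sqrt s\,\xi$ with $\xi$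 $G$-normally distributed. Under $\hat{\mathbb E}$ the canonical process $B$ is a $G$-Brownian motion. A map $\tau:\Omega\to[0,\infty)$ is an optional time if $\{\tau<t\}\in\mathcal F_t$ for each $t\ge0$. *)

theory Defs
  imports "HOL-Probability.Probability"
begin

section \<open>Bounded Lipschitz functions\<close>

definition Cb_Lip :: "('a::metric_space \<Rightarrow> real) set" where
  "Cb_Lip = {\<phi>. bounded (range \<phi>) \<and> (\<exists>L. L-lipschitz_on UNIV \<phi>)}"

text \<open>The number \<open>n\<close> of arguments varies, so a function of \<open>n\<close> arguments is a function on
  sequences. The Lipschitz bound is with respect to the Euclidean norm of the first \<open>n\<close> entries;
  in particular it forces \<open>\<phi>\<close> to depend on these entries only. For \<open>'b = real^'d\<close> this is
  the class of bounded Lipschitz functions on \<open>(n * d)\<close>-dimensional Euclidean space.\<close>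

definition Cb_Lip_seq :: "nat \<Rightarrow> ((nat \<Rightarrow> 'b::real_normed_vector) \<Rightarrow> real) set" where
  "Cb_Lip_seq n = {\<phi>. bounded (range \<phi>) \<and>
     (\<exists>L. \<forall>x y. \<bar>\<phi> x - \<phi> y\<bar> \<le> L * L2_set (\<lambda>i. norm (x i - y i)) {..<n})}"


section \<open>Sublinear expectation spaces\<close>

text \<open>The underlying set is the universe of the type \<open>'w\<close>.\<close>

locale sublinear_expectation_space =
  fixes H :: "('w \<Rightarrow> real) set" and E :: "('w \<Rightarrow> real) \<Rightarrow> real"
  assumes zero_mem: "(\<lambda>_. 0) \<in> H"
    and add_mem: "\<And>X Y. X \<in> H \<Longrightarrow> Y \<in> H \<Longrightarrow> (\<lambda>w. X w + Y w) \<in> H"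
    and scale_mem: "\<And>a X. X \<in> H \<Longrightarrow> (\<lambda>w. a * X w) \<in> H"
    and Cb_Lip_mem:
      "\<And>n \<phi> X. \<phi> \<in> Cb_Lip_seq n \<Longrightarrow> (\<And>i. i < n \<Longrightarrow> X i \<in> H) \<Longrightarrow> (\<lambda>w. \<phi> (\<lambda>i. X i w)) \<in> H"
    and monotone:
      "\<And>X Y. X \<in> H \<Longrightarrow> Y \<in> H \<Longrightarrow> (\<And>w. X w \<le> Y w) \<Longrightarrow> E X \<le> E Y"
    and constant_preserving: "\<And>c. E (\<lambda>_. c) = c"
    and subadditive: "\<And>X Y. X \<in> H \<Longrightarrow> Y \<in> H \<Longrightarrow> E (\<lambda>w. X w + Y w) \<le> E X + E Y"
    and positively_homogeneous: "\<And>a X. 0 \<le> a \<Longrightarrow> X \<in> H \<Longrightarrow> E (\<lambda>w. a * X w) = a * E X"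

definition random_vector :: "('w \<Rightarrow> real) set \<Rightarrow> ('w \<Rightarrow> real^'d) \<Rightarrow> bool" where
  "random_vector H X \<longleftrightarrow> (\<forall>j. (\<lambda>w. X w $ j) \<in> H)"

text \<open>The two vectors may live on different spaces.\<close>

definition identically_distributed ::
  "(('w \<Rightarrow> real) \<Rightarrow> real) \<Rightarrow> ('w \<Rightarrow> real^'d) \<Rightarrow> (('v \<Rightarrow> real) \<Rightarrow> real) \<Rightarrow> ('v \<Rightarrow> real^'d) \<Rightarrow> bool" where
  "identically_distributed E1 X1 E2 X2 \<longleftrightarrow>
     (\<forall>\<phi>\<in>Cb_Lip. E1 (\<lambda>w. \<phi> (X1 w)) = E2 (\<lambda>v. \<phi> (X2 v)))"

text \<open>\<open>Y\<close> is independent from \<open>(X 0, \<dots>, X (n - 1))\<close> (in this order; the notion is not symmetric).\<close>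

definition independent_from ::
  "(('w \<Rightarrow> real) \<Rightarrow> real) \<Rightarrow> ('w \<Rightarrow> real^'d) \<Rightarrow> nat \<Rightarrow> (nat \<Rightarrow> 'w \<Rightarrow> real^'d) \<Rightarrow> bool" where
  "independent_from E Y n X \<longleftrightarrow>
     (\<forall>\<phi>\<in>Cb_Lip_seq (Suc n).
        E (\<lambda>w. \<phi> ((\<lambda>i. X i w)(n := Y w))) =
        E (\<lambda>w. E (\<lambda>w'. \<phi> ((\<lambda>i. X i w)(n := Y w')))))"


section \<open>G-normal distribution\<close>

definition symmetric_matrices :: "(real^'d^'d) set" where
  "symmetric_matrices = {A. transpose A = A}"

definition monotone_sublinear :: "(real^'d^'d \<Rightarrow> real) \<Rightarrow> bool" where
  "monotone_sublinear G \<longleftrightarrow>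
     (\<forall>A\<in>symmetric_matrices. \<forall>B\<in>symmetric_matrices.
        (\<forall>x. 0 \<le> ((B - A) *v x) \<bullet> x) \<longrightarrow> G A \<le> G B) \<and>
     (\<forall>A\<in>symmetric_matrices. \<forall>B\<in>symmetric_matrices. G (A + B) \<le> G A + G B) \<and>
     (\<forall>A\<in>symmetric_matrices. \<forall>c\<ge>0. G (c *\<^sub>R A) = c * G A)"

text \<open>Closure of \<open>H\<close> under bounded Lipschitz functions does not put \<open>\<langle>AX, X\<rangle>\<close> into \<open>H\<close>, so this
  is part of the definition.\<close>

definition G_normal ::
  "('w \<Rightarrow> real) set \<Rightarrow> (('w \<Rightarrow> real) \<Rightarrow> real) \<Rightarrow> (real^'d^'d \<Rightarrow> real) \<Rightarrow> ('w \<Rightarrow> real^'d) \<Rightarrow> bool" where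
  "G_normal H E G X \<longleftrightarrow>
     random_vector H X \<and>
     (\<exists>X'. random_vector H X' \<and> identically_distributed E X' E X \<and>
        independent_from E X' 1 (\<lambda>_. X) \<and>
        (\<forall>a\<ge>0. \<forall>b\<ge>0. identically_distributed
           E (\<lambda>w. a *\<^sub>R X w + b *\<^sub>R X' w) E (\<lambda>w. sqrt (a\<^sup>2 + b\<^sup>2) *\<^sub>R X w))) \<and>
     (\<forall>A\<in>symmetric_matrices.
        (\<lambda>w. (A *v X w) \<bullet> X w) \<in> H \<and> G A = 1 / 2 * E (\<lambda>w. (A *v X w) \<bullet> X w))"

text \<open>The sequence \<open>\<xi>\<close> is indexed from \<open>0\<close>.\<close>

definition iid_G_normal ::
  "('w \<Rightarrow> real) set \<Rightarrow> (('w \<Rightarrow> real) \<Rightarrow> real) \<Rightarrow> (real^'d^'d \<Rightarrow> real) \<Rightarrow> (nat \<Rightarrow> 'w \<Rightarrow> real^'d) \<Rightarrow> bool"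
  where
  "iid_G_normal H E G \<xi> \<longleftrightarrow>
     (\<forall>i. G_normal H E G (\<xi> i)) \<and>
     (\<forall>i j. identically_distributed E (\<xi> i) E (\<xi> j)) \<and>
     (\<forall>i. independent_from E (\<xi> (Suc i)) (Suc i) \<xi>)"


section \<open>Path space\<close>

text \<open>Paths on \<open>[0, \<infinity>)\<close>, made unique by fixing a dummy value at negative times. The starting point
  is not prescribed.\<close>

definition Omega :: "(real \<Rightarrow> real^'d) set" where
  "Omega = {\<omega> \<in> extensional {0..}. continuous_on {0..} \<omega>}"

definition locally_uniform_topology :: "(real \<Rightarrow> real^'d) topology" where
  "locally_uniform_topology = topology (\<lambda>U. U \<subseteq> Omega \<and>
     (\<forall>\<omega>\<in>U. \<exists>T\<ge>0. \<exists>\<epsilon>>0. \<forall>\<omega>'\<in>Omega. (\<forall>t\<in>{0..T}. dist (\<omega>' t) (\<omega> t) < \<epsilon>) \<longrightarrow> \<omega>' \<in> U))"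

lemma openin_locally_uniform_topology:
  "openin locally_uniform_topology U \<longleftrightarrow> U \<subseteq> Omega \<and>
     (\<forall>\<omega>\<in>U. \<exists>T\<ge>0. \<exists>\<epsilon>>0. \<forall>\<omega>'\<in>Omega. (\<forall>t\<in>{0..T}. dist (\<omega>' t) (\<omega> t) < \<epsilon>) \<longrightarrow> \<omega>' \<in> U)"
proof -
  let ?P = "\<lambda>U :: (real \<Rightarrow> real^'d) set. U \<subseteq> Omega \<and>
     (\<forall>\<omega>\<in>U. \<exists>T\<ge>0. \<exists>\<epsilon>>0. \<forall>\<omega>'\<in>Omega. (\<forall>t\<in>{0..T}. dist (\<omega>' t) (\<omega> t) < \<epsilon>) \<longrightarrow> \<omega>' \<in> U)"
  have inter: "?P (S \<inter> S')" if S: "?P S" and S': "?P S'" for S S'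
  proof (intro conjI ballI)
    show "S \<inter> S' \<subseteq> Omega" using S by blast
    fix \<omega> assume "\<omega> \<in> S \<inter> S'"
    then obtain T \<epsilon> T' \<epsilon>' where
      *: "T \<ge> 0" "\<epsilon> > 0" "T' \<ge> 0" "\<epsilon>' > 0"
        "\<forall>\<omega>'\<in>Omega. (\<forall>t\<in>{0..T}. dist (\<omega>' t) (\<omega> t) < \<epsilon>) \<longrightarrow> \<omega>' \<in> S"
        "\<forall>\<omega>'\<in>Omega. (\<forall>t\<in>{0..T'}. dist (\<omega>' t) (\<omega> t) < \<epsilon>') \<longrightarrow> \<omega>' \<in> S'"
      using S S' by (metis IntD1 IntD2)
    have "\<forall>\<omega>'\<in>Omega. (\<forall>t\<in>{0..max T T'}. dist (\<omega>' t) (\<omega> t) < min \<epsilon> \<epsilon>') \<longrightarrow> \<omega>' \<in> S \<inter> S'"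
      using * by (auto simp: le_max_iff_disj)
    moreover have "max T T' \<ge> 0" "min \<epsilon> \<epsilon>' > 0" using * by auto
    ultimately show "\<exists>T\<ge>0. \<exists>\<epsilon>>0. \<forall>\<omega>'\<in>Omega.
        (\<forall>t\<in>{0..T}. dist (\<omega>' t) (\<omega> t) < \<epsilon>) \<longrightarrow> \<omega>' \<in> S \<inter> S'" by blast
  qed
  have union: "?P (\<Union>\<K>)" if "\<forall>K\<in>\<K>. ?P K" for \<K>
  proof (intro conjI ballI)
    show "\<Union>\<K> \<subseteq> Omega" using that by blast
    fix \<omega> assume "\<omega> \<in> \<Union>\<K>"
    then obtain K where K: "K \<in> \<K>" "\<omega> \<in> K" by blast
    then obtain T \<epsilon> where "T \<ge> 0" "\<epsilon> > 0"
      "\<forall>\<omega>'\<in>Omega. (\<forall>t\<in>{0..T}. dist (\<omega>' t) (\<omega> t) < \<epsilon>) \<longrightarrow> \<omega>' \<in> K"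
      using \<open>\<forall>K\<in>\<K>. ?P K\<close> by meson
    with K(1) show "\<exists>T\<ge>0. \<exists>\<epsilon>>0. \<forall>\<omega>'\<in>Omega.
        (\<forall>t\<in>{0..T}. dist (\<omega>' t) (\<omega> t) < \<epsilon>) \<longrightarrow> \<omega>' \<in> \<Union>\<K>" by blast
  qed
  have "istopology ?P" unfolding istopology_def using inter union by blast
  then show ?thesis unfolding locally_uniform_topology_def by (subst topology_inverse') auto
qed

definition B :: "real \<Rightarrow> (real \<Rightarrow> real^'d) \<Rightarrow> real^'d" where
  "B t \<omega> = \<omega> t"

definition Ft :: "real \<Rightarrow> (real \<Rightarrow> real^'d) measure" where
  "Ft t = sigma Omega {B s -` A \<inter> Omega | s A. 0 \<le> s \<and> s \<le> t \<and> A \<in> sets borel}"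

definition Finf :: "(real \<Rightarrow> real^'d) measure" where
  "Finf = sigma Omega (\<Union>t\<in>{0..}. sets (Ft t))"

definition optional_time :: "((real \<Rightarrow> real^'d) \<Rightarrow> real) \<Rightarrow> bool" where
  "optional_time \<tau> \<longleftrightarrow>
     (\<forall>\<omega>\<in>Omega. 0 \<le> \<tau> \<omega>) \<and> (\<forall>t\<ge>0. {\<omega>\<in>Omega. \<tau> \<omega> < t} \<in> sets (Ft t))"


section \<open>Families of probability measures\<close>

definition prob_laws :: "(real \<Rightarrow> real^'d) measure set" where
  "prob_laws = {P. prob_space P \<and> sets P = sets Finf}"

text \<open>The coarsest topology that makes all \<open>P \<mapsto> E\<^sub>P[f]\<close> with \<open>f\<close> bounded and continuous on the path
  space continuous.\<close>

definition weak_topology :: "(real \<Rightarrow> real^'d) measure topology" where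
  "weak_topology = topology_generated_by
     {{P \<in> prob_laws. (\<integral>\<omega>. f \<omega> \<partial>P) \<in> U} | f U.
        continuous_map locally_uniform_topology euclideanreal f \<and> bounded (f ` Omega) \<and> open U}"

text \<open>Meaningful for \<open>X\<close> measurable and integrable under each \<open>P\<close> with bounded expectations.\<close>

definition Ehat :: "(real \<Rightarrow> real^'d) measure set \<Rightarrow> ((real \<Rightarrow> real^'d) \<Rightarrow> real) \<Rightarrow> real" where
  "Ehat \<P> X = (SUP P\<in>\<P>. \<integral>\<omega>. X \<omega> \<partial>P)"

definition capacity :: "(real \<Rightarrow> real^'d) measure set \<Rightarrow> (real \<Rightarrow> real^'d) set \<Rightarrow> real" where
  "capacity \<P> A = (SUP P\<in>\<P>. measure P A)"


section \<open>G-expectation\<close>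

text \<open>\<open>increment t x i\<close> is \<open>x (t 0)\<close> for \<open>i = 0\<close> and \<open>x (t i) - x (t (i - 1))\<close> otherwise.\<close>

definition increment :: "(nat \<Rightarrow> real) \<Rightarrow> (real \<Rightarrow> 'a::minus) \<Rightarrow> nat \<Rightarrow> 'a" where
  "increment t x i = (if i = 0 then x (t 0) else x (t i) - x (t (i - 1)))"

text \<open>\<open>Lip_value E \<xi> X v\<close>: \<open>X\<close> is an element of \<open>L\<^sub>i\<^sub>p(\<Omega>)\<close>, and \<open>v\<close> is the G-expectation of \<open>X\<close>
  computed from some cylinder representation of \<open>X\<close>. It is a relation because independence
  of the representation is a theorem.\<close>

definition Lip_value ::
  "(('w \<Rightarrow> real) \<Rightarrow> real) \<Rightarrow> (nat \<Rightarrow> 'w \<Rightarrow> real^'d) \<Rightarrow> ((real \<Rightarrow> real^'d) \<Rightarrow> real) \<Rightarrow> real \<Rightarrow> bool" where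
  "Lip_value E \<xi> X v \<longleftrightarrow>
     (\<exists>n t. \<exists>\<phi>\<in>Cb_Lip_seq n. 1 \<le> n \<and> 0 \<le> t 0 \<and> strict_mono_on {..<n} t \<and>
        (\<forall>\<omega>\<in>Omega. X \<omega> = \<phi> (increment t (\<lambda>s. B s \<omega>))) \<and>
        v = E (\<lambda>w. \<phi> (\<lambda>i. sqrt (increment t (\<lambda>s. s) i) *\<^sub>R \<xi> i w)))"

text \<open>The completion \<open>L\<^sup>1\<^sub>G(\<Omega>)\<close>, realised by measurable functions: \<open>X\<close> is the limit of a sequence in
  \<open>L\<^sub>i\<^sub>p(\<Omega>)\<close>, and \<open>v\<close> is the value at \<open>X\<close> of the continuous extension of the G-expectation.
  Constant sequences give the elements of \<open>L\<^sub>i\<^sub>p(\<Omega>)\<close> themselves.\<close>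

definition L1G_value ::
  "(('w \<Rightarrow> real) \<Rightarrow> real) \<Rightarrow> (nat \<Rightarrow> 'w \<Rightarrow> real^'d) \<Rightarrow> (real \<Rightarrow> real^'d) measure set \<Rightarrow>
    ((real \<Rightarrow> real^'d) \<Rightarrow> real) \<Rightarrow> real \<Rightarrow> bool" where
  "L1G_value E \<xi> \<P> X v \<longleftrightarrow>
     X \<in> borel_measurable Finf \<and>
     (\<exists>Xs vs. (\<forall>k. Lip_value E \<xi> (Xs k) (vs k)) \<and>
        (\<lambda>k. SUP P\<in>\<P>. \<integral>\<^sup>+\<omega>. ennreal \<bar>Xs k \<omega> - X \<omega>\<bar> \<partial>P) \<longlonglongrightarrow> 0 \<and> vs \<longlonglongrightarrow> v)"

definition represents_G_expectation ::
  "(('w \<Rightarrow> real) \<Rightarrow> real) \<Rightarrow> (nat \<Rightarrow> 'w \<Rightarrow> real^'d) \<Rightarrow> (real \<Rightarrow> real^'d) measure set \<Rightarrow> bool" where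
  "represents_G_expectation E \<xi> \<P> \<longleftrightarrow>
     \<P> \<noteq> {} \<and> compactin weak_topology \<P> \<and> (\<forall>X v. L1G_value E \<xi> \<P> X v \<longrightarrow> v = Ehat \<P> X)"


section \<open>G-Brownian motion\<close>

text \<open>\<open>Y\<close> is a process on \<open>(Omega, Finf)\<close> under \<open>Ehat \<P>\<close>. The reference space \<open>(H, E)\<close> only supplies a
  G-normally distributed vector. As random variables are identified up to capacity zero,
  \<open>Y\<^sub>0 = 0\<close> is required quasi-surely.\<close>

definition G_Brownian_motion ::
  "('w \<Rightarrow> real) set \<Rightarrow> (('w \<Rightarrow> real) \<Rightarrow> real) \<Rightarrow> (real^'d^'d \<Rightarrow> real) \<Rightarrow>
    (real \<Rightarrow> real^'d) measure set \<Rightarrow> (real \<Rightarrow> (real \<Rightarrow> real^'d) \<Rightarrow> real^'d) \<Rightarrow> bool" where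
  "G_Brownian_motion H E G \<P> Y \<longleftrightarrow>
     (\<forall>t\<ge>0. Y t \<in> borel_measurable Finf) \<and>
     capacity \<P> {\<omega>\<in>Omega. Y 0 \<omega> \<noteq> 0} = 0 \<and>
     (\<forall>t\<ge>0. \<forall>s\<ge>0. \<forall>n\<ge>1. \<forall>u. mono_on {..<n} u \<and> (\<forall>i<n. 0 \<le> u i \<and> u i \<le> t) \<longrightarrow>
        independent_from (Ehat \<P>) (\<lambda>\<omega>. Y (t + s) \<omega> - Y t \<omega>) n (\<lambda>i. Y (u i))) \<and>
     (\<exists>\<xi>. G_normal H E G \<xi> \<and>
        (\<forall>t\<ge>0. \<forall>s\<ge>0. identically_distributed
           (Ehat \<P>) (\<lambda>\<omega>. Y (t + s) \<omega> - Y t \<omega>) E (\<lambda>w. sqrt s *\<^sub>R \<xi> w)))"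

end

theory Submission
  imports Defs
begin

text \<open>
  Reflecting the path after \<open>\<tau>\<close> preserves the upper expectation because G-Brownian motion has
  independent increments and is symmetric. The difficulty is that functions of the reflected path
  are discontinuous in general, whereas the representing family is described by its values on
  cylinder functions only, and that the symmetry of the G-normal distribution has to be derived from
  its stability.

  \<^bold>\<open>Discontinuous functions.\<close> Call a law \<open>Q\<close> dominated if \<open>E\<^sub>Q X \<le> Ehat X\<close> for all cylinder functions
  \<open>X\<close>. Then \<open>E\<^sub>Q f \<le> Ehat f\<close> for every bounded measurable \<open>f\<close> (lemma \<open>dominated_bounded_measurable\<close>):
  inner regularity of \<open>Q\<close> approximates \<open>f\<close> from below by a decreasing limit of cylinder functions,
  and weak compactness lets \<open>Ehat\<close> pass to such limits (lemma \<open>Ehat_decreasing_limit\<close>). So the upper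
  expectation may be computed with all dominated laws.

  \<^bold>\<open>Reflection.\<close> Dominated laws are stable under reflection at a fixed time \<open>t\<close> on an event of \<open>Ft t\<close>
  (lemma \<open>dominated_reflect_on\<close>), since under a dominated law the conditional expectation given the
  past is at most the nonlinear conditional expectation, and the latter does not see the reflection.
  Reflection at a stopping time with values in a grid is a finite composition of such maps, and it
  is an involution \<open>\<Phi>\<close>, because the reflected path has the same stopping time. Hence
  \<open>Ehat (X \<circ> \<Phi>) \<le> Ehat X\<close>; and the expectation of \<open>X \<circ> \<Phi>\<close> under the image of \<open>P\<close> by \<open>\<Phi>\<close> is
  \<open>E\<^sub>P X\<close>, which gives the converse (lemma \<open>Ehat_reflect_steps\<close>). A general optional time is rounded up
  to a grid; the error is bounded by the modulus of continuity of the path, whose upper expectation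
  tends to zero, again by weak compactness (lemma \<open>Ehat_reflect_optional\<close>).

  \<^bold>\<open>Symmetry.\<close> Let \<open>T\<^sub>h \<phi> x = Ehat (\<phi> (x + B h))\<close>, and let \<open>T'\<^sub>h\<close> be the same with \<open>- B h\<close>; both are
  semigroups. Averaging \<open>T\<^sub>t \<phi>\<close> over translates gives smooth functions \<open>w\<^sub>t\<close>, and sublinearity gives
  \<open>T\<^sub>h w\<^sub>t \<le> w\<^sub>t\<^sub>+\<^sub>h\<close>. For smooth \<open>w\<close> the difference \<open>w (x - y) - w (x + y)\<close> is a linear term plus an
  error of third order in \<open>y\<close>. The increment \<open>B h\<close> has mean zero, its second moment is at most a
  multiple of \<open>h\<close>, and by continuity of the paths it is large only with probability \<open>o(h)\<close>; so
  \<open>T'\<^sub>h w \<le> T\<^sub>h w + o(h)\<close>. With \<open>n\<close> steps of length \<open>1 / n\<close> this gives \<open>T'\<^sub>1 w\<^sub>0 \<le> w\<^sub>1\<close>, and hence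
  \<open>T'\<^sub>1 \<phi> \<le> T\<^sub>1 \<phi>\<close> (lemma \<open>flow_reflect_le\<close>).
\<close>

section \<open>Sigma-algebras generated by coordinates\<close>

text \<open>Both \<open>Ft t\<close> and \<open>Finf\<close> are of this form, which allows a common treatment of measurability and
  regularity with respect to the past and to the whole path.\<close>

definition path_algebra :: "real set \<Rightarrow> (real \<Rightarrow> real^'d) measure" where
  "path_algebra I = sigma Omega {B s -` A \<inter> Omega | s A. s \<in> I \<and> A \<in> sets borel}"

lemma path_algebra_generators:
  "{B s -` A \<inter> Omega | s A. s \<in> I \<and> A \<in> sets borel} \<subseteq> Pow Omega"
  by auto

lemma space_path_algebra [simp]: "space (path_algebra I) = Omega"
  by (simp add: path_algebra_def path_algebra_generators space_measure_of)

lemma sets_path_algebra: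
  "sets (path_algebra I) = sigma_sets Omega {B s -` A \<inter> Omega | s A. s \<in> I \<and> A \<in> sets borel}"
  unfolding path_algebra_def by (rule sets_measure_of[OF path_algebra_generators])

lemma sets_path_algebra_mono: "I \<subseteq> J \<Longrightarrow> sets (path_algebra I) \<subseteq> sets (path_algebra J)"
  unfolding sets_path_algebra by (rule sigma_sets_mono') blast

lemma Ft_eq_path_algebra: "Ft t = path_algebra {0..t}"
  unfolding Ft_def path_algebra_def by (rule arg_cong[where f = "sigma Omega"]) auto

lemma sets_Finf: "sets (Finf :: (real \<Rightarrow> real^'d) measure) = sets (path_algebra {0..})"
proof -
  let ?U = "\<Union>t\<in>{0..}. sets (Ft t :: (real \<Rightarrow> real^'d) measure)"
  have U: "?U \<subseteq> sets (path_algebra {0..})"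
    using sets_path_algebra_mono[of "{0..t}" "{0..}" for t] by (auto simp: Ft_eq_path_algebra)
  have sub: "?U \<subseteq> Pow Omega"
    using U sets.space_closed[of "path_algebra {0..}"] by auto
  have "sets (Finf :: (real \<Rightarrow> real^'d) measure) = sigma_sets Omega ?U"
    unfolding Finf_def by (rule sets_measure_of[OF sub])
  also have "\<dots> = sets (path_algebra {0..})"
  proof (rule antisym)
    show "sigma_sets Omega ?U \<subseteq> sets (path_algebra {0..})"
      using sets.sigma_sets_subset[OF U] by simp
    have "B s -` A \<inter> Omega \<in> ?U" if "s \<in> {0..}" "A \<in> sets borel" for s and A :: "(real^'d) set"
      using that by (intro UN_I[of s]) (auto simp: Ft_eq_path_algebra sets_path_algebra)
    then show "sets (path_algebra {0..}) \<subseteq> sigma_sets Omega ?U"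
      unfolding sets_path_algebra by (intro sigma_sets_mono') auto
  qed
  finally show ?thesis .
qed

lemma space_Finf [simp]: "space Finf = Omega"
  using sets_eq_imp_space_eq[OF sets_Finf] by simp

lemma coordinate_measurable:
  assumes "s \<in> I"
  shows "(\<lambda>\<omega>. \<omega> s) \<in> borel_measurable (path_algebra I)"
proof (rule measurableI)
  fix A :: "(real^'d) set" assume "A \<in> sets borel"
  moreover have "(\<lambda>\<omega>. \<omega> s) -` A \<inter> Omega = B s -` A \<inter> Omega"
    by (auto simp: B_def)
  ultimately show "(\<lambda>\<omega>. \<omega> s) -` A \<inter> space (path_algebra I) \<in> sets (path_algebra I)"
    using assms unfolding sets_path_algebra by auto
qed simp

lemma coordinate_measurable_Finf:
  "0 \<le> s \<Longrightarrow> (\<lambda>\<omega>. \<omega> s) \<in> borel_measurable Finf"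
  unfolding measurable_cong_sets[OF sets_Finf refl] by (rule coordinate_measurable) simp

lemma measurable_into_Finf:
  fixes f :: "'a \<Rightarrow> real \<Rightarrow> real^'d"
  assumes "\<And>x. x \<in> space M \<Longrightarrow> f x \<in> Omega"
    and "\<And>s. 0 \<le> s \<Longrightarrow> (\<lambda>x. f x s) \<in> borel_measurable M"
  shows "f \<in> measurable M Finf"
proof -
  have "f \<in> measurable M (path_algebra {0..})"
    unfolding path_algebra_def
  proof (rule measurable_measure_of)
    fix y :: "(real \<Rightarrow> real^'d) set" assume "y \<in> {B s -` A \<inter> Omega |s A. s \<in> {0..} \<and> A \<in> sets borel}"
    then obtain s A where y: "y = B s -` A \<inter> Omega" "0 \<le> s" "A \<in> sets borel" by auto
    have "f -` y \<inter> space M = (\<lambda>x. f x s) -` A \<inter> space M"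
      using assms(1) y(1) by (auto simp: B_def)
    then show "f -` y \<inter> space M \<in> sets M"
      using measurable_sets[OF assms(2)[OF y(2)] y(3)] by simp
  qed (use assms(1) in auto)
  then show ?thesis by (simp only: measurable_cong_sets[OF refl sets_Finf])
qed

text \<open>A Galmarino-type test. Applied to a path and its reflection, it shows that reflection at a stopping
  time with values in a grid leaves the stopping time unchanged.\<close>

lemma path_algebra_determined:
  assumes "A \<in> sets (path_algebra I)" "\<omega> \<in> Omega" "\<omega>' \<in> Omega" "\<And>s. s \<in> I \<Longrightarrow> \<omega> s = \<omega>' s"
  shows "\<omega> \<in> A \<longleftrightarrow> \<omega>' \<in> A"
  using assms(1) unfolding sets_path_algebra
proof induction
  case (Basic a) then show ?case using assms by (auto simp: B_def)
qed (use assms in auto)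

lemma continuous_path_eval:
  assumes "\<omega> \<in> Omega" "\<And>n. 0 \<le> r n" "0 \<le> r0" "r \<longlonglongrightarrow> r0"
  shows "(\<lambda>n. \<omega> (r n)) \<longlonglongrightarrow> \<omega> r0"
proof -
  have "continuous_on {0..} \<omega>" using assms(1) by (simp add: Omega_def)
  then show ?thesis
    using assms by (intro continuous_on_tendsto_compose[of "{0..}" \<omega> r r0]) auto
qed

lemma OmegaI: "continuous_on {0..} f \<Longrightarrow> restrict f {0..} \<in> Omega"
  unfolding Omega_def using continuous_on_cong[of "{0..}" "{0..}" "restrict f {0..}" f]
  by (intro CollectI IntI conjI) (simp_all only: restrict_extensional restrict_apply if_True simp_thms)

section \<open>Bounded Lipschitz functions\<close>

lemma Cb_Lip_seqE:
  assumes "\<phi> \<in> Cb_Lip_seq n"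
  obtains L M where "0 \<le> L" "0 \<le> M" "\<And>x. \<bar>\<phi> x\<bar> \<le> M"
    "\<And>x y. \<bar>\<phi> x - \<phi> y\<bar> \<le> L * L2_set (\<lambda>i. norm (x i - y i)) {..<n}"
proof -
  from assms obtain L where L: "\<And>x y. \<bar>\<phi> x - \<phi> y\<bar> \<le> L * L2_set (\<lambda>i. norm (x i - y i)) {..<n}"
    and b: "bounded (range \<phi>)" by (auto simp: Cb_Lip_seq_def)
  obtain M where M: "\<And>x. \<bar>\<phi> x\<bar> \<le> M" using b by (auto simp: bounded_iff)
  have "\<bar>\<phi> x - \<phi> y\<bar> \<le> max L 0 * L2_set (\<lambda>i. norm (x i - y i)) {..<n}" for x y
    using L[of x y] mult_right_mono[of L "max L 0" "L2_set (\<lambda>i. norm (x i - y i)) {..<n}"]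
    by (simp add: L2_set_nonneg)
  moreover have "\<bar>\<phi> x\<bar> \<le> max M 0" for x using M[of x] by simp
  ultimately show thesis by (intro that[of "max L 0" "max M 0"]) simp_all
qed

text \<open>Sums over the arguments are easier to handle than the Euclidean norm; passing from one to the
  other costs a factor \<open>n\<close>.\<close>

lemma Cb_Lip_seqI:
  assumes "\<And>x. \<bar>\<phi> x\<bar> \<le> M"
    and "\<And>x y. \<bar>\<phi> x - \<phi> y\<bar> \<le> L * (\<Sum>i<n. norm (x i - y i))" and "0 \<le> L"
  shows "\<phi> \<in> Cb_Lip_seq n"
proof -
  have "\<bar>\<phi> x - \<phi> y\<bar> \<le> (L * n) * L2_set (\<lambda>i. norm (x i - y i)) {..<n}" for x y
  proof -
    have "(\<Sum>i<n. norm (x i - y i)) \<le> n * L2_set (\<lambda>i. norm (x i - y i)) {..<n}"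
      using sum_bounded_above[of "{..<n}" "\<lambda>i. norm (x i - y i)" "L2_set (\<lambda>i. norm (x i - y i)) {..<n}"]
        member_le_L2_set[of "{..<n}"] by fastforce
    then have "L * (\<Sum>i<n. norm (x i - y i)) \<le> L * (n * L2_set (\<lambda>i. norm (x i - y i)) {..<n})"
      using assms(3) by (rule mult_left_mono)
    with assms(2)[of x y] show ?thesis by (simp add: mult.assoc)
  qed
  then show ?thesis using assms(1) by (auto simp: Cb_Lip_seq_def bounded_iff)
qed

lemma Cb_Lip_seq_sum_bound:
  fixes \<phi> :: "(nat \<Rightarrow> 'b::real_normed_vector) \<Rightarrow> real"
  assumes "\<phi> \<in> Cb_Lip_seq n"
  obtains L M where "0 \<le> L" "0 \<le> M" "\<And>x. \<bar>\<phi> x\<bar> \<le> M"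
    "\<And>x y. \<bar>\<phi> x - \<phi> y\<bar> \<le> L * (\<Sum>i<n. norm (x i - y i))"
proof -
  from assms obtain L M where *: "0 \<le> L" "0 \<le> M" "\<And>x. \<bar>\<phi> x\<bar> \<le> M"
    "\<And>x y. \<bar>\<phi> x - \<phi> y\<bar> \<le> L * L2_set (\<lambda>i. norm (x i - y i)) {..<n}"
    using Cb_Lip_seqE[OF assms] by blast
  have "\<bar>\<phi> x - \<phi> y\<bar> \<le> L * (\<Sum>i<n. norm (x i - y i))" for x y
    using *(4)[of x y] mult_left_mono[OF L2_set_le_sum[of "{..<n}" "\<lambda>i. norm (x i - y i)"] *(1)] by simp
  with * that show thesis by blast
qed

lemma Cb_Lip_seq_cong:
  fixes \<phi> :: "(nat \<Rightarrow> 'b::real_normed_vector) \<Rightarrow> real"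
  assumes "\<phi> \<in> Cb_Lip_seq n" "\<And>i. i < n \<Longrightarrow> x i = y i"
  shows "\<phi> x = \<phi> y"
proof -
  obtain L M where "0 \<le> L" "0 \<le> M" "\<And>x. \<bar>\<phi> x\<bar> \<le> M"
    and L: "\<And>x y. \<bar>\<phi> x - \<phi> y\<bar> \<le> L * (\<Sum>i<n. norm (x i - y i))"
    using Cb_Lip_seq_sum_bound[OF assms(1)] by blast
  have "(\<Sum>i<n. norm (x i - y i)) = 0" by (rule sum.neutral) (simp add: assms(2))
  with L[of x y] show ?thesis by simp
qed

lemma Cb_LipE:
  assumes "\<phi> \<in> Cb_Lip"
  obtains L M where "0 \<le> L" "0 \<le> M" "\<And>x. \<bar>\<phi> x\<bar> \<le> M" "\<And>x y. \<bar>\<phi> x - \<phi> y\<bar> \<le> L * dist x y"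
proof -
  from assms obtain L where L: "L-lipschitz_on UNIV \<phi>"
    and b: "bounded (range \<phi>)" by (auto simp: Cb_Lip_def)
  obtain M where M: "\<And>x. \<bar>\<phi> x\<bar> \<le> M" using b by (auto simp: bounded_iff)
  have "0 \<le> M" using M[of undefined] by linarith
  then show thesis using that[of L M] M L lipschitz_onD[OF L] lipschitz_on_nonneg[OF L]
    by (simp add: dist_real_def)
qed

lemma Cb_LipI:
  fixes \<phi> :: "'b::metric_space \<Rightarrow> real"
  assumes "\<And>x. \<bar>\<phi> x\<bar> \<le> M" "\<And>x y. \<bar>\<phi> x - \<phi> y\<bar> \<le> L * dist x y" "0 \<le> L"
  shows "\<phi> \<in> Cb_Lip"
proof -
  have "L-lipschitz_on UNIV \<phi>"
    using assms by (intro lipschitz_onI) (auto simp: dist_real_def)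
  then show ?thesis unfolding Cb_Lip_def using assms(1) by (auto simp: bounded_iff)
qed

lemma Cb_Lip_continuous: "\<phi> \<in> Cb_Lip \<Longrightarrow> continuous_on UNIV \<phi>"
  by (erule Cb_LipE) (rule lipschitz_on_continuous_on, rule lipschitz_onI, auto simp: dist_real_def)

text \<open>A Lipschitz function of finitely many entries is continuous in the product topology, and on
  sequences in a second countable space the Borel sets of that topology form the product
  sigma-algebra.\<close>

lemma Cb_Lip_seq_measurable:
  fixes Y :: "nat \<Rightarrow> 'a \<Rightarrow> 'b::{second_countable_topology, real_normed_vector}"
  assumes "\<phi> \<in> Cb_Lip_seq n" "\<And>i. i < n \<Longrightarrow> Y i \<in> borel_measurable M"
  shows "(\<lambda>w. \<phi> (\<lambda>i. Y i w)) \<in> borel_measurable M"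
proof -
  obtain L K where L: "0 \<le> L" "0 \<le> K" "\<And>x. \<bar>\<phi> x\<bar> \<le> K"
    "\<And>x y. \<bar>\<phi> x - \<phi> y\<bar> \<le> L * (\<Sum>i<n. norm (x i - y i))"
    using Cb_Lip_seq_sum_bound[OF assms(1)] by blast
  have "(\<phi> \<longlongrightarrow> \<phi> x) (at x)" for x
  proof -
    have "((\<lambda>y :: nat \<Rightarrow> 'b. y i) \<longlongrightarrow> x i) (at x)" for i
      using continuous_on_product_coordinates[of i] unfolding continuous_on_def by blast
    then have "((\<lambda>y. L * (\<Sum>i<n. norm (y i - x i))) \<longlongrightarrow> L * (\<Sum>i<n. norm (x i - x i))) (at x)"
      by (intro tendsto_intros) auto
    then have "((\<lambda>y. L * (\<Sum>i<n. norm (y i - x i))) \<longlongrightarrow> 0) (at x)" by simp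
    then have "((\<lambda>y. \<phi> y - \<phi> x) \<longlongrightarrow> 0) (at x)"
      by (rule Lim_null_comparison[rotated]) (intro always_eventually allI, simp add: L(4))
    then show ?thesis by (rule LIM_zero_cancel)
  qed
  then have "continuous_on UNIV \<phi>" unfolding continuous_on_def by blast
  then have 1: "\<phi> \<in> borel_measurable borel" by (rule borel_measurable_continuous_onI)
  have "(\<lambda>w i. if i < n then Y i w else 0) \<in> measurable M (Pi\<^sub>M UNIV (\<lambda>_. borel))"
  proof (rule measurable_PiM_single')
    show "(\<lambda>w. if i < n then Y i w else 0) \<in> borel_measurable M" for i
      using assms(2) by (cases "i < n") simp_all
  qed simp
  then have 2: "(\<lambda>w i. if i < n then Y i w else 0) \<in> measurable M borel"
    by (simp only: measurable_cong_sets[OF refl sets_PiM_equal_borel])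
  have 3: "(\<lambda>w. \<phi> (\<lambda>i. if i < n then Y i w else 0)) \<in> borel_measurable M"
    using measurable_compose[OF 2 1] .
  have "\<phi> (\<lambda>i. if i < n then Y i w else 0) = \<phi> (\<lambda>i. Y i w)" for w
    by (rule Cb_Lip_seq_cong[OF assms(1)]) auto
  with 3 show ?thesis by simp
qed

section \<open>Cylinder functions\<close>

text \<open>Cylinder functions are described by the times at which they evaluate the path, without choosing
  an increasing enumeration of these times. This makes them visibly a vector lattice and an
  algebra, and keeps functions of pasted and reflected paths in the class.\<close>

definition finitely_Lipschitz ::
  "real set \<Rightarrow> ((real \<Rightarrow> real^'d) \<Rightarrow> 'b::real_normed_vector) \<Rightarrow> bool" where
  "finitely_Lipschitz I Y \<longleftrightarrow> (\<exists>S L. finite S \<and> S \<subseteq> I \<and> 0 \<le> L \<and>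
     (\<forall>\<omega>\<in>Omega. \<forall>\<omega>'\<in>Omega. norm (Y \<omega> - Y \<omega>') \<le> L * (\<Sum>s\<in>S. norm (\<omega> s - \<omega>' s))))"

definition cylinder :: "real set \<Rightarrow> ((real \<Rightarrow> real^'d) \<Rightarrow> real) set" where
  "cylinder I = {X. (\<exists>M. \<forall>\<omega>\<in>Omega. \<bar>X \<omega>\<bar> \<le> M) \<and> finitely_Lipschitz I X}"

lemma finitely_LipschitzI:
  assumes "finite S" "S \<subseteq> I" "0 \<le> L"
    "\<And>\<omega> \<omega>'. \<omega> \<in> Omega \<Longrightarrow> \<omega>' \<in> Omega \<Longrightarrow> norm (Y \<omega> - Y \<omega>') \<le> L * (\<Sum>s\<in>S. norm (\<omega> s - \<omega>' s))"
  shows "finitely_Lipschitz I Y"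
  using assms unfolding finitely_Lipschitz_def by blast

lemma finitely_LipschitzE:
  assumes "finitely_Lipschitz I Y"
  obtains S L where "finite S" "S \<subseteq> I" "0 \<le> L"
    "\<And>\<omega> \<omega>'. \<omega> \<in> Omega \<Longrightarrow> \<omega>' \<in> Omega \<Longrightarrow> norm (Y \<omega> - Y \<omega>') \<le> L * (\<Sum>s\<in>S. norm (\<omega> s - \<omega>' s))"
  using assms unfolding finitely_Lipschitz_def by blast

lemma finitely_Lipschitz_mono: "finitely_Lipschitz I Y \<Longrightarrow> I \<subseteq> J \<Longrightarrow> finitely_Lipschitz J Y"
  unfolding finitely_Lipschitz_def by (meson subset_trans)

lemma finitely_Lipschitz_coordinate: "s \<in> I \<Longrightarrow> finitely_Lipschitz I (\<lambda>\<omega>. \<omega> s)"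
  by (rule finitely_LipschitzI[of "{s}" _ 1]) auto

lemma finitely_Lipschitz_const: "finitely_Lipschitz I (\<lambda>\<omega>. c)"
  by (rule finitely_LipschitzI[of "{}" _ 0]) auto

lemma finitely_Lipschitz_bound2:
  fixes Y :: "(real \<Rightarrow> real^'d) \<Rightarrow> 'b::real_normed_vector"
    and Z :: "(real \<Rightarrow> real^'d) \<Rightarrow> 'c::real_normed_vector"
    and W :: "(real \<Rightarrow> real^'d) \<Rightarrow> 'e::real_normed_vector"
  assumes Y: "finitely_Lipschitz I Y" and Z: "finitely_Lipschitz I Z" and "0 \<le> K"
    and W: "\<And>\<omega> \<omega>'. \<omega> \<in> Omega \<Longrightarrow> \<omega>' \<in> Omega \<Longrightarrow>
      norm (W \<omega> - W \<omega>') \<le> K * (norm (Y \<omega> - Y \<omega>') + norm (Z \<omega> - Z \<omega>'))"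
  shows "finitely_Lipschitz I W"
proof -
  obtain S L where 1: "finite S" "S \<subseteq> I" "0 \<le> L"
    "\<And>\<omega> \<omega>'. \<omega> \<in> Omega \<Longrightarrow> \<omega>' \<in> Omega \<Longrightarrow> norm (Y \<omega> - Y \<omega>') \<le> L * (\<Sum>s\<in>S. norm (\<omega> s - \<omega>' s))"
    using finitely_LipschitzE[OF Y] by blast
  obtain S' L' where 2: "finite S'" "S' \<subseteq> I" "0 \<le> L'"
    "\<And>\<omega> \<omega>'. \<omega> \<in> Omega \<Longrightarrow> \<omega>' \<in> Omega \<Longrightarrow> norm (Z \<omega> - Z \<omega>') \<le> L' * (\<Sum>s\<in>S'. norm (\<omega> s - \<omega>' s))"
    using finitely_LipschitzE[OF Z] by blast
  show ?thesis
  proof (rule finitely_LipschitzI[of "S \<union> S'" _ "K * (L + L')"])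
    fix \<omega> \<omega>' :: "real \<Rightarrow> real^'d" assume om: "\<omega> \<in> Omega" "\<omega>' \<in> Omega"
    let ?s = "\<lambda>S. \<Sum>s\<in>S. norm (\<omega> s - \<omega>' s)"
    have "?s S \<le> ?s (S \<union> S')" "?s S' \<le> ?s (S \<union> S')"
      using 1 2 by (auto intro!: sum_mono2)
    then have "L * ?s S \<le> L * ?s (S \<union> S')" "L' * ?s S' \<le> L' * ?s (S \<union> S')"
      using 1(3) 2(3) by (auto intro: mult_left_mono)
    then have "norm (Y \<omega> - Y \<omega>') + norm (Z \<omega> - Z \<omega>') \<le> (L + L') * ?s (S \<union> S')"
      using 1(4)[OF om] 2(4)[OF om] by (simp add: distrib_right)
    then have "K * (norm (Y \<omega> - Y \<omega>') + norm (Z \<omega> - Z \<omega>')) \<le> K * ((L + L') * ?s (S \<union> S'))"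
      using \<open>0 \<le> K\<close> by (rule mult_left_mono)
    with W[OF om] show "norm (W \<omega> - W \<omega>') \<le> K * (L + L') * ?s (S \<union> S')"
      by (simp add: mult.assoc)
  qed (use 1 2 \<open>0 \<le> K\<close> in auto)
qed

lemma finitely_Lipschitz_add:
  assumes "finitely_Lipschitz I Y" "finitely_Lipschitz I Z"
  shows "finitely_Lipschitz I (\<lambda>\<omega>. Y \<omega> + Z \<omega>)"
  by (rule finitely_Lipschitz_bound2[OF assms, of 1]) (simp_all add: add_diff_add norm_triangle_ineq)

lemma finitely_Lipschitz_scaleR:
  assumes "finitely_Lipschitz I Y"
  shows "finitely_Lipschitz I (\<lambda>\<omega>. c *\<^sub>R Y \<omega>)"
  by (rule finitely_Lipschitz_bound2[OF assms assms, of "\<bar>c\<bar>"])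
    (auto simp flip: scaleR_diff_right intro!: mult_left_mono)

lemma finitely_Lipschitz_diff:
  assumes "finitely_Lipschitz I Y" "finitely_Lipschitz I Z"
  shows "finitely_Lipschitz I (\<lambda>\<omega>. Y \<omega> - Z \<omega>)"
  using finitely_Lipschitz_add[OF assms(1) finitely_Lipschitz_scaleR[OF assms(2), of "-1"]] by simp

lemma finitely_Lipschitz_dominated:
  fixes Y :: "'i \<Rightarrow> (real \<Rightarrow> real^'d) \<Rightarrow> 'b::real_normed_vector"
  assumes A: "finite A" and Y: "\<And>i. i \<in> A \<Longrightarrow> finitely_Lipschitz I (Y i)" and "0 \<le> L"
    and W: "\<And>\<omega> \<omega>'. \<omega> \<in> Omega \<Longrightarrow> \<omega>' \<in> Omega \<Longrightarrow>
      norm (W \<omega> - W \<omega>') \<le> L * (\<Sum>i\<in>A. norm (Y i \<omega> - Y i \<omega>'))"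
  shows "finitely_Lipschitz I W"
proof -
  have "\<exists>SK. finite (fst SK) \<and> fst SK \<subseteq> I \<and> 0 \<le> snd SK \<and> (\<forall>\<omega>\<in>Omega. \<forall>\<omega>'\<in>Omega.
      norm (Y i \<omega> - Y i \<omega>') \<le> snd SK * (\<Sum>s\<in>fst SK. norm (\<omega> s - \<omega>' s)))" if "i \<in> A" for i
    using Y[OF that] unfolding finitely_Lipschitz_def by simp
  then have "\<forall>i\<in>A. \<exists>SK. finite (fst SK) \<and> fst SK \<subseteq> I \<and> 0 \<le> snd SK \<and> (\<forall>\<omega>\<in>Omega. \<forall>\<omega>'\<in>Omega.
      norm (Y i \<omega> - Y i \<omega>') \<le> snd SK * (\<Sum>s\<in>fst SK. norm (\<omega> s - \<omega>' s)))"
    by (rule ballI)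
  from bchoice[OF this] obtain SK where SK: "\<forall>i\<in>A. finite (fst (SK i)) \<and> fst (SK i) \<subseteq> I \<and> 0 \<le> snd (SK i) \<and>
      (\<forall>\<omega>\<in>Omega. \<forall>\<omega>'\<in>Omega.
        norm (Y i \<omega> - Y i \<omega>') \<le> snd (SK i) * (\<Sum>s\<in>fst (SK i). norm (\<omega> s - \<omega>' s)))"
    by (elim exE)
  define S where "S i = fst (SK i)" for i
  define K where "K i = snd (SK i)" for i
  have S: "\<And>i. i \<in> A \<Longrightarrow> finite (S i)" "\<And>i. i \<in> A \<Longrightarrow> S i \<subseteq> I"
    and K: "\<And>i. i \<in> A \<Longrightarrow> 0 \<le> K i"
    and YK: "\<And>i \<omega> \<omega>'. i \<in> A \<Longrightarrow> \<omega> \<in> Omega \<Longrightarrow> \<omega>' \<in> Omega \<Longrightarrow>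
      norm (Y i \<omega> - Y i \<omega>') \<le> K i * (\<Sum>s\<in>S i. norm (\<omega> s - \<omega>' s))"
    using SK unfolding S_def K_def by blast+
  show ?thesis
  proof (rule finitely_LipschitzI[of "\<Union>(S ` A)" _ "L * sum K A"])
    show "finite (\<Union>(S ` A))" using A S(1) by blast
    show "\<Union>(S ` A) \<subseteq> I" using S(2) by blast
    show "0 \<le> L * sum K A" using \<open>0 \<le> L\<close> K by (simp add: sum_nonneg)
    fix \<omega> \<omega>' :: "real \<Rightarrow> real^'d" assume om: "\<omega> \<in> Omega" "\<omega>' \<in> Omega"
    let ?s = "\<lambda>S. \<Sum>s\<in>S. norm (\<omega> s - \<omega>' s)"
    have "(\<Sum>i\<in>A. norm (Y i \<omega> - Y i \<omega>')) \<le> (\<Sum>i\<in>A. K i * ?s (\<Union>(S ` A)))"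
    proof (rule sum_mono)
      fix i assume i: "i \<in> A"
      have "?s (S i) \<le> ?s (\<Union>(S ` A))" using A S(1) i by (intro sum_mono2) auto
      then have "K i * ?s (S i) \<le> K i * ?s (\<Union>(S ` A))" using K[OF i] by (rule mult_left_mono)
      with YK[OF i om] show "norm (Y i \<omega> - Y i \<omega>') \<le> K i * ?s (\<Union>(S ` A))" by (rule order_trans)
    qed
    then have "L * (\<Sum>i\<in>A. norm (Y i \<omega> - Y i \<omega>')) \<le> L * (sum K A * ?s (\<Union>(S ` A)))"
      using \<open>0 \<le> L\<close> by (intro mult_left_mono) (simp_all add: sum_distrib_right)
    with W[OF om] show "norm (W \<omega> - W \<omega>') \<le> L * sum K A * ?s (\<Union>(S ` A))"
      by (simp add: mult.assoc)
  qed
qed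

lemma cylinderI:
  "\<lbrakk>\<And>\<omega>. \<omega> \<in> Omega \<Longrightarrow> \<bar>X \<omega>\<bar> \<le> M; finitely_Lipschitz I X\<rbrakk> \<Longrightarrow> X \<in> cylinder I"
  unfolding cylinder_def by blast

lemma cylinder_bounded:
  assumes "X \<in> cylinder I"
  obtains M where "0 \<le> M" "\<And>\<omega>. \<omega> \<in> Omega \<Longrightarrow> \<bar>X \<omega>\<bar> \<le> M"
proof -
  obtain M where M: "\<And>\<omega>. \<omega> \<in> Omega \<Longrightarrow> \<bar>X \<omega>\<bar> \<le> M"
    using assms unfolding cylinder_def by blast
  then have "\<bar>X \<omega>\<bar> \<le> max M 0" if "\<omega> \<in> Omega" for \<omega> using that by (simp add: max.coboundedI1)
  then show thesis by (intro that[of "max M 0"]) simp_all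
qed

lemma cylinder_finitely_Lipschitz: "X \<in> cylinder I \<Longrightarrow> finitely_Lipschitz I X"
  by (simp add: cylinder_def)

lemma cylinder_mono: "X \<in> cylinder I \<Longrightarrow> I \<subseteq> J \<Longrightarrow> X \<in> cylinder J"
  unfolding cylinder_def using finitely_Lipschitz_mono by blast

lemma cylinder_const: "(\<lambda>\<omega>. c) \<in> cylinder I"
  by (rule cylinderI[of _ "\<bar>c\<bar>"]) (simp_all add: finitely_Lipschitz_const)

lemma cylinder_bound2:
  assumes X: "X \<in> cylinder I" and Y: "Y \<in> cylinder I"
    and F: "\<And>M. 0 \<le> M \<Longrightarrow> \<exists>K\<ge>0. \<forall>a b a' b'. \<bar>a\<bar> \<le> M \<and> \<bar>b\<bar> \<le> M \<and> \<bar>a'\<bar> \<le> M \<and> \<bar>b'\<bar> \<le> M \<longrightarrow>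
      \<bar>F a b - F a' b'\<bar> \<le> K * (\<bar>a - a'\<bar> + \<bar>b - b'\<bar>)"
  shows "(\<lambda>\<omega>. F (X \<omega>) (Y \<omega>)) \<in> cylinder I"
proof -
  obtain M1 where M1: "0 \<le> M1" "\<And>\<omega>. \<omega> \<in> Omega \<Longrightarrow> \<bar>X \<omega>\<bar> \<le> M1" using cylinder_bounded[OF X] by blast
  obtain M2 where M2: "0 \<le> M2" "\<And>\<omega>. \<omega> \<in> Omega \<Longrightarrow> \<bar>Y \<omega>\<bar> \<le> M2" using cylinder_bounded[OF Y] by blast
  let ?M = "M1 + M2"
  have M: "\<bar>X \<omega>\<bar> \<le> ?M" "\<bar>Y \<omega>\<bar> \<le> ?M" if "\<omega> \<in> Omega" for \<omega>
    using M1(2)[OF that] M2(2)[OF that] M1(1) M2(1) by linarith+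
  obtain K where K: "0 \<le> K" and
    KF: "\<And>a b a' b'. \<bar>a\<bar> \<le> ?M \<Longrightarrow> \<bar>b\<bar> \<le> ?M \<Longrightarrow> \<bar>a'\<bar> \<le> ?M \<Longrightarrow> \<bar>b'\<bar> \<le> ?M \<Longrightarrow>
      \<bar>F a b - F a' b'\<bar> \<le> K * (\<bar>a - a'\<bar> + \<bar>b - b'\<bar>)"
    using F[of ?M] M1(1) M2(1) by auto
  show ?thesis
  proof (rule cylinderI[of _ "\<bar>F 0 0\<bar> + K * (?M + ?M)"])
    fix \<omega> :: "real \<Rightarrow> real^'a" assume om: "\<omega> \<in> Omega"
    have "\<bar>F (X \<omega>) (Y \<omega>) - F 0 0\<bar> \<le> K * (\<bar>X \<omega> - 0\<bar> + \<bar>Y \<omega> - 0\<bar>)"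
      using M[OF om] M1(1) M2(1) by (intro KF) auto
    also have "\<dots> \<le> K * (?M + ?M)" using M[OF om] K by (intro mult_left_mono) auto
    finally show "\<bar>F (X \<omega>) (Y \<omega>)\<bar> \<le> \<bar>F 0 0\<bar> + K * (?M + ?M)" by linarith
  next
    have "norm (F (X \<omega>) (Y \<omega>) - F (X \<omega>') (Y \<omega>')) \<le> K * (norm (X \<omega> - X \<omega>') + norm (Y \<omega> - Y \<omega>'))"
      if "\<omega> \<in> Omega" "\<omega>' \<in> Omega" for \<omega> \<omega>'
      using KF[OF M(1)[OF that(1)] M(2)[OF that(1)] M(1)[OF that(2)] M(2)[OF that(2)]] by simp
    then show "finitely_Lipschitz I (\<lambda>\<omega>. F (X \<omega>) (Y \<omega>))"
      by (rule finitely_Lipschitz_bound2[OF cylinder_finitely_Lipschitz[OF X]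
            cylinder_finitely_Lipschitz[OF Y] K])
  qed
qed

lemma cylinder_add: "X \<in> cylinder I \<Longrightarrow> Y \<in> cylinder I \<Longrightarrow> (\<lambda>\<omega>. X \<omega> + Y \<omega>) \<in> cylinder I"
  by (rule cylinder_bound2, assumption+) (auto intro!: exI[of _ 1])

lemma cylinder_diff: "X \<in> cylinder I \<Longrightarrow> Y \<in> cylinder I \<Longrightarrow> (\<lambda>\<omega>. X \<omega> - Y \<omega>) \<in> cylinder I"
  by (rule cylinder_bound2, assumption+) (auto intro!: exI[of _ 1])

lemma cylinder_max: "X \<in> cylinder I \<Longrightarrow> Y \<in> cylinder I \<Longrightarrow> (\<lambda>\<omega>. max (X \<omega>) (Y \<omega>)) \<in> cylinder I"
  by (rule cylinder_bound2, assumption+) (auto intro!: exI[of _ 1])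

lemma cylinder_mult:
  assumes "X \<in> cylinder I" "Y \<in> cylinder I"
  shows "(\<lambda>\<omega>. X \<omega> * Y \<omega>) \<in> cylinder I"
proof (rule cylinder_bound2[OF assms])
  fix M :: real assume M: "0 \<le> M"
  have "\<bar>a * b - a' * b'\<bar> \<le> M * (\<bar>a - a'\<bar> + \<bar>b - b'\<bar>)"
    if "\<bar>b\<bar> \<le> M" "\<bar>a'\<bar> \<le> M" for a b a' b' :: real
  proof -
    have "\<bar>a * b - a' * b'\<bar> = \<bar>(a - a') * b + a' * (b - b')\<bar>" by (simp add: algebra_simps)
    also have "\<dots> \<le> \<bar>a - a'\<bar> * \<bar>b\<bar> + \<bar>a'\<bar> * \<bar>b - b'\<bar>"
      by (simp flip: abs_mult)
    also have "\<dots> \<le> \<bar>a - a'\<bar> * M + M * \<bar>b - b'\<bar>"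
      using that by (intro add_mono mult_left_mono mult_right_mono) auto
    finally show ?thesis by (simp add: algebra_simps)
  qed
  with M show "\<exists>K\<ge>0. \<forall>a b a' b'. \<bar>a\<bar> \<le> M \<and> \<bar>b\<bar> \<le> M \<and> \<bar>a'\<bar> \<le> M \<and> \<bar>b'\<bar> \<le> M \<longrightarrow>
      \<bar>a * b - a' * b'\<bar> \<le> K * (\<bar>a - a'\<bar> + \<bar>b - b'\<bar>)"
    by blast
qed

lemma cylinder_scale: "X \<in> cylinder I \<Longrightarrow> (\<lambda>\<omega>. c * X \<omega>) \<in> cylinder I"
  using cylinder_mult[OF cylinder_const] .

lemma cylinder_sum:
  assumes "\<And>i. i \<in> A \<Longrightarrow> X i \<in> cylinder I"
  shows "(\<lambda>\<omega>. \<Sum>i\<in>A. X i \<omega>) \<in> cylinder I"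
  using assms by (induction A rule: infinite_finite_induct) (simp_all add: cylinder_const cylinder_add)

lemma cylinder_Cb_Lip_seq:
  fixes Y :: "nat \<Rightarrow> (real \<Rightarrow> real^'d) \<Rightarrow> 'b::real_normed_vector"
  assumes \<phi>: "\<phi> \<in> Cb_Lip_seq n" and Y: "\<And>i. i < n \<Longrightarrow> finitely_Lipschitz I (Y i)"
  shows "(\<lambda>\<omega>. \<phi> (\<lambda>i. Y i \<omega>)) \<in> cylinder I"
proof -
  obtain L M where L: "0 \<le> L" "0 \<le> M" "\<And>x. \<bar>\<phi> x\<bar> \<le> M"
    "\<And>x y. \<bar>\<phi> x - \<phi> y\<bar> \<le> L * (\<Sum>i<n. norm (x i - y i))"
    using Cb_Lip_seq_sum_bound[OF \<phi>] by blast
  have "finitely_Lipschitz I (\<lambda>\<omega>. \<phi> (\<lambda>i. Y i \<omega>))"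
  proof (rule finitely_Lipschitz_dominated[OF finite_lessThan[of n] _ L(1)])
    show "finitely_Lipschitz I (Y i)" if "i \<in> {..<n}" for i using that by (simp add: Y)
    show "norm (\<phi> (\<lambda>i. Y i \<omega>) - \<phi> (\<lambda>i. Y i \<omega>')) \<le> L * (\<Sum>i<n. norm (Y i \<omega> - Y i \<omega>'))"
      for \<omega> \<omega>' unfolding real_norm_def by (rule L(4))
  qed
  then show ?thesis using L(3) by (intro cylinderI[of _ M]) auto
qed

lemma cylinder_compose:
  assumes X: "X \<in> cylinder I" and \<Phi>: "\<And>\<omega>. \<omega> \<in> Omega \<Longrightarrow> \<Phi> \<omega> \<in> Omega"
    and \<Phi>s: "\<And>s. s \<in> I \<Longrightarrow> finitely_Lipschitz J (\<lambda>\<omega>. \<Phi> \<omega> s)"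
  shows "(\<lambda>\<omega>. X (\<Phi> \<omega>)) \<in> cylinder J"
proof -
  obtain S L where S: "finite S" "S \<subseteq> I" "0 \<le> L"
    "\<And>\<omega> \<omega>'. \<omega> \<in> Omega \<Longrightarrow> \<omega>' \<in> Omega \<Longrightarrow> norm (X \<omega> - X \<omega>') \<le> L * (\<Sum>s\<in>S. norm (\<omega> s - \<omega>' s))"
    using finitely_LipschitzE[OF cylinder_finitely_Lipschitz[OF X]] by blast
  obtain M where M: "\<And>\<omega>. \<omega> \<in> Omega \<Longrightarrow> \<bar>X \<omega>\<bar> \<le> M" using cylinder_bounded[OF X] by blast
  have "finitely_Lipschitz J (\<lambda>\<omega>. X (\<Phi> \<omega>))"
  proof (rule finitely_Lipschitz_dominated[OF S(1) _ S(3)])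
    show "finitely_Lipschitz J (\<lambda>\<omega>. \<Phi> \<omega> s)" if "s \<in> S" for s using that S(2) by (blast intro: \<Phi>s)
    show "norm (X (\<Phi> \<omega>) - X (\<Phi> \<omega>')) \<le> L * (\<Sum>s\<in>S. norm (\<Phi> \<omega> s - \<Phi> \<omega>' s))"
      if "\<omega> \<in> Omega" "\<omega>' \<in> Omega" for \<omega> \<omega>' by (intro S(4) \<Phi> that)
  qed
  moreover have "\<bar>X (\<Phi> \<omega>)\<bar> \<le> M" if "\<omega> \<in> Omega" for \<omega> by (intro M \<Phi> that)
  ultimately show ?thesis by (rule cylinderI[rotated])
qed

lemma cylinder_Cb_Lip:
  fixes \<phi> :: "real^'d \<Rightarrow> real"
  assumes \<phi>: "\<phi> \<in> Cb_Lip" and Y: "finitely_Lipschitz I Y"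
  shows "(\<lambda>\<omega>. \<phi> (Y \<omega>)) \<in> cylinder I"
proof -
  obtain L M where L: "0 \<le> L" "0 \<le> M" "\<And>x. \<bar>\<phi> x\<bar> \<le> M" "\<And>x y. \<bar>\<phi> x - \<phi> y\<bar> \<le> L * dist x y"
    using Cb_LipE[OF \<phi>] by blast
  have "(\<lambda>x. \<phi> (x 0)) \<in> Cb_Lip_seq 1"
    using L by (intro Cb_Lip_seqI[of _ M L]) (auto simp: dist_norm)
  from cylinder_Cb_Lip_seq[OF this, of I "\<lambda>_. Y"] Y show ?thesis by simp
qed

section \<open>Operations on paths\<close>

text \<open>The past up to \<open>t\<close> is taken from the first path and the increments after \<open>t\<close> from the second;
  the minimum and the maximum select the two regimes without a case distinction.\<close>

definition paste :: "real \<Rightarrow> (real \<Rightarrow> real^'d) \<Rightarrow> (real \<Rightarrow> real^'d) \<Rightarrow> real \<Rightarrow> real^'d" where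
  "paste t \<omega> \<omega>' = restrict (\<lambda>s. \<omega> (min s t) + (\<omega>' (max s t) - \<omega>' t)) {0..}"

definition reflect :: "real \<Rightarrow> (real \<Rightarrow> real^'d) \<Rightarrow> real \<Rightarrow> real^'d" where
  "reflect t \<omega> = restrict (\<lambda>s. 2 *\<^sub>R \<omega> (min s t) - \<omega> s) {0..}"

lemma continuous_on_path_compose:
  assumes "\<omega> \<in> Omega" "continuous_on {0..} f" "\<And>s. 0 \<le> s \<Longrightarrow> 0 \<le> f s"
  shows "continuous_on {0..} (\<lambda>s. \<omega> (f s))"
proof -
  have "continuous_on {0..} \<omega>" "f ` {0..} \<subseteq> {0..}" using assms(1,3) by (auto simp: Omega_def)
  then show ?thesis by (rule continuous_on_compose2[OF _ assms(2)])
qed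

lemma paste_in_Omega:
  assumes "\<omega> \<in> Omega" "\<omega>' \<in> Omega" "0 \<le> t" shows "paste t \<omega> \<omega>' \<in> Omega"
  unfolding paste_def using assms(3)
  by (intro OmegaI continuous_on_add continuous_on_diff continuous_on_const
      continuous_on_path_compose[OF assms(1)] continuous_on_path_compose[OF assms(2)]
      continuous_intros) auto

lemma reflect_in_Omega:
  assumes "\<omega> \<in> Omega" "0 \<le> t" shows "reflect t \<omega> \<in> Omega"
proof -
  have "continuous_on {0..} \<omega>" using assms(1) by (simp add: Omega_def)
  then show ?thesis
    unfolding reflect_def using assms(2)
    by (intro OmegaI continuous_on_diff continuous_on_scaleR continuous_on_const
        continuous_on_path_compose[OF assms(1)] continuous_intros) auto
qed

text \<open>Lagrange interpolation gives a path with prescribed values at finitely many times.\<close>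

definition interpolate :: "real set \<Rightarrow> (real \<Rightarrow> real^'d) \<Rightarrow> real \<Rightarrow> real^'d" where
  "interpolate S v = restrict (\<lambda>r. \<Sum>s\<in>S. (\<Prod>q\<in>S - {s}. (r - q) / (s - q)) *\<^sub>R v s) {0..}"

lemma interpolate_in_Omega: "interpolate S v \<in> Omega"
  unfolding interpolate_def divide_inverse by (intro OmegaI continuous_intros)

lemma interpolate_eq:
  assumes "finite S" "S \<subseteq> {0..}" "r \<in> S"
  shows "interpolate S v r = v r"
proof -
  have "(\<Sum>s\<in>S. (\<Prod>q\<in>S - {s}. (r - q) / (s - q)) *\<^sub>R v s) =
      (\<Sum>s\<in>S. (if s = r then v s else 0))"
  proof (rule sum.cong)
    fix s assume s: "s \<in> S"
    show "(\<Prod>q\<in>S - {s}. (r - q) / (s - q)) *\<^sub>R v s = (if s = r then v s else 0)"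
    proof (cases "s = r")
      case True
      have "(\<Prod>q\<in>S - {s}. (r - q) / (s - q)) = 1"
        using True by (intro prod.neutral) auto
      with True show ?thesis by simp
    next
      case False
      then have "(\<Prod>q\<in>S - {s}. (r - q) / (s - q)) = 0"
        using assms by (intro prod_zero) auto
      with False show ?thesis by simp
    qed
  qed simp
  also have "\<dots> = v r" using assms by (simp add: sum.delta)
  finally show ?thesis using assms by (auto simp: interpolate_def)
qed

lemma sum_increment:
  fixes x :: "real \<Rightarrow> 'a::ab_group_add"
  shows "(\<Sum>j\<le>i. increment t x j) = x (t i)"
  by (induction i) (simp_all add: increment_def)

text \<open>This connects the two descriptions of cylinder functions. The values of a path at the grid points
  are the partial sums of its increments, and interpolation turns a sequence of increments back into
  a path, on which the cylinder function can be evaluated. The set \<open>S0\<close> makes it possible to prescribe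
  some of the grid points.\<close>

lemma cylinder_representation:
  fixes X :: "(real \<Rightarrow> real^'d) \<Rightarrow> real"
  assumes X: "X \<in> cylinder {0..}" and S0: "finite S0" "S0 \<subseteq> {0..}"
  obtains n t \<phi> where "1 \<le> n" "strict_mono_on {..<n} t" "0 \<le> t (0::nat)" "S0 \<subseteq> t ` {..<n}"
    "\<phi> \<in> Cb_Lip_seq n" "\<And>\<omega>. \<omega> \<in> Omega \<Longrightarrow> X \<omega> = \<phi> (increment t \<omega>)"
proof -
  obtain S1 L where S1: "finite S1" "S1 \<subseteq> {0..}" and L: "0 \<le> L"
    and XL: "\<And>\<omega> \<omega>'. \<omega> \<in> Omega \<Longrightarrow> \<omega>' \<in> Omega \<Longrightarrow> norm (X \<omega> - X \<omega>') \<le> L * (\<Sum>s\<in>S1. norm (\<omega> s - \<omega>' s))"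
    using finitely_LipschitzE[OF cylinder_finitely_Lipschitz[OF X]] by blast
  obtain M where M: "\<And>\<omega>. \<omega> \<in> Omega \<Longrightarrow> \<bar>X \<omega>\<bar> \<le> M" using cylinder_bounded[OF X] by blast
  define S where "S = insert 0 (S0 \<union> S1)"
  have S: "finite S" "S \<subseteq> {0..}" "S \<noteq> {}" using S0 S1 by (auto simp: S_def)
  define n where "n = card S"
  define t where "t i = sorted_list_of_set S ! i" for i
  have n: "1 \<le> n" using S by (simp add: n_def Suc_leI card_gt_0_iff)
  have tm: "strict_mono_on {..<n} t"
    using strict_sorted_list_of_set[of S] S(1)
    by (auto simp: strict_mono_on_def t_def n_def sorted_wrt_iff_nth_less)
  have tS: "t ` {..<n} = S"
  proof -
    have "set (sorted_list_of_set S) = (\<lambda>i. sorted_list_of_set S ! i) ` {..<length (sorted_list_of_set S)}"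
      by (auto simp: set_conv_nth)
    then show ?thesis using S(1) by (simp add: t_def[abs_def] n_def)
  qed
  have bij: "bij_betw t {..<n} S"
    using tS strict_mono_on_imp_inj_on[OF tm] by (simp add: bij_betw_def)
  define idx where "idx = inv_into {..<n} t"
  have idx: "idx (t i) = i" if "i < n" for i
    using that strict_mono_on_imp_inj_on[OF tm] by (simp add: idx_def inv_into_f_f)
  define path :: "(nat \<Rightarrow> real^'d) \<Rightarrow> real \<Rightarrow> real^'d" where
    "path x = interpolate S (\<lambda>s. \<Sum>j\<le>idx s. x j)" for x
  have path: "path x \<in> Omega" for x unfolding path_def by (rule interpolate_in_Omega)
  have path_t: "path x (t i) = (\<Sum>j\<le>i. x j)" if "i < n" for x i
  proof -
    have "t i \<in> S" using that tS by blast
    then show ?thesis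
      unfolding path_def by (simp add: interpolate_eq[OF S(1,2)] idx[OF that])
  qed
  have LS: "\<bar>X \<omega> - X \<omega>'\<bar> \<le> L * (\<Sum>i<n. norm (\<omega> (t i) - \<omega>' (t i)))"
    if "\<omega> \<in> Omega" "\<omega>' \<in> Omega" for \<omega> \<omega>'
  proof -
    have "(\<Sum>s\<in>S1. norm (\<omega> s - \<omega>' s)) \<le> (\<Sum>s\<in>S. norm (\<omega> s - \<omega>' s))"
      using S by (intro sum_mono2) (auto simp: S_def)
    also have "\<dots> = (\<Sum>i<n. norm (\<omega> (t i) - \<omega>' (t i)))"
      using sum.reindex_bij_betw[OF bij, of "\<lambda>s. norm (\<omega> s - \<omega>' s)"] by simp
    finally show ?thesis using XL[OF that] mult_left_mono[OF _ L] by fastforce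
  qed
  define \<phi> where "\<phi> x = X (path x)" for x
  have "\<phi> \<in> Cb_Lip_seq n"
  proof (rule Cb_Lip_seqI)
    show "\<bar>\<phi> x\<bar> \<le> M" for x using M path by (simp add: \<phi>_def)
    show "0 \<le> L * n" using L by simp
    fix x y :: "nat \<Rightarrow> real^'d"
    have "norm (path x (t i) - path y (t i)) \<le> (\<Sum>j<n. norm (x j - y j))" if "i < n" for i
    proof -
      have "norm (path x (t i) - path y (t i)) \<le> (\<Sum>j\<le>i. norm (x j - y j))"
        using path_t[OF that] by (simp flip: sum_subtractf add: norm_sum)
      also have "\<dots> \<le> (\<Sum>j<n. norm (x j - y j))" using that by (intro sum_mono2) auto
      finally show ?thesis .
    qed
    then have "(\<Sum>i<n. norm (path x (t i) - path y (t i))) \<le> n * (\<Sum>j<n. norm (x j - y j))"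
      using sum_bounded_above[of "{..<n}" "\<lambda>i. norm (path x (t i) - path y (t i))" "\<Sum>j<n. norm (x j - y j)"]
      by simp
    then have "L * (\<Sum>i<n. norm (path x (t i) - path y (t i))) \<le> L * (n * (\<Sum>j<n. norm (x j - y j)))"
      using L by (rule mult_left_mono)
    with LS[OF path path, of x y] show "\<bar>\<phi> x - \<phi> y\<bar> \<le> L * n * (\<Sum>i<n. norm (x i - y i))"
      by (simp add: \<phi>_def mult.assoc)
  qed
  moreover have "X \<omega> = \<phi> (increment t \<omega>)" if "\<omega> \<in> Omega" for \<omega>
  proof -
    have "(\<Sum>i<n. norm (\<omega> (t i) - path (increment t \<omega>) (t i))) = 0"
      by (rule sum.neutral) (simp add: path_t sum_increment)
    with LS[OF that path[of "increment t \<omega>"]] show ?thesis by (simp add: \<phi>_def)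
  qed
  moreover have "0 \<le> t 0"
    using tS S(2) n imageI[of 0 "{..<n}" t] by auto
  moreover have "S0 \<subseteq> t ` {..<n}" using tS by (auto simp: S_def)
  ultimately show thesis using that[OF n tm] by blast
qed

lemma cylinder_measurable:
  fixes X :: "(real \<Rightarrow> real^'d) \<Rightarrow> real"
  assumes "X \<in> cylinder {0..}"
  shows "X \<in> borel_measurable Finf"
proof -
  obtain n t \<phi> where *: "1 \<le> n" "strict_mono_on {..<n} t" "0 \<le> t (0::nat)"
    "\<phi> \<in> Cb_Lip_seq n" "\<And>\<omega>. \<omega> \<in> Omega \<Longrightarrow> X \<omega> = \<phi> (increment t \<omega>)"
    using cylinder_representation[OF assms, of "{}"] by auto
  have t: "0 \<le> t i" if "i < n" for i
    using strict_mono_onD[OF *(2), of 0 i] *(3) that by (cases "i = 0") auto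
  have "(\<lambda>\<omega>. increment t \<omega> i) \<in> borel_measurable Finf" if "i < n" for i
  proof (cases "i = 0")
    case True then show ?thesis using t[OF that] by (simp add: increment_def coordinate_measurable_Finf)
  next
    case False
    have "(\<lambda>\<omega>. \<omega> (t i) - \<omega> (t (i - 1))) \<in> borel_measurable Finf"
      using t[of i] t[of "i - 1"] that by (intro borel_measurable_diff coordinate_measurable_Finf) auto
    with False show ?thesis by (simp add: increment_def)
  qed
  from Cb_Lip_seq_measurable[OF *(4) this] have "(\<lambda>\<omega>. \<phi> (increment t \<omega>)) \<in> borel_measurable Finf"
    by simp
  then show ?thesis using *(5) measurable_cong[of Finf X "\<lambda>\<omega>. \<phi> (increment t \<omega>)"] by simp
qed

section \<open>Continuity on the path space and the modulus of continuity\<close>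

lemma topspace_locally_uniform [simp]: "topspace locally_uniform_topology = Omega"
proof
  show "topspace locally_uniform_topology \<subseteq> Omega"
    using openin_topspace openin_locally_uniform_topology by blast
  have "openin locally_uniform_topology Omega"
    unfolding openin_locally_uniform_topology using zero_le_one zero_less_one by blast
  then show "Omega \<subseteq> topspace locally_uniform_topology" by (rule openin_subset)
qed

text \<open>Both cylinder functions and the modulus of continuity are Lipschitz for the supremum norm on a
  compact time interval.\<close>

lemma continuous_map_locally_uniformI:
  fixes X :: "(real \<Rightarrow> real^'d) \<Rightarrow> real"
  assumes "0 \<le> T" "0 \<le> K"
    and X: "\<And>\<omega> \<omega>' e. \<omega> \<in> Omega \<Longrightarrow> \<omega>' \<in> Omega \<Longrightarrow> (\<And>t. 0 \<le> t \<Longrightarrow> t \<le> T \<Longrightarrow> norm (\<omega>' t - \<omega> t) \<le> e) \<Longrightarrow>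
      \<bar>X \<omega>' - X \<omega>\<bar> \<le> K * e"
  shows "continuous_map locally_uniform_topology euclideanreal X"
  unfolding continuous_map topspace_locally_uniform
proof (intro conjI allI impI)
  fix U :: "real set" assume "openin euclideanreal U"
  then have U: "open U" by simp
  show "openin locally_uniform_topology {\<omega> \<in> Omega. X \<omega> \<in> U}"
    unfolding openin_locally_uniform_topology
  proof (intro conjI ballI)
    fix \<omega> assume "\<omega> \<in> {\<omega> \<in> Omega. X \<omega> \<in> U}"
    then have \<omega>: "\<omega> \<in> Omega" "X \<omega> \<in> U" by auto
    obtain e where e: "0 < e" "\<And>y. dist y (X \<omega>) < e \<Longrightarrow> y \<in> U"
      using U \<omega>(2) unfolding open_dist by blast
    let ?e = "e / (K + 1)"
    have "K * ?e < e" "0 < ?e" using e(1) \<open>0 \<le> K\<close> by (auto simp: field_simps)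
    have "\<forall>\<omega>'\<in>Omega. (\<forall>t\<in>{0..T}. dist (\<omega>' t) (\<omega> t) < ?e) \<longrightarrow> \<omega>' \<in> {\<omega> \<in> Omega. X \<omega> \<in> U}"
    proof (intro ballI impI)
      fix \<omega>' :: "real \<Rightarrow> real^'d"
      assume 1: "\<omega>' \<in> Omega" "\<forall>t\<in>{0..T}. dist (\<omega>' t) (\<omega> t) < ?e"
      have "\<bar>X \<omega>' - X \<omega>\<bar> \<le> K * ?e"
        using 1(2) by (intro X[OF \<omega>(1) 1(1)]) (auto simp: dist_norm less_imp_le)
      also have "\<dots> < e" by fact
      finally show "\<omega>' \<in> {\<omega> \<in> Omega. X \<omega> \<in> U}" using e(2) 1(1) by (simp add: dist_real_def)
    qed
    then show "\<exists>T\<ge>0. \<exists>\<epsilon>>0. \<forall>\<omega>'\<in>Omega. (\<forall>t\<in>{0..T}. dist (\<omega>' t) (\<omega> t) < \<epsilon>) \<longrightarrow>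
        \<omega>' \<in> {\<omega> \<in> Omega. X \<omega> \<in> U}"
      using \<open>0 \<le> T\<close> \<open>0 < ?e\<close> by blast
  qed auto
qed auto

lemma cylinder_continuous:
  fixes X :: "(real \<Rightarrow> real^'d) \<Rightarrow> real"
  assumes "X \<in> cylinder {0..}"
  shows "continuous_map locally_uniform_topology euclideanreal X"
proof -
  obtain S L where S: "finite S" "S \<subseteq> {0..}" and L: "0 \<le> L"
    and XL: "\<And>\<omega> \<omega>'. \<omega> \<in> Omega \<Longrightarrow> \<omega>' \<in> Omega \<Longrightarrow> norm (X \<omega> - X \<omega>') \<le> L * (\<Sum>s\<in>S. norm (\<omega> s - \<omega>' s))"
    using finitely_LipschitzE[OF cylinder_finitely_Lipschitz[OF assms]] by blast
  have T: "s \<le> Max (insert 0 S)" if "s \<in> S" for s using S(1) that by simp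
  show ?thesis
  proof (rule continuous_map_locally_uniformI[of "Max (insert 0 S)" "L * card S"])
    show "0 \<le> Max (insert 0 S)" using S(1) by simp
    show "0 \<le> L * card S" using L by simp
    fix \<omega> \<omega>' :: "real \<Rightarrow> real^'d" and e
    assume om: "\<omega> \<in> Omega" "\<omega>' \<in> Omega"
      and e: "\<And>t. 0 \<le> t \<Longrightarrow> t \<le> Max (insert 0 S) \<Longrightarrow> norm (\<omega>' t - \<omega> t) \<le> e"
    have "(\<Sum>s\<in>S. norm (\<omega>' s - \<omega> s)) \<le> card S * e"
      using sum_bounded_above[of S "\<lambda>s. norm (\<omega>' s - \<omega> s)" e] e T S(2) by auto
    then have "L * (\<Sum>s\<in>S. norm (\<omega>' s - \<omega> s)) \<le> L * (card S * e)" using L by (rule mult_left_mono)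
    with XL[OF om(2,1)] show "\<bar>X \<omega>' - X \<omega>\<bar> \<le> L * card S * e" by (simp add: mult.assoc)
  qed
qed

definition rational_pairs :: "real \<Rightarrow> real \<Rightarrow> (real \<times> real) set" where
  "rational_pairs T \<delta> = {(p, q) \<in> \<rat> \<times> \<rat>. p \<in> {0..T} \<and> q \<in> {0..T} \<and> \<bar>p - q\<bar> \<le> \<delta>}"

text \<open>Only rational times occur, so that the supremum is measurable.\<close>

definition modulus :: "real \<Rightarrow> real \<Rightarrow> (real \<Rightarrow> real^'d) \<Rightarrow> real" where
  "modulus T \<delta> \<omega> = (SUP pq\<in>rational_pairs T \<delta>. min 1 (norm (\<omega> (fst pq) - \<omega> (snd pq))))"

lemma rational_pairs_zero: "0 \<le> T \<Longrightarrow> 0 \<le> \<delta> \<Longrightarrow> (0, 0) \<in> rational_pairs T \<delta>"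
  by (simp add: rational_pairs_def)

lemma modulus_upper:
  "pq \<in> rational_pairs T \<delta> \<Longrightarrow> min 1 (norm (\<omega> (fst pq) - \<omega> (snd pq))) \<le> modulus T \<delta> \<omega>"
  unfolding modulus_def by (rule cSUP_upper) (auto intro!: bdd_aboveI2[where M = 1])

lemma modulus_least:
  assumes "0 \<le> T" "0 \<le> \<delta>"
    "\<And>pq. pq \<in> rational_pairs T \<delta> \<Longrightarrow> min 1 (norm (\<omega> (fst pq) - \<omega> (snd pq))) \<le> c"
  shows "modulus T \<delta> \<omega> \<le> c"
  unfolding modulus_def using rational_pairs_zero[OF assms(1,2)] assms(3)
  by (intro cSUP_least) auto

lemma modulus_bounds:
  assumes "0 \<le> T" "0 \<le> \<delta>"
  shows "0 \<le> modulus T \<delta> \<omega>" "modulus T \<delta> \<omega> \<le> 1"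
  using modulus_upper[OF rational_pairs_zero[OF assms], of \<omega>] modulus_least[OF assms, of \<omega> 1] by auto

lemma modulus_mono:
  assumes "0 \<le> T" "0 \<le> \<delta>" "\<delta> \<le> \<delta>'"
  shows "modulus T \<delta> \<omega> \<le> modulus T \<delta>' \<omega>"
  using assms(3) by (intro modulus_least[OF assms(1,2)] modulus_upper) (auto simp: rational_pairs_def)

lemma modulus_measurable:
  fixes T \<delta> :: real
  assumes "0 \<le> T" "0 \<le> \<delta>"
  shows "(modulus T \<delta> :: (real \<Rightarrow> real^'d) \<Rightarrow> real) \<in> borel_measurable Finf"
proof -
  have "(\<lambda>\<omega> :: real \<Rightarrow> real^'d. SUP pq\<in>rational_pairs T \<delta>. min 1 (norm (\<omega> (fst pq) - \<omega> (snd pq))))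
      \<in> borel_measurable Finf"
  proof (rule borel_measurable_cSUP)
    have "rational_pairs T \<delta> \<subseteq> \<rat> \<times> \<rat>" by (auto simp: rational_pairs_def)
    then show "countable (rational_pairs T \<delta>)"
      by (rule countable_subset) (intro countable_SIGMA countable_rat)
    fix pq assume "pq \<in> rational_pairs T \<delta>"
    then have "0 \<le> fst pq" "0 \<le> snd pq" by (auto simp: rational_pairs_def)
    then have [measurable]: "(\<lambda>\<omega> :: real \<Rightarrow> real^'d. \<omega> (fst pq)) \<in> borel_measurable Finf"
      "(\<lambda>\<omega> :: real \<Rightarrow> real^'d. \<omega> (snd pq)) \<in> borel_measurable Finf"
      by (simp_all add: coordinate_measurable_Finf)
    show "(\<lambda>\<omega> :: real \<Rightarrow> real^'d. min 1 (norm (\<omega> (fst pq) - \<omega> (snd pq)))) \<in> borel_measurable Finf"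
      by measurable
  next
    show "bdd_above ((\<lambda>pq. min 1 (norm (\<omega> (fst pq) - \<omega> (snd pq)))) ` rational_pairs T \<delta>)"
      for \<omega> :: "real \<Rightarrow> real^'d" by (auto intro!: bdd_aboveI2[where M = 1])
  qed
  then show ?thesis by (simp add: modulus_def[abs_def])
qed

lemma modulus_continuous:
  assumes "0 \<le> T" "0 \<le> \<delta>"
  shows "continuous_map locally_uniform_topology euclideanreal (modulus T \<delta> :: (real \<Rightarrow> real^'d) \<Rightarrow> real)"
proof (rule continuous_map_locally_uniformI[OF assms(1), of 2])
  fix \<omega> \<omega>' :: "real \<Rightarrow> real^'d" and e
  assume e: "\<And>t. 0 \<le> t \<Longrightarrow> t \<le> T \<Longrightarrow> norm (\<omega>' t - \<omega> t) \<le> e"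
  have le: "modulus T \<delta> x \<le> modulus T \<delta> y + 2 * e"
    if xy: "\<And>t. 0 \<le> t \<Longrightarrow> t \<le> T \<Longrightarrow> norm (x t - y t) \<le> e" for x y :: "real \<Rightarrow> real^'d"
  proof (rule modulus_least[OF assms])
    fix pq assume pq: "pq \<in> rational_pairs T \<delta>"
    then have "norm (x (fst pq) - y (fst pq)) \<le> e" "norm (x (snd pq) - y (snd pq)) \<le> e"
      using xy by (auto simp: rational_pairs_def)
    moreover have "norm (x (fst pq) - x (snd pq)) \<le>
        norm (x (fst pq) - y (fst pq)) + norm (y (fst pq) - y (snd pq)) + norm (y (snd pq) - x (snd pq))"
      using norm_triangle_ineq[of "x (fst pq) - y (fst pq) + (y (fst pq) - y (snd pq))" "y (snd pq) - x (snd pq)"]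
        norm_triangle_ineq[of "x (fst pq) - y (fst pq)" "y (fst pq) - y (snd pq)"] by simp
    ultimately have "norm (x (fst pq) - x (snd pq)) \<le> norm (y (fst pq) - y (snd pq)) + 2 * e"
      by (simp add: norm_minus_commute)
    moreover have "0 \<le> e" using order_trans[OF norm_ge_zero xy[of 0]] assms(1) by simp
    ultimately have "min 1 (norm (x (fst pq) - x (snd pq))) \<le> min 1 (norm (y (fst pq) - y (snd pq))) + 2 * e"
      by (auto simp: min_def)
    with modulus_upper[OF pq, of y]
    show "min 1 (norm (x (fst pq) - x (snd pq))) \<le> modulus T \<delta> y + 2 * e" by linarith
  qed
  have "modulus T \<delta> \<omega>' \<le> modulus T \<delta> \<omega> + 2 * e" "modulus T \<delta> \<omega> \<le> modulus T \<delta> \<omega>' + 2 * e"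
    using e by (auto intro!: le simp: norm_minus_commute)
  then show "\<bar>modulus T \<delta> \<omega>' - modulus T \<delta> \<omega>\<bar> \<le> 2 * e" by linarith
qed simp

lemma modulus_tendsto_zero:
  fixes \<omega> :: "real \<Rightarrow> real^'d"
  assumes "\<omega> \<in> Omega" "0 \<le> T" "\<delta> \<longlonglongrightarrow> 0" "\<And>n. 0 \<le> \<delta> n"
  shows "(\<lambda>n. modulus T (\<delta> n) \<omega>) \<longlonglongrightarrow> 0"
proof (rule LIMSEQ_I)
  fix e :: real assume e: "0 < e"
  have "continuous_on {0..T} \<omega>"
    using assms(1) by (auto simp: Omega_def intro: continuous_on_subset)
  then have "uniformly_continuous_on {0..T} \<omega>"
    by (rule compact_uniformly_continuous) simp
  then obtain d where d: "0 < d"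
    "\<And>x y. x \<in> {0..T} \<Longrightarrow> y \<in> {0..T} \<Longrightarrow> dist y x < d \<Longrightarrow> dist (\<omega> y) (\<omega> x) < e / 2"
    using e unfolding uniformly_continuous_on_def by (meson half_gt_zero)
  obtain N where N: "\<And>n. N \<le> n \<Longrightarrow> norm (\<delta> n - 0) < d" using LIMSEQ_D[OF assms(3) d(1)] by blast
  have "norm (modulus T (\<delta> n) \<omega> - 0) < e" if "N \<le> n" for n
  proof -
    have "modulus T (\<delta> n) \<omega> \<le> e / 2"
    proof (rule modulus_least[OF assms(2,4)])
      fix pq assume "pq \<in> rational_pairs T (\<delta> n)"
      then have "dist (\<omega> (fst pq)) (\<omega> (snd pq)) < e / 2"
        using N[OF that] by (intro d(2)) (auto simp: rational_pairs_def dist_real_def)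
      then show "min 1 (norm (\<omega> (fst pq) - \<omega> (snd pq))) \<le> e / 2" by (simp add: dist_norm)
    qed
    with modulus_bounds(1)[OF assms(2) assms(4)[of n], of \<omega>] e show ?thesis by simp
  qed
  then show "\<exists>N. \<forall>n\<ge>N. norm (modulus T (\<delta> n) \<omega> - 0) < e" by blast
qed

text \<open>Real times are limits of rational ones from the right; this is why the interval is enlarged and
  the distance has to be strictly below \<open>\<delta>\<close>.\<close>

lemma increment_le_modulus:
  fixes \<omega> :: "real \<Rightarrow> real^'d"
  assumes "\<omega> \<in> Omega" "0 \<le> r" "r \<le> T" "0 \<le> s" "s \<le> T" "\<bar>r - s\<bar> < \<delta>"
  shows "min 1 (norm (\<omega> r - \<omega> s)) \<le> modulus (T + 1) \<delta> \<omega>"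
proof -
  define e where "e = min 1 (\<delta> - \<bar>r - s\<bar>)"
  have e: "0 < e" using assms by (simp add: e_def)
  have "\<exists>p. p \<in> \<rat> \<and> x < p \<and> p < x + e / (2 * (real n + 1))" for n :: nat and x
  proof -
    have "x < x + e / (2 * (real n + 1))" using e by simp
    from Rats_dense_in_real[OF this] show ?thesis by blast
  qed
  then have "\<exists>p. \<forall>n. p n \<in> \<rat> \<and> x < p n \<and> p n < x + e / (2 * (real n + 1))" for x
    by (intro choice allI)
  then obtain p q :: "nat \<Rightarrow> real" where
    p: "\<And>n. p n \<in> \<rat> \<and> r < p n \<and> p n < r + e / (2 * (real n + 1))" and
    q: "\<And>n. q n \<in> \<rat> \<and> s < q n \<and> q n < s + e / (2 * (real n + 1))"
    by meson
  have lim0: "(\<lambda>n. x + e / (2 * (real n + 1))) \<longlonglongrightarrow> x" for x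
  proof -
    have "(\<lambda>n. x + (e / 2) * inverse (real (Suc n))) \<longlonglongrightarrow> x + (e / 2) * 0"
      by (intro tendsto_intros LIMSEQ_inverse_real_of_nat)
    then show ?thesis by (simp add: field_simps)
  qed
  have limp: "p \<longlonglongrightarrow> r"
    by (rule real_tendsto_sandwich[OF _ _ tendsto_const lim0])
      (use p in \<open>auto intro!: always_eventually less_imp_le\<close>)
  have limq: "q \<longlonglongrightarrow> s"
    by (rule real_tendsto_sandwich[OF _ _ tendsto_const lim0])
      (use q in \<open>auto intro!: always_eventually less_imp_le\<close>)
  have pos: "0 \<le> p n" "0 \<le> q n" for n using p[of n] q[of n] assms by auto
  have "(\<lambda>n. min 1 (norm (\<omega> (p n) - \<omega> (q n)))) \<longlonglongrightarrow> min 1 (norm (\<omega> r - \<omega> s))"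
    using limp limq pos assms by (intro tendsto_intros continuous_path_eval)
  moreover have "min 1 (norm (\<omega> (p n) - \<omega> (q n))) \<le> modulus (T + 1) \<delta> \<omega>" for n
  proof -
    have "e / (2 * (real n + 1)) \<le> e / 2" using e by (intro divide_left_mono) auto
    then have "p n < r + e / 2" "q n < s + e / 2" using p[of n] q[of n] by linarith+
    moreover have "r < p n" "s < q n" using p q by auto
    moreover have "e \<le> 1" "e \<le> \<delta> - \<bar>r - s\<bar>" by (simp_all add: e_def)
    ultimately have "p n \<le> T + 1" "q n \<le> T + 1" "\<bar>p n - q n\<bar> \<le> \<delta>"
      using assms e by linarith+
    then have "(p n, q n) \<in> rational_pairs (T + 1) \<delta>"
      using p[of n] q[of n] assms by (auto simp: rational_pairs_def)
    from modulus_upper[OF this, of \<omega>] show ?thesis by simp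
  qed
  ultimately show ?thesis by (meson LIMSEQ_le_const2)
qed

section \<open>Bounded measurable functions of the path\<close>

definition bounded_measurable :: "((real \<Rightarrow> real^'d) \<Rightarrow> real) \<Rightarrow> bool" where
  "bounded_measurable f \<longleftrightarrow> f \<in> borel_measurable Finf \<and> (\<exists>M. \<forall>\<omega>\<in>Omega. \<bar>f \<omega>\<bar> \<le> M)"

lemma bounded_measurableI:
  "f \<in> borel_measurable Finf \<Longrightarrow> (\<And>\<omega>. \<omega> \<in> Omega \<Longrightarrow> \<bar>f \<omega>\<bar> \<le> M) \<Longrightarrow> bounded_measurable f"
  unfolding bounded_measurable_def by blast

lemma bounded_measurableE:
  assumes "bounded_measurable f"
  obtains M where "0 \<le> M" "\<And>\<omega>. \<omega> \<in> Omega \<Longrightarrow> \<bar>f \<omega>\<bar> \<le> M"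
proof -
  obtain M where M: "\<And>\<omega>. \<omega> \<in> Omega \<Longrightarrow> \<bar>f \<omega>\<bar> \<le> M"
    using assms unfolding bounded_measurable_def by blast
  then have "\<bar>f \<omega>\<bar> \<le> max M 0" if "\<omega> \<in> Omega" for \<omega> using that by (simp add: max.coboundedI1)
  then show thesis by (intro that[of "max M 0"]) simp_all
qed

lemma bounded_measurable_borel: "bounded_measurable f \<Longrightarrow> f \<in> borel_measurable Finf"
  by (simp add: bounded_measurable_def)

lemma bounded_measurable_add:
  assumes "bounded_measurable f" "bounded_measurable g"
  shows "bounded_measurable (\<lambda>\<omega>. f \<omega> + g \<omega>)"
proof -
  obtain M where M: "\<And>\<omega>. \<omega> \<in> Omega \<Longrightarrow> \<bar>f \<omega>\<bar> \<le> M" using bounded_measurableE[OF assms(1)] by blast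
  obtain M' where M': "\<And>\<omega>. \<omega> \<in> Omega \<Longrightarrow> \<bar>g \<omega>\<bar> \<le> M'" using bounded_measurableE[OF assms(2)] by blast
  show ?thesis
  proof (rule bounded_measurableI)
    show "(\<lambda>\<omega>. f \<omega> + g \<omega>) \<in> borel_measurable Finf"
      using assms[THEN bounded_measurable_borel] by (rule borel_measurable_add)
    fix \<omega> :: "real \<Rightarrow> real^'a" assume "\<omega> \<in> Omega"
    then show "\<bar>f \<omega> + g \<omega>\<bar> \<le> M + M'" using M[of \<omega>] M'[of \<omega>] by linarith
  qed
qed

lemma bounded_measurable_mult:
  assumes "bounded_measurable f" "bounded_measurable g"
  shows "bounded_measurable (\<lambda>\<omega>. f \<omega> * g \<omega>)"
proof -
  obtain M where M: "0 \<le> M" "\<And>\<omega>. \<omega> \<in> Omega \<Longrightarrow> \<bar>f \<omega>\<bar> \<le> M" using bounded_measurableE[OF assms(1)] by blast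
  obtain M' where M': "\<And>\<omega>. \<omega> \<in> Omega \<Longrightarrow> \<bar>g \<omega>\<bar> \<le> M'" using bounded_measurableE[OF assms(2)] by blast
  show ?thesis
  proof (rule bounded_measurableI)
    show "(\<lambda>\<omega>. f \<omega> * g \<omega>) \<in> borel_measurable Finf"
      using assms[THEN bounded_measurable_borel] by (rule borel_measurable_times)
    fix \<omega> :: "real \<Rightarrow> real^'a" assume "\<omega> \<in> Omega"
    then show "\<bar>f \<omega> * g \<omega>\<bar> \<le> M * M'" using M M' by (simp add: abs_mult mult_mono')
  qed
qed

lemma bounded_measurable_const: "bounded_measurable (\<lambda>\<omega>. c)"
  by (rule bounded_measurableI[of _ "\<bar>c\<bar>"]) auto

lemma bounded_measurable_cylinder: "X \<in> cylinder {0..} \<Longrightarrow> bounded_measurable X"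
  using cylinder_measurable[of X] cylinder_bounded[of X] unfolding bounded_measurable_def by metis

lemma bounded_measurable_indicator:
  "A \<in> sets Finf \<Longrightarrow> bounded_measurable (indicator A)"
  by (rule bounded_measurableI[of _ 1]) (auto simp: indicator_def)

lemma prob_lawsD:
  assumes "P \<in> prob_laws"
  shows "prob_space P" "sets P = sets Finf" "space P = Omega"
  using assms sets_eq_imp_space_eq[of P Finf] by (auto simp: prob_laws_def)

lemma bounded_measurable_law:
  "P \<in> prob_laws \<Longrightarrow> bounded_measurable f \<Longrightarrow> f \<in> borel_measurable P"
  using measurable_cong_sets[OF prob_lawsD(2) refl] by (auto simp: bounded_measurable_def)

lemma bounded_measurable_integrable:
  assumes "P \<in> prob_laws" "bounded_measurable f"
  shows "integrable P f"
proof -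
  obtain M where M: "\<And>\<omega>. \<omega> \<in> Omega \<Longrightarrow> \<bar>f \<omega>\<bar> \<le> M" using bounded_measurableE[OF assms(2)] by blast
  interpret prob_space P using assms(1) by (rule prob_lawsD)
  show ?thesis
    using M bounded_measurable_law[OF assms] prob_lawsD(3)[OF assms(1)]
    by (intro integrable_const_bound[of _ M]) (auto intro!: AE_I2)
qed

lemma integral_law_le:
  assumes "P \<in> prob_laws" "bounded_measurable f" "\<And>\<omega>. \<omega> \<in> Omega \<Longrightarrow> f \<omega> \<le> c"
  shows "(\<integral>\<omega>. f \<omega> \<partial>P) \<le> c"
proof -
  interpret prob_space P using assms(1) by (rule prob_lawsD)
  have "(\<integral>\<omega>. f \<omega> \<partial>P) \<le> (\<integral>\<omega>. c \<partial>P)"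
    using assms prob_lawsD(3)[OF assms(1)] bounded_measurable_integrable[OF assms(1,2)]
    by (intro integral_mono) auto
  then show ?thesis by (simp add: prob_space)
qed

lemma integral_law_mono:
  assumes "P \<in> prob_laws" "bounded_measurable f" "bounded_measurable g"
    "\<And>\<omega>. \<omega> \<in> Omega \<Longrightarrow> f \<omega> \<le> g \<omega>"
  shows "(\<integral>\<omega>. f \<omega> \<partial>P) \<le> (\<integral>\<omega>. g \<omega> \<partial>P)"
  using assms prob_lawsD(3)[OF assms(1)] bounded_measurable_integrable[OF assms(1)]
  by (intro integral_mono) auto

lemma integral_law_affine:
  assumes "P \<in> prob_laws" "bounded_measurable f"
  shows "(\<integral>\<omega>. a + b * f \<omega> \<partial>P) = a + b * (\<integral>\<omega>. f \<omega> \<partial>P)"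
proof -
  interpret prob_space P using assms(1) by (rule prob_lawsD)
  show ?thesis using bounded_measurable_integrable[OF assms] by (simp add: prob_space)
qed

section \<open>Inner regularity with respect to limits of cylinder functions\<close>

text \<open>These sets play the role of closed sets: their indicators are decreasing limits of cylinder
  functions. Approximation by such functions, rather than by compact sets, is what the upper
  expectation can follow.\<close>

definition cylinder_closed :: "real set \<Rightarrow> (real \<Rightarrow> real^'d) set \<Rightarrow> bool" where
  "cylinder_closed I C \<longleftrightarrow> C \<subseteq> Omega \<and> (\<exists>h. (\<forall>n::nat. h n \<in> cylinder I) \<and>
     (\<forall>n. \<forall>\<omega>\<in>Omega. 0 \<le> h n \<omega> \<and> h n \<omega> \<le> 1 \<and> h (Suc n) \<omega> \<le> h n \<omega>) \<and>
     (\<forall>\<omega>\<in>Omega. (\<lambda>n. h n \<omega>) \<longlonglongrightarrow> indicator C \<omega>))"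

lemma cylinder_closedE:
  assumes "cylinder_closed I C"
  obtains h where "C \<subseteq> Omega" "\<And>n::nat. h n \<in> cylinder I" "\<And>n \<omega>. \<omega> \<in> Omega \<Longrightarrow> 0 \<le> h n \<omega>"
    "\<And>n \<omega>. \<omega> \<in> Omega \<Longrightarrow> h n \<omega> \<le> 1" "\<And>n \<omega>. \<omega> \<in> Omega \<Longrightarrow> h (Suc n) \<omega> \<le> h n \<omega>"
    "\<And>\<omega>. \<omega> \<in> Omega \<Longrightarrow> (\<lambda>n. h n \<omega>) \<longlonglongrightarrow> indicator C \<omega>"
  using assms unfolding cylinder_closed_def by blast

lemma cylinder_closedI:
  assumes "C \<subseteq> Omega" "\<And>n::nat. h n \<in> cylinder I" "\<And>n \<omega>. \<omega> \<in> Omega \<Longrightarrow> 0 \<le> h n \<omega>"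
    "\<And>n \<omega>. \<omega> \<in> Omega \<Longrightarrow> h n \<omega> \<le> 1" "\<And>n \<omega>. \<omega> \<in> Omega \<Longrightarrow> h (Suc n) \<omega> \<le> h n \<omega>"
    "\<And>\<omega>. \<omega> \<in> Omega \<Longrightarrow> (\<lambda>n. h n \<omega>) \<longlonglongrightarrow> indicator C \<omega>"
  shows "cylinder_closed I C"
  unfolding cylinder_closed_def using assms by blast

lemma cylinder_closed_empty: "cylinder_closed I {}"
  by (rule cylinder_closedI[where h = "\<lambda>_ _. 0"]) (simp_all add: cylinder_const)

lemma cylinder_closed_Omega: "cylinder_closed I Omega"
  by (rule cylinder_closedI[where h = "\<lambda>_ _. 1"]) (simp_all add: cylinder_const)

lemma cylinder_closed_Un:
  assumes "cylinder_closed I C" "cylinder_closed I D"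
  shows "cylinder_closed I (C \<union> D)"
proof -
  obtain h where h: "C \<subseteq> Omega" "\<And>n::nat. h n \<in> cylinder I" "\<And>n \<omega>. \<omega> \<in> Omega \<Longrightarrow> 0 \<le> h n \<omega>"
    "\<And>n \<omega>. \<omega> \<in> Omega \<Longrightarrow> h n \<omega> \<le> 1" "\<And>n \<omega>. \<omega> \<in> Omega \<Longrightarrow> h (Suc n) \<omega> \<le> h n \<omega>"
    "\<And>\<omega>. \<omega> \<in> Omega \<Longrightarrow> (\<lambda>n. h n \<omega>) \<longlonglongrightarrow> indicator C \<omega>"
    using cylinder_closedE[OF assms(1)] by blast
  obtain k where k: "D \<subseteq> Omega" "\<And>n::nat. k n \<in> cylinder I" "\<And>n \<omega>. \<omega> \<in> Omega \<Longrightarrow> 0 \<le> k n \<omega>"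
    "\<And>n \<omega>. \<omega> \<in> Omega \<Longrightarrow> k n \<omega> \<le> 1" "\<And>n \<omega>. \<omega> \<in> Omega \<Longrightarrow> k (Suc n) \<omega> \<le> k n \<omega>"
    "\<And>\<omega>. \<omega> \<in> Omega \<Longrightarrow> (\<lambda>n. k n \<omega>) \<longlonglongrightarrow> indicator D \<omega>"
    using cylinder_closedE[OF assms(2)] by blast
  show ?thesis
  proof (rule cylinder_closedI[where h = "\<lambda>n \<omega>. max (h n \<omega>) (k n \<omega>)"])
    show "C \<union> D \<subseteq> Omega" using h(1) k(1) by simp
    show "(\<lambda>\<omega>. max (h n \<omega>) (k n \<omega>)) \<in> cylinder I" for n
      using h(2) k(2) by (rule cylinder_max)
    fix \<omega> :: "real \<Rightarrow> real^'a" assume om: "\<omega> \<in> Omega"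
    have "(\<lambda>n. max (h n \<omega>) (k n \<omega>)) \<longlonglongrightarrow> max (indicator C \<omega>) (indicator D \<omega>)"
      using h(6)[OF om] k(6)[OF om] by (rule tendsto_max)
    also have "max (indicator C \<omega>) (indicator D \<omega>) = (indicator (C \<union> D) \<omega> :: real)"
      by (auto simp: indicator_def)
    finally show "(\<lambda>n. max (h n \<omega>) (k n \<omega>)) \<longlonglongrightarrow> indicator (C \<union> D) \<omega>" .
    show "max (h (Suc n) \<omega>) (k (Suc n) \<omega>) \<le> max (h n \<omega>) (k n \<omega>)" for n
      using h(5)[OF om, of n] k(5)[OF om, of n] by (rule max.mono)
    show "0 \<le> max (h n \<omega>) (k n \<omega>)" "max (h n \<omega>) (k n \<omega>) \<le> 1" for n
      using h(3,4)[OF om, of n] k(3,4)[OF om, of n] by auto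
  qed
qed

lemma cylinder_closed_UN:
  "(\<And>i. i < (n::nat) \<Longrightarrow> cylinder_closed I (C i)) \<Longrightarrow> cylinder_closed I (\<Union>i<n. C i)"
  by (induction n) (auto simp: lessThan_Suc cylinder_closed_empty cylinder_closed_Un)

text \<open>The products of the first \<open>n\<close> of the \<open>n\<close>-th approximations decrease to the indicator of the
  intersection.\<close>

lemma cylinder_closed_INT:
  fixes C :: "nat \<Rightarrow> (real \<Rightarrow> real^'d) set"
  assumes "\<And>i. cylinder_closed I (C i)"
  shows "cylinder_closed I (\<Inter>i. C i)"
proof -
  have "\<forall>i. \<exists>h. (\<forall>n::nat. h n \<in> cylinder I) \<and>
     (\<forall>n. \<forall>\<omega>\<in>Omega. 0 \<le> h n \<omega> \<and> h n \<omega> \<le> 1 \<and> h (Suc n) \<omega> \<le> h n \<omega>) \<and>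
     (\<forall>\<omega>\<in>Omega. (\<lambda>n. h n \<omega>) \<longlonglongrightarrow> indicator (C i) \<omega>)"
    using assms unfolding cylinder_closed_def by blast
  then obtain h where h: "\<And>i n::nat. h i n \<in> cylinder I"
    "\<And>i n \<omega>. \<omega> \<in> Omega \<Longrightarrow> 0 \<le> h i n \<omega> \<and> h i n \<omega> \<le> 1 \<and> h i (Suc n) \<omega> \<le> h i n \<omega>"
    "\<And>i \<omega>. \<omega> \<in> Omega \<Longrightarrow> (\<lambda>n. h i n \<omega>) \<longlonglongrightarrow> indicator (C i) \<omega>"
    by (subst (asm) choice_iff) blast
  have prod_cyl: "(\<lambda>\<omega>. \<Prod>i\<le>m. h i n \<omega>) \<in> cylinder I" for m n
    by (induction m) (simp_all add: h(1) cylinder_mult)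
  show ?thesis
  proof (rule cylinder_closedI[where h = "\<lambda>n \<omega>. \<Prod>i\<le>n. h i n \<omega>"])
    show "(\<Inter>i. C i) \<subseteq> Omega" using assms[of 0] unfolding cylinder_closed_def by auto
    fix \<omega> :: "real \<Rightarrow> real^'d" assume om: "\<omega> \<in> Omega"
    show ge: "0 \<le> (\<Prod>i\<le>n. h i n \<omega>)" for n using h(2)[OF om] by (intro prod_nonneg) auto
    show "(\<Prod>i\<le>n. h i n \<omega>) \<le> 1" for n using h(2)[OF om] by (intro prod_le_1) auto
    show "(\<Prod>i\<le>Suc n. h i (Suc n) \<omega>) \<le> (\<Prod>i\<le>n. h i n \<omega>)" for n
    proof -
      have "(\<Prod>i\<le>Suc n. h i (Suc n) \<omega>) \<le> (\<Prod>i\<le>n. h i (Suc n) \<omega>)"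
        using h(2)[OF om] by (simp add: mult_left_le prod_nonneg)
      also have "\<dots> \<le> (\<Prod>i\<le>n. h i n \<omega>)" using h(2)[OF om] by (intro prod_mono) auto
      finally show ?thesis .
    qed
    show "(\<lambda>n. \<Prod>i\<le>n. h i n \<omega>) \<longlonglongrightarrow> indicator (\<Inter>i. C i) \<omega>"
    proof (cases "\<omega> \<in> (\<Inter>i. C i)")
      case True
      have "h i n \<omega> = 1" for i n
      proof -
        have "decseq (\<lambda>n. h i n \<omega>)" using h(2)[OF om] by (simp add: decseq_Suc_iff)
        moreover have "(\<lambda>n. h i n \<omega>) \<longlonglongrightarrow> 1" using h(3)[OF om, of i] True by simp
        ultimately have "1 \<le> h i n \<omega>" by (rule decseq_ge)
        with h(2)[OF om, of i n] show ?thesis by simp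
      qed
      with True show ?thesis by simp
    next
      case False
      then obtain j where j: "\<omega> \<notin> C j" by auto
      have "(\<Prod>i\<le>n. h i n \<omega>) \<le> h j n \<omega>" if "j \<le> n" for n
      proof -
        have "(\<Prod>i\<le>n. h i n \<omega>) = h j n \<omega> * (\<Prod>i\<in>{..n} - {j}. h i n \<omega>)"
          using that by (intro prod.remove) auto
        also have "\<dots> \<le> h j n \<omega>"
          using h(2)[OF om] by (intro mult_left_le prod_le_1) auto
        finally show ?thesis .
      qed
      then have upper: "eventually (\<lambda>n. (\<Prod>i\<le>n. h i n \<omega>) \<le> h j n \<omega>) sequentially"
        unfolding eventually_sequentially by blast
      have lower: "eventually (\<lambda>n. 0 \<le> (\<Prod>i\<le>n. h i n \<omega>)) sequentially"
        by (rule always_eventually) (rule allI, rule ge)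
      have lim: "(\<lambda>n. h j n \<omega>) \<longlonglongrightarrow> 0" using h(3)[OF om, of j] j by simp
      have "(\<lambda>n. \<Prod>i\<le>n. h i n \<omega>) \<longlonglongrightarrow> 0"
        by (rule tendsto_sandwich[OF lower upper tendsto_const lim])
      with False show ?thesis by simp
    qed
  qed (simp add: prod_cyl)
qed

text \<open>The indicator of a closed set \<open>F\<close> is the decreasing limit of \<open>max 0 (1 - n * infdist x F)\<close>.\<close>

lemma cylinder_closed_coordinate:
  fixes F :: "(real^'d) set"
  assumes "s \<in> I" "closed F"
  shows "cylinder_closed I {\<omega> \<in> Omega. \<omega> s \<in> F}"
proof (cases "F = {}")
  case True then show ?thesis using cylinder_closed_empty by simp
next
  case False
  define g where "g n x = max 0 (1 - real n * infdist x F)" for n :: nat and x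
  have g: "g n \<in> Cb_Lip" for n
  proof (rule Cb_LipI)
    show "\<bar>g n x\<bar> \<le> 1" for x by (simp add: g_def infdist_nonneg)
    show "\<bar>g n x - g n y\<bar> \<le> real n * dist x y" for x y
    proof -
      have "\<bar>infdist x F - infdist y F\<bar> \<le> dist x y"
        using infdist_triangle[of x F y] infdist_triangle[of y F x] by (simp add: dist_commute)
      then have "real n * \<bar>infdist x F - infdist y F\<bar> \<le> real n * dist x y"
        by (rule mult_left_mono) simp
      moreover have "\<bar>g n x - g n y\<bar> \<le> \<bar>real n * infdist x F - real n * infdist y F\<bar>"
        by (simp add: g_def)
      ultimately show ?thesis by (simp flip: right_diff_distrib add: abs_mult)
    qed
  qed simp
  show ?thesis
  proof (rule cylinder_closedI[where h = "\<lambda>n \<omega>. g n (\<omega> s)"])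
    show "(\<lambda>\<omega>. g n (\<omega> s)) \<in> cylinder I" for n
      using assms(1) by (intro cylinder_Cb_Lip[OF g] finitely_Lipschitz_coordinate)
    fix \<omega> :: "real \<Rightarrow> real^'d" assume om: "\<omega> \<in> Omega"
    show "0 \<le> g n (\<omega> s)" "g n (\<omega> s) \<le> 1" for n by (simp_all add: g_def infdist_nonneg)
    show "g (Suc n) (\<omega> s) \<le> g n (\<omega> s)" for n
      by (simp add: g_def infdist_nonneg distrib_right max.coboundedI2)
    show "(\<lambda>n. g n (\<omega> s)) \<longlonglongrightarrow> indicator {\<omega> \<in> Omega. \<omega> s \<in> F} \<omega>"
    proof (cases "\<omega> s \<in> F")
      case True then show ?thesis using om by (simp add: g_def)
    next
      case F: False
      then have pos: "0 < infdist (\<omega> s) F"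
        using infdist_pos_not_in_closed[OF assms(2) False] by simp
      obtain N :: nat where N: "1 < real N * infdist (\<omega> s) F" using ex_less_of_nat_mult[OF pos] by blast
      have "g n (\<omega> s) = 0" if "N \<le> n" for n
      proof -
        have "real N * infdist (\<omega> s) F \<le> real n * infdist (\<omega> s) F"
          using that pos by (intro mult_right_mono) auto
        with N show ?thesis by (simp add: g_def)
      qed
      then have "(\<lambda>n. g n (\<omega> s)) \<longlonglongrightarrow> 0"
        by (intro tendsto_eventually) (auto simp: eventually_sequentially)
      with F om show ?thesis by simp
    qed
  qed auto
qed

lemma cylinder_closed_measurable:
  assumes "cylinder_closed I C" "I \<subseteq> {0..}"
  shows "C \<in> sets Finf"
proof -
  obtain h where h: "C \<subseteq> Omega" "\<And>n::nat. h n \<in> cylinder I" "\<And>n \<omega>. \<omega> \<in> Omega \<Longrightarrow> 0 \<le> h n \<omega>"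
    "\<And>n \<omega>. \<omega> \<in> Omega \<Longrightarrow> h n \<omega> \<le> 1" "\<And>n \<omega>. \<omega> \<in> Omega \<Longrightarrow> h (Suc n) \<omega> \<le> h n \<omega>"
    "\<And>\<omega>. \<omega> \<in> Omega \<Longrightarrow> (\<lambda>n. h n \<omega>) \<longlonglongrightarrow> indicator C \<omega>"
    using cylinder_closedE[OF assms(1)] by blast
  have "(indicator C :: _ \<Rightarrow> real) \<in> borel_measurable Finf"
  proof (rule borel_measurable_LIMSEQ_real)
    show "h n \<in> borel_measurable Finf" for n
      using cylinder_measurable[OF cylinder_mono[OF h(2) assms(2)]] .
  qed (use h(6) in simp)
  then have "C \<inter> space Finf \<in> sets Finf" by (rule borel_measurable_indicator_iff[THEN iffD1])
  with h(1) show ?thesis by (simp add: Int_absorb2)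
qed

text \<open>The condition is symmetric in \<open>A\<close> and its complement, so that it defines a sigma-algebra.\<close>

definition cylinder_regular :: "real set \<Rightarrow> (real \<Rightarrow> real^'d) measure \<Rightarrow> (real \<Rightarrow> real^'d) set \<Rightarrow> bool" where
  "cylinder_regular I P A \<longleftrightarrow> A \<subseteq> Omega \<and> (\<forall>\<epsilon>>0. \<exists>C D. cylinder_closed I C \<and> cylinder_closed I D \<and>
     C \<subseteq> A \<and> D \<subseteq> Omega - A \<and> 1 - \<epsilon> < measure P C + measure P D)"

lemma cylinder_regular_Compl: "cylinder_regular I P A \<Longrightarrow> cylinder_regular I P (Omega - A)"
  unfolding cylinder_regular_def
proof (intro conjI allI impI)
  fix \<epsilon> :: real assume "A \<subseteq> Omega \<and> (\<forall>\<epsilon>>0. \<exists>C D. cylinder_closed I C \<and> cylinder_closed I D \<and>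
     C \<subseteq> A \<and> D \<subseteq> Omega - A \<and> 1 - \<epsilon> < measure P C + measure P D)" "0 < \<epsilon>"
  then obtain C D where *: "A \<subseteq> Omega" "cylinder_closed I C" "cylinder_closed I D"
     "C \<subseteq> A" "D \<subseteq> Omega - A" "1 - \<epsilon> < measure P C + measure P D" by blast
  then show "\<exists>C D. cylinder_closed I C \<and> cylinder_closed I D \<and>
     C \<subseteq> Omega - A \<and> D \<subseteq> Omega - (Omega - A) \<and> 1 - \<epsilon> < measure P C + measure P D"
    by (intro exI[of _ D] exI[of _ C]) auto
qed auto

lemma cylinder_regular_empty:
  assumes "P \<in> prob_laws" shows "cylinder_regular I P {}"
proof -
  interpret prob_space P using assms by (rule prob_lawsD)
  have "measure P Omega = 1" using prob_space prob_lawsD(3)[OF assms] by simp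
  then have "\<exists>C D. cylinder_closed I C \<and> cylinder_closed I D \<and> C \<subseteq> {} \<and> D \<subseteq> Omega - {} \<and>
      1 - \<epsilon> < measure P C + measure P D" if "0 < \<epsilon>" for \<epsilon>
    using that by (intro exI[of _ "{}"] exI[of _ Omega])
      (simp add: cylinder_closed_empty cylinder_closed_Omega)
  then show ?thesis unfolding cylinder_regular_def by blast
qed

text \<open>From the outside one takes the intersection of all \<open>D i\<close>; from the inside finitely many \<open>C i\<close> suffice
  by continuity of the measure. The errors \<open>d i\<close> sum up to \<open>\<epsilon> / 2\<close>.\<close>

lemma cylinder_regular_UN:
  fixes A :: "nat \<Rightarrow> (real \<Rightarrow> real^'d) set"
  assumes P: "P \<in> prob_laws" and I: "I \<subseteq> {0..}" and A: "\<And>i. cylinder_regular I P (A i)"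
  shows "cylinder_regular I P (\<Union>i. A i)"
  unfolding cylinder_regular_def
proof (intro conjI allI impI)
  show "(\<Union>i. A i) \<subseteq> Omega" using A unfolding cylinder_regular_def by blast
  fix \<epsilon> :: real assume \<epsilon>: "0 < \<epsilon>"
  interpret prob_space P using P by (rule prob_lawsD)
  have meas: "C \<in> events" if "cylinder_closed I C" for C
    using cylinder_closed_measurable[OF that I] prob_lawsD(2)[OF P] by simp
  define d where "d i = \<epsilon> / 2 * (1 / 2) ^ Suc i" for i :: nat
  have "0 < d i" for i using \<epsilon> by (simp add: d_def)
  then have "\<exists>C D. cylinder_closed I C \<and> cylinder_closed I D \<and>
     C \<subseteq> A i \<and> D \<subseteq> Omega - A i \<and> 1 - d i < prob C + prob D" for i
    using A unfolding cylinder_regular_def by blast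
  then have "\<forall>i. \<exists>CD. cylinder_closed I (fst CD) \<and> cylinder_closed I (snd CD) \<and>
     fst CD \<subseteq> A i \<and> snd CD \<subseteq> Omega - A i \<and> 1 - d i < prob (fst CD) + prob (snd CD)"
    by auto
  then obtain CD where CD: "\<And>i. cylinder_closed I (fst (CD i)) \<and> cylinder_closed I (snd (CD i)) \<and>
     fst (CD i) \<subseteq> A i \<and> snd (CD i) \<subseteq> Omega - A i \<and> 1 - d i < prob (fst (CD i)) + prob (snd (CD i))"
    by (subst (asm) choice_iff) blast
  define C where "C i = fst (CD i)" for i
  define D where "D i = snd (CD i)" for i
  have CD: "cylinder_closed I (C i)" "cylinder_closed I (D i)" "C i \<subseteq> A i" "D i \<subseteq> Omega - A i"
    "1 - d i < prob (C i) + prob (D i)" for i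
    using CD[of i] by (auto simp: C_def D_def)
  have ev: "C i \<in> events" "D i \<in> events" for i using CD meas by auto
  have Omega_ev: "Omega \<in> events" using prob_lawsD(3)[OF P] sets.top[of P] by simp
  have rest: "prob (Omega - (C i \<union> D i)) \<le> d i" for i
  proof -
    have "prob (C i \<union> D i) = prob (C i) + prob (D i)"
      using CD(3,4)[of i] ev by (intro finite_measure_Union) auto
    moreover have "prob (Omega - (C i \<union> D i)) = 1 - prob (C i \<union> D i)"
      using prob_compl[of "C i \<union> D i"] ev prob_lawsD(3)[OF P] by simp
    ultimately show ?thesis using CD(5)[of i] by simp
  qed
  have dsum: "d sums (\<epsilon> / 2)"
    using sums_mult[OF power_half_series, of "\<epsilon> / 2"] by (simp add: d_def[abs_def])
  have rests: "prob (\<Union>i. Omega - (C i \<union> D i)) \<le> \<epsilon> / 2"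
  proof -
    have sm: "summable (\<lambda>i. prob (Omega - (C i \<union> D i)))"
      by (rule summable_comparison_test'[OF sums_summable[OF dsum], of 0])
        (simp only: real_norm_def abs_of_nonneg measure_nonneg rest)
    have "prob (\<Union>i. Omega - (C i \<union> D i)) \<le> (\<Sum>i. prob (Omega - (C i \<union> D i)))"
      using ev Omega_ev by (intro finite_measure_subadditive_countably sm) blast
    also have "\<dots> \<le> suminf d" by (rule suminf_le[OF rest sm sums_summable[OF dsum]])
    finally show ?thesis using sums_unique[OF dsum] by simp
  qed
  have evI: "(\<Inter>i. D i) \<in> events" "(\<Union>i. C i) \<in> events" "(\<Union>i. Omega - (C i \<union> D i)) \<in> events"
    using ev Omega_ev by blast+
  have sumge: "1 - \<epsilon> / 2 \<le> prob (\<Inter>i. D i) + prob (\<Union>i. C i)"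
  proof -
    have "Omega \<subseteq> ((\<Inter>i. D i) \<union> (\<Union>i. C i)) \<union> (\<Union>i. Omega - (C i \<union> D i))" by auto
    then have "prob Omega \<le> prob (((\<Inter>i. D i) \<union> (\<Union>i. C i)) \<union> (\<Union>i. Omega - (C i \<union> D i)))"
      using evI by (intro finite_measure_mono) blast+
    also have "\<dots> \<le> prob ((\<Inter>i. D i) \<union> (\<Union>i. C i)) + prob (\<Union>i. Omega - (C i \<union> D i))"
      using evI by (intro measure_Un_le) blast+
    also have "prob ((\<Inter>i. D i) \<union> (\<Union>i. C i)) \<le> prob (\<Inter>i. D i) + prob (\<Union>i. C i)"
      using evI by (intro measure_Un_le) blast+
    finally show ?thesis using rests prob_space prob_lawsD(3)[OF P] by simp
  qed
  have "(\<lambda>n. prob (\<Union>i<n. C i)) \<longlonglongrightarrow> prob (\<Union>n. \<Union>i<n. C i)"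
  proof (rule finite_Lim_measure_incseq)
    show "range (\<lambda>n. \<Union>i<n. C i) \<subseteq> events" using ev(1) by blast
    show "incseq (\<lambda>n. \<Union>i<n. C i)" unfolding incseq_def by (intro allI impI UN_mono) auto
  qed
  moreover have "(\<Union>n. \<Union>i<n. C i) = (\<Union>i. C i)" by auto
  ultimately have "(\<lambda>n. prob (\<Union>i<n. C i)) \<longlonglongrightarrow> prob (\<Union>i. C i)" by (simp only:)
  then have "eventually (\<lambda>n. prob (\<Union>i. C i) - \<epsilon> / 2 < prob (\<Union>i<n. C i)) sequentially"
    using \<epsilon> by (intro order_tendstoD) auto
  then obtain n where n: "prob (\<Union>i. C i) - \<epsilon> / 2 < prob (\<Union>i<n. C i)"
    by (auto simp: eventually_sequentially)
  show "\<exists>C D. cylinder_closed I C \<and> cylinder_closed I D \<and> C \<subseteq> (\<Union>i. A i) \<and>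
      D \<subseteq> Omega - (\<Union>i. A i) \<and> 1 - \<epsilon> < prob C + prob D"
  proof (intro exI conjI)
    show "cylinder_closed I (\<Union>i<n. C i)" using CD(1) by (rule cylinder_closed_UN)
    show "cylinder_closed I (\<Inter>i. D i)" using CD(2) by (rule cylinder_closed_INT)
    show "(\<Union>i<n. C i) \<subseteq> (\<Union>i. A i)" "(\<Inter>i. D i) \<subseteq> Omega - (\<Union>i. A i)"
      using CD(3,4) by blast+
    show "1 - \<epsilon> < prob (\<Union>i<n. C i) + prob (\<Inter>i. D i)" using n sumge by linarith
  qed
qed

text \<open>The complement of a closed set is the increasing union of the closed sets of points at distance at
  least \<open>1 / (n + 1)\<close>.\<close>

lemma cylinder_regular_coordinate_closed:
  fixes F :: "(real^'d) set"
  assumes P: "P \<in> prob_laws" and I: "I \<subseteq> {0..}" and s: "s \<in> I" and F: "closed F"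
  shows "cylinder_regular I P {\<omega> \<in> Omega. \<omega> s \<in> F}"
  unfolding cylinder_regular_def
proof (intro conjI allI impI)
  fix \<epsilon> :: real assume \<epsilon>: "0 < \<epsilon>"
  interpret prob_space P using P by (rule prob_lawsD)
  obtain K :: "nat \<Rightarrow> (real^'d) set" where K: "\<And>n. closed (K n)" "\<And>n. K n \<subseteq> K (Suc n)" "(\<Union>n. K n) = - F"
  proof (cases "F = {}")
    case True then show thesis using that[of "\<lambda>_. UNIV"] by auto
  next
    case False
    let ?K = "\<lambda>n. {x. 1 / real (Suc n) \<le> infdist x F}"
    show thesis
    proof (rule that[of ?K])
      show "closed (?K n)" for n by (intro closed_Collect_le continuous_intros)
      show "?K n \<subseteq> ?K (Suc n)" for n
      proof -
        have "1 / real (Suc (Suc n)) \<le> 1 / real (Suc n)" by (simp add: frac_le)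
        then show ?thesis by (blast intro: order_trans)
      qed
      have "x \<in> (\<Union>n. ?K n)" if "x \<notin> F" for x
      proof -
        have "0 < infdist x F" using infdist_pos_not_in_closed[OF F False that] .
        then obtain n where "1 / real (Suc n) < infdist x F" using nat_approx_posE by blast
        then show ?thesis by (auto intro: less_imp_le)
      qed
      moreover have "x \<notin> F" if "x \<in> (\<Union>n. ?K n)" for x
        using that infdist_zero[of x F] by (auto simp: not_le)
      ultimately show "(\<Union>n. ?K n) = - F" by blast
    qed
  qed
  let ?A = "{\<omega> \<in> Omega. \<omega> s \<in> F}" and ?D = "\<lambda>n. {\<omega> \<in> Omega. \<omega> s \<in> K n}"
  have cc: "cylinder_closed I ?A" "cylinder_closed I (?D n)" for n
    using cylinder_closed_coordinate[OF s] F K(1) by auto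
  have ev: "?A \<in> events" "?D n \<in> events" for n
    using cylinder_closed_measurable[OF cc(1) I] cylinder_closed_measurable[OF cc(2) I]
      prob_lawsD(2)[OF P] by auto
  have "(\<lambda>n. prob (?D n)) \<longlonglongrightarrow> prob (\<Union>n. ?D n)"
    using ev(2) K(2) by (intro finite_Lim_measure_incseq) (auto simp: incseq_Suc_iff)
  moreover have "(\<Union>n. ?D n) = Omega - ?A" using K(3) by auto
  moreover have "prob (Omega - ?A) = 1 - prob ?A"
    using prob_compl[OF ev(1)] prob_lawsD(3)[OF P] by simp
  ultimately have "(\<lambda>n. prob (?D n)) \<longlonglongrightarrow> 1 - prob ?A" by simp
  then have "eventually (\<lambda>n. 1 - prob ?A - \<epsilon> < prob (?D n)) sequentially"
    using \<epsilon> by (intro order_tendstoD) auto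
  then obtain n where n: "1 - prob ?A - \<epsilon> < prob (?D n)" by (auto simp: eventually_sequentially)
  have "?D n \<subseteq> Omega - ?A" using K(3) by auto
  with n cc show "\<exists>C D. cylinder_closed I C \<and> cylinder_closed I D \<and> C \<subseteq> ?A \<and>
      D \<subseteq> Omega - ?A \<and> 1 - \<epsilon> < prob C + prob D"
    by (intro exI[of _ ?A] exI[of _ "?D n"] conjI) auto
qed auto

lemma cylinder_regular_sets:
  assumes P: "P \<in> prob_laws" and I: "I \<subseteq> {0..}" and A: "A \<in> sets (path_algebra I)"
  shows "cylinder_regular I P A"
  using A unfolding sets_path_algebra
proof induction
  case (Basic a)
  then obtain s A where a: "a = B s -` A \<inter> Omega" and s: "s \<in> I" and "A \<in> sets borel" by auto
  then have "A \<in> sigma_sets UNIV (Collect closed)"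
    by (simp add: borel_eq_closed sets_measure_of)
  then have "cylinder_regular I P {\<omega> \<in> Omega. \<omega> s \<in> A}"
  proof induction
    case (Basic F) then show ?case using cylinder_regular_coordinate_closed[OF P I s] by simp
  next
    case Empty then show ?case using cylinder_regular_empty[OF P] by simp
  next
    case (Compl F)
    have "{\<omega> \<in> Omega. \<omega> s \<in> UNIV - F} = Omega - {\<omega> \<in> Omega. \<omega> s \<in> F}" by auto
    with cylinder_regular_Compl[OF Compl.IH] show ?case by simp
  next
    case (Union F)
    have "{\<omega> \<in> Omega. \<omega> s \<in> (\<Union>i. F i)} = (\<Union>i. {\<omega> \<in> Omega. \<omega> s \<in> F i})" by auto
    with cylinder_regular_UN[OF P I Union.IH] show ?case by simp
  qed
  moreover have "a = {\<omega> \<in> Omega. \<omega> s \<in> A}" by (auto simp: a B_def)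
  ultimately show ?case by simp
next
  case Empty then show ?case using cylinder_regular_empty[OF P] .
next
  case (Compl a) then show ?case using cylinder_regular_Compl by blast
next
  case (Union a) then show ?case using cylinder_regular_UN[OF P I] by blast
qed

lemma cylinder_inner_regular:
  assumes P: "P \<in> prob_laws" and I: "I \<subseteq> {0..}" and A: "A \<in> sets (path_algebra I)" and "0 < \<epsilon>"
  obtains C where "cylinder_closed I C" "C \<subseteq> A" "measure P A - \<epsilon> < measure P C"
proof -
  interpret prob_space P using P by (rule prob_lawsD)
  obtain C D where *: "cylinder_closed I C" "cylinder_closed I D" "C \<subseteq> A" "D \<subseteq> Omega - A"
    "1 - \<epsilon> < measure P C + measure P D"
    using cylinder_regular_sets[OF P I A] \<open>0 < \<epsilon>\<close> unfolding cylinder_regular_def by blast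
  have ev: "A \<in> events" using A sets_path_algebra_mono[OF I] prob_lawsD(2)[OF P] sets_Finf by auto
  have "Omega - A \<in> events" using ev prob_lawsD(3)[OF P] sets.top[of P] by auto
  then have "prob D \<le> prob (Omega - A)" using *(4) by (intro finite_measure_mono) auto
  also have "\<dots> = 1 - prob A" using prob_compl[OF ev] prob_lawsD(3)[OF P] by simp
  finally show thesis using * by (intro that[of C]) auto
qed

section \<open>The upper expectation of a weakly compact family\<close>

lemma weak_topology_topspace: "topspace weak_topology \<subseteq> prob_laws"
  unfolding weak_topology_def topology_generated_by_topspace by blast

lemma weak_topology_open:
  assumes "continuous_map locally_uniform_topology euclideanreal f" "bounded (f ` Omega)" "open U"
  shows "openin weak_topology {P \<in> prob_laws. (\<integral>\<omega>. f \<omega> \<partial>P) \<in> U}"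
  unfolding weak_topology_def using assms by (intro topology_generated_by_Basis) blast

locale compact_laws =
  fixes \<P> :: "(real \<Rightarrow> real^'d) measure set"
  assumes nonempty: "\<P> \<noteq> {}" and compact: "compactin weak_topology \<P>"
begin

lemma laws: "P \<in> \<P> \<Longrightarrow> P \<in> prob_laws"
  using compactin_subset_topspace[OF compact] weak_topology_topspace by blast

lemma Ehat_least:
  assumes "\<And>P. P \<in> \<P> \<Longrightarrow> (\<integral>\<omega>. f \<omega> \<partial>P) \<le> c" shows "Ehat \<P> f \<le> c"
  unfolding Ehat_def using nonempty assms by (intro cSUP_least) auto

lemma expectation_le_Ehat:
  assumes "P \<in> \<P>" "bounded_measurable f" shows "(\<integral>\<omega>. f \<omega> \<partial>P) \<le> Ehat \<P> f"
proof -
  obtain M where M: "\<And>\<omega>. \<omega> \<in> Omega \<Longrightarrow> \<bar>f \<omega>\<bar> \<le> M" using bounded_measurableE[OF assms(2)] by blast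
  have "(\<integral>\<omega>. f \<omega> \<partial>P) \<le> M" if "P \<in> \<P>" for P
    using M by (intro integral_law_le[OF laws[OF that] assms(2)]) (auto dest: abs_le_D1)
  then show ?thesis unfolding Ehat_def using assms(1) by (intro cSUP_upper) (auto intro!: bdd_aboveI2)
qed

lemma Ehat_mono:
  assumes "bounded_measurable f" "bounded_measurable g" "\<And>\<omega>. \<omega> \<in> Omega \<Longrightarrow> f \<omega> \<le> g \<omega>"
  shows "Ehat \<P> f \<le> Ehat \<P> g"
proof (rule Ehat_least)
  fix P assume P: "P \<in> \<P>"
  have "(\<integral>\<omega>. f \<omega> \<partial>P) \<le> (\<integral>\<omega>. g \<omega> \<partial>P)" by (rule integral_law_mono[OF laws[OF P] assms])
  also have "\<dots> \<le> Ehat \<P> g" by (rule expectation_le_Ehat[OF P assms(2)])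
  finally show "(\<integral>\<omega>. f \<omega> \<partial>P) \<le> Ehat \<P> g" .
qed

lemma Ehat_cong:
  assumes "\<And>\<omega>. \<omega> \<in> Omega \<Longrightarrow> f \<omega> = g \<omega>"
  shows "Ehat \<P> f = Ehat \<P> g"
  unfolding Ehat_def
proof (rule SUP_cong[OF refl])
  fix P assume "P \<in> \<P>"
  then show "(\<integral>\<omega>. f \<omega> \<partial>P) = (\<integral>\<omega>. g \<omega> \<partial>P)"
    using assms prob_lawsD(3)[OF laws] by (intro Bochner_Integration.integral_cong) auto
qed

lemma Ehat_affine:
  assumes f: "bounded_measurable f" and b: "0 \<le> b"
  shows "Ehat \<P> (\<lambda>\<omega>. a + b * f \<omega>) = a + b * Ehat \<P> f"
proof (rule antisym)
  have af: "bounded_measurable (\<lambda>\<omega>. a + b * f \<omega>)"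
    by (intro bounded_measurable_add bounded_measurable_mult bounded_measurable_const f)
  show "Ehat \<P> (\<lambda>\<omega>. a + b * f \<omega>) \<le> a + b * Ehat \<P> f"
  proof (rule Ehat_least)
    fix P assume P: "P \<in> \<P>"
    have "b * (\<integral>\<omega>. f \<omega> \<partial>P) \<le> b * Ehat \<P> f"
      using expectation_le_Ehat[OF P f] b by (rule mult_left_mono)
    then show "(\<integral>\<omega>. a + b * f \<omega> \<partial>P) \<le> a + b * Ehat \<P> f"
      unfolding integral_law_affine[OF laws[OF P] f] by simp
  qed
  show "a + b * Ehat \<P> f \<le> Ehat \<P> (\<lambda>\<omega>. a + b * f \<omega>)"
  proof (cases "b = 0")
    case True
    obtain P where P: "P \<in> \<P>" using nonempty by blast
    have "a = (\<integral>\<omega>. a + b * f \<omega> \<partial>P)"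
      unfolding integral_law_affine[OF laws[OF P] f] using True by simp
    also have "\<dots> \<le> Ehat \<P> (\<lambda>\<omega>. a + b * f \<omega>)" by (rule expectation_le_Ehat[OF P af])
    finally show ?thesis using True by simp
  next
    case False
    then have "0 < b" using b by simp
    have "Ehat \<P> f \<le> (Ehat \<P> (\<lambda>\<omega>. a + b * f \<omega>) - a) / b"
    proof (rule Ehat_least)
      fix P assume P: "P \<in> \<P>"
      have "a + b * (\<integral>\<omega>. f \<omega> \<partial>P) \<le> Ehat \<P> (\<lambda>\<omega>. a + b * f \<omega>)"
        unfolding integral_law_affine[OF laws[OF P] f, symmetric] by (rule expectation_le_Ehat[OF P af])
      with \<open>0 < b\<close> show "(\<integral>\<omega>. f \<omega> \<partial>P) \<le> (Ehat \<P> (\<lambda>\<omega>. a + b * f \<omega>) - a) / b"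
        by (simp add: field_simps)
    qed
    with \<open>0 < b\<close> show ?thesis by (simp add: field_simps)
  qed
qed

lemma Ehat_const: "Ehat \<P> (\<lambda>\<omega>. c) = c"
  using Ehat_affine[OF bounded_measurable_const, of 0 c 0] by simp

lemma Ehat_diff_le:
  assumes f: "bounded_measurable f" and g: "bounded_measurable g"
    and le: "\<And>P. P \<in> \<P> \<Longrightarrow> (\<integral>\<omega>. \<bar>f \<omega> - g \<omega>\<bar> \<partial>P) \<le> c"
  shows "\<bar>Ehat \<P> f - Ehat \<P> g\<bar> \<le> c"
proof -
  have *: "Ehat \<P> f \<le> Ehat \<P> g + c" if f: "bounded_measurable f" and g: "bounded_measurable g"
    and le: "\<And>P. P \<in> \<P> \<Longrightarrow> (\<integral>\<omega>. \<bar>f \<omega> - g \<omega>\<bar> \<partial>P) \<le> c" for f g :: "(real \<Rightarrow> real^'d) \<Rightarrow> real"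
  proof (rule Ehat_least)
    fix P assume P: "P \<in> \<P>"
    note i = bounded_measurable_integrable[OF laws[OF P] f] bounded_measurable_integrable[OF laws[OF P] g]
    have "(\<integral>\<omega>. f \<omega> \<partial>P) - (\<integral>\<omega>. g \<omega> \<partial>P) = (\<integral>\<omega>. f \<omega> - g \<omega> \<partial>P)" using i by simp
    also have "\<dots> \<le> (\<integral>\<omega>. \<bar>f \<omega> - g \<omega>\<bar> \<partial>P)" using i by (intro integral_mono) auto
    also have "\<dots> \<le> c" by (rule le[OF P])
    finally show "(\<integral>\<omega>. f \<omega> \<partial>P) \<le> Ehat \<P> g + c" using expectation_le_Ehat[OF P g] by linarith
  qed
  have "Ehat \<P> g \<le> Ehat \<P> f + c"
    using le by (intro *[OF g f]) (simp add: abs_minus_commute)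
  with *[OF f g le] show ?thesis by linarith
qed

lemma Ehat_diff_le_sup:
  assumes f: "bounded_measurable f" and g: "bounded_measurable g"
    and le: "\<And>\<omega>. \<omega> \<in> Omega \<Longrightarrow> \<bar>f \<omega> - g \<omega>\<bar> \<le> c"
  shows "\<bar>Ehat \<P> f - Ehat \<P> g\<bar> \<le> c"
proof (rule Ehat_diff_le[OF f g])
  fix P assume P: "P \<in> \<P>"
  have "bounded_measurable (\<lambda>\<omega>. \<bar>f \<omega> - g \<omega>\<bar>)"
  proof (rule bounded_measurableI)
    show "(\<lambda>\<omega>. \<bar>f \<omega> - g \<omega>\<bar>) \<in> borel_measurable Finf"
      by (intro borel_measurable_abs borel_measurable_diff bounded_measurable_borel f g)
    show "\<bar>\<bar>f \<omega> - g \<omega>\<bar>\<bar> \<le> c" if "\<omega> \<in> Omega" for \<omega> using le[OF that] by simp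
  qed
  then show "(\<integral>\<omega>. \<bar>f \<omega> - g \<omega>\<bar> \<partial>P) \<le> c" using le by (rule integral_law_le[OF laws[OF P]])
qed

lemma Ehat_abs_le:
  assumes f: "bounded_measurable f" and le: "\<And>\<omega>. \<omega> \<in> Omega \<Longrightarrow> \<bar>f \<omega>\<bar> \<le> c"
  shows "\<bar>Ehat \<P> f\<bar> \<le> c"
  using Ehat_diff_le_sup[OF f bounded_measurable_const[of 0]] le by (simp add: Ehat_const)

text \<open>Dini's argument: if the upper expectation of the limit were smaller than \<open>c\<close>, then the weakly open
  sets of laws under which \<open>h n\<close> has expectation below \<open>c'\<close> would cover the compact family, and as they
  increase one of them would contain it.\<close>

lemma Ehat_decreasing_limit:
  assumes cont: "\<And>n::nat. continuous_map locally_uniform_topology euclideanreal (h n)"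
    and meas: "\<And>n. h n \<in> borel_measurable Finf"
    and M: "\<And>n \<omega>. \<omega> \<in> Omega \<Longrightarrow> \<bar>h n \<omega>\<bar> \<le> M"
    and dec: "\<And>n \<omega>. \<omega> \<in> Omega \<Longrightarrow> h (Suc n) \<omega> \<le> h n \<omega>"
    and g: "g \<in> borel_measurable Finf"
    and lim: "\<And>\<omega>. \<omega> \<in> Omega \<Longrightarrow> (\<lambda>n. h n \<omega>) \<longlonglongrightarrow> g \<omega>"
    and c: "\<And>n. c \<le> Ehat \<P> (h n)"
  shows "c \<le> Ehat \<P> g"
proof (rule ccontr)
  assume "\<not> c \<le> Ehat \<P> g"
  then obtain c' where c': "Ehat \<P> g < c'" "c' < c" using dense[of "Ehat \<P> g" c] by auto
  have bm: "bounded_measurable (h n)" for n by (rule bounded_measurableI[OF meas M])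
  have "\<bar>g \<omega>\<bar> \<le> M" if "\<omega> \<in> Omega" for \<omega>
    using LIMSEQ_le_const2[OF tendsto_rabs[OF lim[OF that]]] M[OF that] by blast
  then have bg: "bounded_measurable g" by (rule bounded_measurableI[OF g])
  have decseq: "decseq (\<lambda>n. h n \<omega>)" if "\<omega> \<in> Omega" for \<omega>
    using dec[OF that] by (simp add: decseq_Suc_iff)
  define U where "U n = {P \<in> prob_laws. (\<integral>\<omega>. h n \<omega> \<partial>P) \<in> {..<c'}}" for n
  have openU: "openin weak_topology (U n)" for n
    unfolding U_def using M by (intro weak_topology_open cont) (auto simp: bounded_iff)
  have mono: "U m \<subseteq> U n" if "m \<le> n" for m n
  proof
    fix P assume P: "P \<in> U m"
    then have P': "P \<in> prob_laws" by (simp add: U_def)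
    have "(\<integral>\<omega>. h n \<omega> \<partial>P) \<le> (\<integral>\<omega>. h m \<omega> \<partial>P)"
      using decseqD[OF decseq that] by (intro integral_law_mono[OF P' bm bm])
    with P show "P \<in> U n" by (simp add: U_def)
  qed
  have cover: "\<P> \<subseteq> (\<Union>n. U n)"
  proof
    fix P assume P: "P \<in> \<P>"
    interpret prob_space P using laws[OF P] by (rule prob_lawsD)
    have "(\<lambda>n. \<integral>\<omega>. h n \<omega> \<partial>P) \<longlonglongrightarrow> (\<integral>\<omega>. g \<omega> \<partial>P)"
    proof (rule integral_dominated_convergence[where w = "\<lambda>_. M"])
      show "g \<in> borel_measurable P" "h n \<in> borel_measurable P" for n
        using bounded_measurable_law[OF laws[OF P]] bm bg by auto
      show "AE \<omega> in P. (\<lambda>n. h n \<omega>) \<longlonglongrightarrow> g \<omega>" "AE \<omega> in P. norm (h n \<omega>) \<le> M" for n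
        using lim M prob_lawsD(3)[OF laws[OF P]] by (auto intro!: AE_I2)
    qed simp
    moreover have "(\<integral>\<omega>. g \<omega> \<partial>P) < c'" using expectation_le_Ehat[OF P bg] c'(1) by simp
    ultimately have "eventually (\<lambda>n. (\<integral>\<omega>. h n \<omega> \<partial>P) < c') sequentially" by (rule order_tendstoD)
    then obtain n where "(\<integral>\<omega>. h n \<omega> \<partial>P) < c'" by (auto simp: eventually_sequentially)
    then show "P \<in> (\<Union>n. U n)" using laws[OF P] by (auto simp: U_def)
  qed
  obtain \<F> where \<F>: "finite \<F>" "\<F> \<subseteq> range U" "\<P> \<subseteq> \<Union>\<F>"
    using compact cover openU unfolding compactin_def by (metis imageE)
  obtain N where N: "finite N" "\<F> = U ` N" using finite_subset_image[OF \<F>(1,2)] by blast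
  have "\<P> \<subseteq> U (Max (insert 0 N))"
  proof
    fix P assume "P \<in> \<P>"
    then obtain n where "n \<in> N" "P \<in> U n" using \<F>(3) N(2) by blast
    then show "P \<in> U (Max (insert 0 N))" using mono[of n "Max (insert 0 N)"] N(1) by auto
  qed
  then have "Ehat \<P> (h (Max (insert 0 N))) \<le> c'"
    by (intro Ehat_least) (auto simp: U_def less_imp_le)
  with c[of "Max (insert 0 N)"] c'(2) show False by linarith
qed

text \<open>Paths are uniformly continuous on compact intervals, so the moduli decrease to zero pointwise.\<close>

lemma Ehat_modulus_tendsto_zero:
  assumes "0 \<le> T"
  shows "(\<lambda>n. Ehat \<P> (modulus T (inverse (real (Suc n))))) \<longlonglongrightarrow> 0"
proof (rule decreasing_tendsto)
  let ?d = "\<lambda>n. inverse (real (Suc n))"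
  have bm: "bounded_measurable (modulus T (?d n) :: (real \<Rightarrow> real^'d) \<Rightarrow> real)" for n
  proof (rule bounded_measurableI)
    show "modulus T (?d n) \<in> borel_measurable Finf" by (rule modulus_measurable[OF assms]) simp
    show "\<bar>modulus T (?d n) \<omega>\<bar> \<le> 1" for \<omega> :: "real \<Rightarrow> real^'d"
      using modulus_bounds[OF assms, of "?d n" \<omega>] by simp
  qed
  have mono: "(modulus T (?d n) \<omega> :: real) \<le> modulus T (?d m) \<omega>" if "m \<le> n"
    for m n and \<omega> :: "real \<Rightarrow> real^'d"
    using that by (intro modulus_mono[OF assms]) (auto simp: le_imp_inverse_le)
  have "Ehat \<P> (\<lambda>_. 0) \<le> Ehat \<P> (modulus T (?d n))" for n
    by (intro Ehat_mono bm bounded_measurable_const modulus_bounds(1)[OF assms]) simp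
  then show "\<forall>\<^sub>F n in sequentially. 0 \<le> Ehat \<P> (modulus T (?d n))"
    by (simp add: Ehat_const)
  fix e :: real assume e: "0 < e"
  have "\<exists>N. Ehat \<P> (modulus T (?d N)) < e"
  proof (rule ccontr)
    assume "\<not> (\<exists>N. Ehat \<P> (modulus T (?d N)) < e)"
    then have "e \<le> Ehat \<P> (modulus T (?d n))" for n by (simp add: not_less)
    then have "e \<le> Ehat \<P> (\<lambda>_. 0)"
    proof (rule Ehat_decreasing_limit[rotated -1])
      show "continuous_map locally_uniform_topology euclideanreal (modulus T (?d n) :: (real \<Rightarrow> real^'d) \<Rightarrow> real)" for n
        by (rule modulus_continuous[OF assms]) simp
      show "modulus T (?d n) \<in> borel_measurable Finf" for n
        by (rule modulus_measurable[OF assms]) simp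
      show "\<bar>modulus T (?d n) \<omega>\<bar> \<le> 1" for n and \<omega> :: "real \<Rightarrow> real^'d"
        using modulus_bounds[OF assms, of "?d n" \<omega>] by simp
      show "(\<lambda>n. modulus T (?d n) \<omega>) \<longlonglongrightarrow> 0" if "\<omega> \<in> Omega" for \<omega> :: "real \<Rightarrow> real^'d"
        using LIMSEQ_inverse_real_of_nat by (rule modulus_tendsto_zero[OF that assms]) simp
      show "modulus T (?d (Suc n)) \<omega> \<le> modulus T (?d n) \<omega>" for n and \<omega> :: "real \<Rightarrow> real^'d"
        by (rule mono) simp
    qed simp
    with e show False by (simp add: Ehat_const)
  qed
  then obtain N where N: "Ehat \<P> (modulus T (?d N)) < e" by blast
  have "Ehat \<P> (modulus T (?d n)) < e" if "N \<le> n" for n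
    using Ehat_mono[OF bm bm mono[OF that]] N by linarith
  then show "\<forall>\<^sub>F n in sequentially. Ehat \<P> (modulus T (?d n)) < e"
    unfolding eventually_sequentially by blast
qed

section \<open>Dominated laws\<close>

text \<open>By the Hahn-Banach theorem these laws form the closed convex hull of the family, described here by its
  support function. This set is stable under reflections, which the family itself need not be.\<close>

definition dominated :: "(real \<Rightarrow> real^'d) measure \<Rightarrow> bool" where
  "dominated Q \<longleftrightarrow> Q \<in> prob_laws \<and> (\<forall>X\<in>cylinder {0..}. (\<integral>\<omega>. X \<omega> \<partial>Q) \<le> Ehat \<P> X)"

lemma dominated_law: "P \<in> \<P> \<Longrightarrow> dominated P"
  unfolding dominated_def using laws expectation_le_Ehat bounded_measurable_cylinder by blast

text \<open>The function is replaced by the staircase \<open>F A\<close> over its level sets \<open>A i\<close>, and these are shrunk to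
  sets \<open>C i\<close> whose indicators are decreasing limits of cylinder functions; so is the average \<open>F C\<close>.\<close>

lemma dominated_unit_interval:
  assumes Q: "dominated Q" and f: "f \<in> borel_measurable Finf"
    and f01: "\<And>\<omega>. \<omega> \<in> Omega \<Longrightarrow> 0 \<le> f \<omega> \<and> f \<omega> < 1"
  shows "(\<integral>\<omega>. f \<omega> \<partial>Q) \<le> Ehat \<P> f"
proof (rule field_le_epsilon)
  fix e :: real assume e: "0 < e"
  have Ql: "Q \<in> prob_laws" using Q by (simp add: dominated_def)
  interpret prob_space Q using Ql by (rule prob_lawsD)
  have bf: "bounded_measurable f" using f01 by (intro bounded_measurableI[of f 1] f) force
  obtain k :: nat where k: "2 / e < real k" "0 < k"
    using reals_Archimedean2[of "max (2 / e) 0"] by auto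
  have ke: "1 / real k < e / 2" using k e by (simp add: field_simps)
  define A where "A i = {\<omega> \<in> Omega. real i / k \<le> f \<omega>}" for i
  have A: "A i \<in> sets Finf" for i
  proof -
    have "f -` {real i / k..} \<inter> space Finf \<in> sets Finf" by (rule measurable_sets[OF f]) simp
    moreover have "f -` {real i / k..} \<inter> space Finf = A i" by (auto simp: A_def)
    ultimately show ?thesis by simp
  qed
  have "\<exists>C. cylinder_closed {0..} C \<and> C \<subseteq> A i \<and> prob (A i) - e / 2 < prob C" for i
  proof -
    have "A i \<in> sets (path_algebra {0..})" "0 < e / 2" using A e sets_Finf by auto
    from cylinder_inner_regular[OF Ql order_refl this] show ?thesis by blast
  qed
  then obtain C where C: "\<And>i. cylinder_closed {0..} (C i)" "\<And>i. C i \<subseteq> A i"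
    "\<And>i. prob (A i) - e / 2 < prob (C i)" by metis
  have Cs: "C i \<in> sets Finf" for i using cylinder_closed_measurable[OF C(1)] by simp
  define F where "F D \<omega> = (\<Sum>i<k. indicator (D (Suc i)) \<omega>) / real k" for D :: "nat \<Rightarrow> (real \<Rightarrow> real^'d) set" and \<omega>
  \<comment> \<open>The number of levels \<open>(i + 1) / k\<close> that do not exceed \<open>f \<omega>\<close> is the integer part of \<open>k * f \<omega>\<close>.\<close>
  have sumA: "(\<Sum>i<k. indicator (A (Suc i)) \<omega>) = (of_int \<lfloor>k * f \<omega>\<rfloor> :: real)" if om: "\<omega> \<in> Omega" for \<omega>
  proof -
    have fl: "0 \<le> \<lfloor>k * f \<omega>\<rfloor>" "\<lfloor>k * f \<omega>\<rfloor> < k"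
      using f01[OF om] k(2) by (auto simp: floor_less_iff)
    have "indicator (A (Suc i)) \<omega> = (if i < nat \<lfloor>k * f \<omega>\<rfloor> then 1 else (0::real))" for i
    proof -
      have "\<omega> \<in> A (Suc i) \<longleftrightarrow> real (Suc i) \<le> k * f \<omega>"
        using om k(2) by (auto simp: A_def field_simps)
      also have "\<dots> \<longleftrightarrow> int (Suc i) \<le> \<lfloor>k * f \<omega>\<rfloor>" by (simp add: le_floor_iff)
      also have "\<dots> \<longleftrightarrow> i < nat \<lfloor>k * f \<omega>\<rfloor>" using fl by linarith
      finally show ?thesis by (simp add: indicator_def)
    qed
    then have "(\<Sum>i<k. indicator (A (Suc i)) \<omega>) = (\<Sum>i\<in>{..<k} \<inter> {i. i < nat \<lfloor>k * f \<omega>\<rfloor>}. 1 :: real)"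
      by (simp add: sum.If_cases)
    also have "{..<k} \<inter> {i. i < nat \<lfloor>k * f \<omega>\<rfloor>} = {..<nat \<lfloor>k * f \<omega>\<rfloor>}" using fl by auto
    finally show ?thesis using fl by simp
  qed
  have FA: "F A \<omega> \<le> f \<omega>" "f \<omega> \<le> F A \<omega> + 1 / k" if "\<omega> \<in> Omega" for \<omega>
  proof -
    have "of_int \<lfloor>k * f \<omega>\<rfloor> \<le> k * f \<omega>" "k * f \<omega> \<le> of_int \<lfloor>k * f \<omega>\<rfloor> + 1" by linarith+
    then show "F A \<omega> \<le> f \<omega>" "f \<omega> \<le> F A \<omega> + 1 / k"
      using sumA[OF that] k(2) by (simp_all add: F_def field_simps)
  qed
  have FC: "F C \<omega> \<le> F A \<omega>" for \<omega>
    unfolding F_def using C(2) by (intro divide_right_mono sum_mono) (auto simp: indicator_def)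
  have Fb: "\<bar>F D \<omega>\<bar> \<le> 1" for D \<omega>
  proof -
    have "(\<Sum>i<k. indicator (D (Suc i)) \<omega>) \<le> (\<Sum>i<k. 1 :: real)" by (intro sum_mono) (auto simp: indicator_def)
    moreover have "0 \<le> (\<Sum>i<k. indicator (D (Suc i)) \<omega> :: real)" by (intro sum_nonneg) auto
    ultimately show ?thesis using k(2) by (simp add: F_def)
  qed
  have bF: "bounded_measurable (F D)" if "\<And>i. D i \<in> sets Finf" for D
  proof (rule bounded_measurableI[OF _ Fb])
    show "F D \<in> borel_measurable Finf" unfolding F_def[abs_def] using that by measurable
  qed
  have FCg: "(\<integral>\<omega>. F C \<omega> \<partial>Q) \<le> Ehat \<P> (F C)"
  proof -
    have "\<forall>i. \<exists>h. (\<forall>n::nat. h n \<in> cylinder {0..}) \<and>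
       (\<forall>n. \<forall>\<omega>\<in>Omega. 0 \<le> h n \<omega> \<and> h n \<omega> \<le> 1 \<and> h (Suc n) \<omega> \<le> h n \<omega>) \<and>
       (\<forall>\<omega>\<in>Omega. (\<lambda>n. h n \<omega>) \<longlonglongrightarrow> indicator (C i) \<omega>)"
      using C(1) unfolding cylinder_closed_def by blast
    then obtain h where h: "\<And>i n::nat. h i n \<in> cylinder {0..}"
      "\<And>i n \<omega>. \<omega> \<in> Omega \<Longrightarrow> 0 \<le> h i n \<omega> \<and> h i n \<omega> \<le> 1 \<and> h i (Suc n) \<omega> \<le> h i n \<omega>"
      "\<And>i \<omega>. \<omega> \<in> Omega \<Longrightarrow> (\<lambda>n. h i n \<omega>) \<longlonglongrightarrow> indicator (C i) \<omega>"
      by (subst (asm) choice_iff) blast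
    define H where "H n \<omega> = (1 / real k) * (\<Sum>i<k. h (Suc i) n \<omega>)" for n \<omega>
    have Hc: "H n \<in> cylinder {0..}" for n
      unfolding H_def[abs_def] by (intro cylinder_scale cylinder_sum h(1))
    have Hlim: "(\<lambda>n. H n \<omega>) \<longlonglongrightarrow> F C \<omega>" if "\<omega> \<in> Omega" for \<omega>
    proof -
      have "(\<lambda>n. H n \<omega>) \<longlonglongrightarrow> (1 / real k) * (\<Sum>i<k. indicator (C (Suc i)) \<omega>)"
        unfolding H_def by (intro tendsto_intros h(3) that)
      then show ?thesis by (simp add: F_def)
    qed
    have Hdec: "H (Suc n) \<omega> \<le> H n \<omega>" if "\<omega> \<in> Omega" for n \<omega>
      unfolding H_def using h(2)[OF that] by (intro mult_left_mono sum_mono) auto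
    have Hb: "\<bar>H n \<omega>\<bar> \<le> 1" if "\<omega> \<in> Omega" for n \<omega>
    proof -
      have "(\<Sum>i<k. h (Suc i) n \<omega>) \<le> (\<Sum>i<k. 1 :: real)" using h(2)[OF that] by (intro sum_mono) auto
      moreover have "0 \<le> (\<Sum>i<k. h (Suc i) n \<omega>)" using h(2)[OF that] by (intro sum_nonneg) auto
      ultimately show ?thesis using k(2) by (simp add: H_def)
    qed
    have FH: "F C \<omega> \<le> H n \<omega>" if om: "\<omega> \<in> Omega" for n \<omega>
      using Hlim[OF om] Hdec[OF om] by (intro decseq_ge) (simp add: decseq_Suc_iff)
    show ?thesis
    proof (rule Ehat_decreasing_limit)
      show "(\<integral>\<omega>. F C \<omega> \<partial>Q) \<le> Ehat \<P> (H n)" for n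
      proof -
        have "(\<integral>\<omega>. F C \<omega> \<partial>Q) \<le> (\<integral>\<omega>. H n \<omega> \<partial>Q)"
          by (rule integral_law_mono[OF Ql bF[OF Cs] bounded_measurable_cylinder[OF Hc] FH])
        also have "\<dots> \<le> Ehat \<P> (H n)" using Q Hc unfolding dominated_def by blast
        finally show ?thesis .
      qed
      show "continuous_map locally_uniform_topology euclideanreal (H n)" for n
        by (rule cylinder_continuous[OF Hc])
      show "H n \<in> borel_measurable Finf" for n by (rule cylinder_measurable[OF Hc])
      show "F C \<in> borel_measurable Finf" by (rule bounded_measurable_borel[OF bF[OF Cs]])
    qed (fact Hb Hdec Hlim)+
  qed
  have intF: "(\<integral>\<omega>. F D \<omega> \<partial>Q) = (\<Sum>i<k. prob (D (Suc i))) / k" if "\<And>i. D i \<in> sets Finf" for D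
  proof -
    have D: "D i \<in> events" for i using that prob_lawsD(2)[OF Ql] by simp
    have "(\<integral>\<omega>. (\<Sum>i<k. indicator (D (Suc i)) \<omega> :: real) \<partial>Q) = (\<Sum>i<k. \<integral>\<omega>. indicator (D (Suc i)) \<omega> \<partial>Q)"
      using D by (intro Bochner_Integration.integral_sum) (simp add: emeasure_eq_measure)
    also have "\<dots> = (\<Sum>i<k. prob (D (Suc i)))"
      using D sets.sets_into_space[OF D] by (intro sum.cong) (simp_all add: Int_absorb2)
    finally show ?thesis unfolding F_def by simp
  qed
  have "(\<Sum>i<k. prob (A (Suc i))) \<le> (\<Sum>i<k. prob (C (Suc i)) + e / 2)"
    using C(3) by (intro sum_mono) (simp add: less_imp_le diff_less_eq)
  also have "\<dots> = (\<Sum>i<k. prob (C (Suc i))) + k * (e / 2)" by (simp add: sum.distrib)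
  finally have "(\<integral>\<omega>. F A \<omega> \<partial>Q) \<le> (\<integral>\<omega>. F C \<omega> \<partial>Q) + e / 2"
    unfolding intF[OF A] intF[OF Cs] using k(2) by (simp add: field_simps)
  moreover have "(\<integral>\<omega>. f \<omega> \<partial>Q) \<le> (\<integral>\<omega>. 1 / k + 1 * F A \<omega> \<partial>Q)"
    using FA(2) by (intro integral_law_mono[OF Ql bf] bounded_measurable_add bounded_measurable_mult
        bounded_measurable_const bF[OF A]) (simp add: add.commute)
  moreover have "(\<integral>\<omega>. 1 / k + 1 * F A \<omega> \<partial>Q) = 1 / k + (\<integral>\<omega>. F A \<omega> \<partial>Q)"
    using integral_law_affine[OF Ql bF[OF A], of "1 / k" 1] by simp
  moreover have "Ehat \<P> (F C) \<le> Ehat \<P> f"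
    using FC FA(1) by (intro Ehat_mono[OF bF[OF Cs] bf]) (meson order_trans)
  ultimately show "(\<integral>\<omega>. f \<omega> \<partial>Q) \<le> Ehat \<P> f + e" using FCg ke by linarith
qed

text \<open>An affine change of the values maps \<open>[-M, M]\<close> into \<open>[0, 1)\<close>.\<close>

lemma dominated_bounded_measurable:
  assumes Q: "dominated Q" and f: "bounded_measurable f"
  shows "(\<integral>\<omega>. f \<omega> \<partial>Q) \<le> Ehat \<P> f"
proof -
  have Ql: "Q \<in> prob_laws" using Q by (simp add: dominated_def)
  obtain M where M: "0 \<le> M" "\<And>\<omega>. \<omega> \<in> Omega \<Longrightarrow> \<bar>f \<omega>\<bar> \<le> M" using bounded_measurableE[OF f] by blast
  let ?b = "1 / (2 * M + 1)"
  let ?f = "\<lambda>\<omega>. M * ?b + ?b * f \<omega>"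
  have b: "0 < ?b" using M(1) by simp
  have "(\<integral>\<omega>. ?f \<omega> \<partial>Q) \<le> Ehat \<P> ?f"
  proof (rule dominated_unit_interval[OF Q])
    show "?f \<in> borel_measurable Finf"
      by (intro bounded_measurable_borel bounded_measurable_add bounded_measurable_mult bounded_measurable_const f)
    fix \<omega> :: "real \<Rightarrow> real^'d" assume "\<omega> \<in> Omega"
    then have "0 \<le> M + f \<omega>" "M + f \<omega> < 2 * M + 1" using M(2)[of \<omega>] by linarith+
    moreover have "?f \<omega> = (M + f \<omega>) / (2 * M + 1)" by (simp add: add_divide_distrib)
    ultimately show "0 \<le> ?f \<omega> \<and> ?f \<omega> < 1" using M(1) by simp
  qed
  then have "?b * (\<integral>\<omega>. f \<omega> \<partial>Q) \<le> ?b * Ehat \<P> f"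
    unfolding integral_law_affine[OF Ql f] Ehat_affine[OF f less_imp_le[OF b]] by simp
  with b show ?thesis by (simp only: mult_le_cancel_left_pos)
qed

end

section \<open>Functions of independent G-normal vectors\<close>

lemma Cb_Lip_seq_slice:
  fixes \<phi> :: "(nat \<Rightarrow> 'b::real_normed_vector) \<Rightarrow> real"
  assumes "\<phi> \<in> Cb_Lip_seq (Suc n)" shows "(\<lambda>y. \<phi> (x(n := y))) \<in> Cb_Lip"
proof -
  obtain L M where L: "0 \<le> L" "0 \<le> M" "\<And>x. \<bar>\<phi> x\<bar> \<le> M"
    "\<And>x y. \<bar>\<phi> x - \<phi> y\<bar> \<le> L * (\<Sum>i<Suc n. norm (x i - y i))"
    using Cb_Lip_seq_sum_bound[OF assms] by blast
  show ?thesis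
  proof (rule Cb_LipI[of _ M L])
    fix y z
    have "(\<Sum>i<Suc n. norm ((x(n := y)) i - (x(n := z)) i)) = norm (y - z)" by simp
    with L(4)[of "x(n := y)" "x(n := z)"] show "\<bar>\<phi> (x(n := y)) - \<phi> (x(n := z))\<bar> \<le> L * dist y z"
      by (simp add: dist_norm)
  qed (use L in auto)
qed

text \<open>Rearranging, rescaling and freezing arguments keeps a function bounded and Lipschitz.\<close>

lemma Cb_Lip_seq_compose:
  fixes \<phi> :: "(nat \<Rightarrow> 'b::real_normed_vector) \<Rightarrow> real" and g :: "(nat \<Rightarrow> 'c::real_normed_vector) \<Rightarrow> nat \<Rightarrow> 'b"
  assumes "\<phi> \<in> Cb_Lip_seq n" "0 \<le> K"
    and g: "\<And>i x y. i < n \<Longrightarrow> norm (g x i - g y i) \<le> K * (\<Sum>j<m. norm (x j - y j))"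
  shows "(\<lambda>x. \<phi> (g x)) \<in> Cb_Lip_seq m"
proof -
  obtain L M where L: "0 \<le> L" "0 \<le> M" "\<And>x. \<bar>\<phi> x\<bar> \<le> M"
    "\<And>x y. \<bar>\<phi> x - \<phi> y\<bar> \<le> L * (\<Sum>i<n. norm (x i - y i))"
    using Cb_Lip_seq_sum_bound[OF assms(1)] by blast
  show ?thesis
  proof (rule Cb_Lip_seqI[of _ M "L * (n * K)"])
    fix x y
    have "(\<Sum>i<n. norm (g x i - g y i)) \<le> n * (K * (\<Sum>j<m. norm (x j - y j)))"
      using sum_bounded_above[of "{..<n}" "\<lambda>i. norm (g x i - g y i)"] g by fastforce
    then have "L * (\<Sum>i<n. norm (g x i - g y i)) \<le> L * (n * (K * (\<Sum>j<m. norm (x j - y j))))"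
      using L(1) by (rule mult_left_mono)
    with L(4)[of "g x" "g y"] show "\<bar>\<phi> (g x) - \<phi> (g y)\<bar> \<le> L * (n * K) * (\<Sum>j<m. norm (x j - y j))"
      by (simp add: mult.assoc)
  qed (use L assms(2) in auto)
qed

lemma Cb_Lip_seq_scale:
  fixes \<phi> :: "(nat \<Rightarrow> 'b::real_normed_vector) \<Rightarrow> real"
  assumes "\<phi> \<in> Cb_Lip_seq n" shows "(\<lambda>x. \<phi> (\<lambda>i. c i *\<^sub>R x i)) \<in> Cb_Lip_seq n"
proof (rule Cb_Lip_seq_compose[OF assms, of "\<Sum>i<n. \<bar>c i\<bar>"])
  fix i x y assume i: "i < n"
  have "norm (c i *\<^sub>R x i - c i *\<^sub>R y i) = \<bar>c i\<bar> * norm (x i - y i)" by (simp flip: scaleR_diff_right)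
  also have "\<dots> \<le> (\<Sum>i<n. \<bar>c i\<bar>) * (\<Sum>j<n. norm (x j - y j))"
    using i by (intro mult_mono member_le_sum sum_nonneg) auto
  finally show "norm (c i *\<^sub>R x i - c i *\<^sub>R y i) \<le> (\<Sum>i<n. \<bar>c i\<bar>) * (\<Sum>j<n. norm (x j - y j))" .
qed (simp add: sum_nonneg)

lemma Cb_Lip_seq_freeze:
  fixes \<phi> :: "(nat \<Rightarrow> 'b::real_normed_vector) \<Rightarrow> real"
  assumes "\<phi> \<in> Cb_Lip_seq n" shows "(\<lambda>y. \<phi> (\<lambda>i. if i < m then a i else y i)) \<in> Cb_Lip_seq n"
  by (rule Cb_Lip_seq_compose[OF assms, of 1]) (auto intro!: member_le_sum sum_nonneg)

lemma Cb_Lip_scaleR: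
  fixes \<psi> :: "'b::real_normed_vector \<Rightarrow> real"
  assumes "\<psi> \<in> Cb_Lip" shows "(\<lambda>x. \<psi> (c *\<^sub>R x)) \<in> Cb_Lip"
proof -
  obtain L M where L: "0 \<le> L" "0 \<le> M" "\<And>x. \<bar>\<psi> x\<bar> \<le> M" "\<And>x y. \<bar>\<psi> x - \<psi> y\<bar> \<le> L * dist x y"
    using Cb_LipE[OF assms] by blast
  show ?thesis
  proof (rule Cb_LipI[of _ M "L * \<bar>c\<bar>"])
    show "\<bar>\<psi> (c *\<^sub>R x) - \<psi> (c *\<^sub>R y)\<bar> \<le> L * \<bar>c\<bar> * dist x y" for x y
      using L(4)[of "c *\<^sub>R x" "c *\<^sub>R y"] by (simp add: dist_norm mult.assoc flip: scaleR_diff_right)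
  qed (use L in auto)
qed

lemma finitely_Lipschitz_increment:
  assumes "i < n" "strict_mono_on {..<n} t" "0 \<le> t (0::nat)"
  shows "finitely_Lipschitz {0..} (\<lambda>\<omega>. increment t \<omega> i)"
proof -
  have t: "0 \<le> t j" if "j < n" for j
    using strict_mono_onD[OF assms(2), of 0 j] assms(3) that by (cases "j = 0") auto
  show ?thesis
  proof (cases "i = 0")
    case True then show ?thesis
      using assms(3) by (simp add: increment_def finitely_Lipschitz_coordinate)
  next
    case False
    have "finitely_Lipschitz {0..} (\<lambda>\<omega>. \<omega> (t i) - \<omega> (t (i - 1)))"
      using t[of i] t[of "i - 1"] assms(1) by (intro finitely_Lipschitz_diff finitely_Lipschitz_coordinate) auto
    with False show ?thesis by (simp add: increment_def)
  qed
qed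

section \<open>The G-expectation of cylinder functions\<close>

locale g_expectation = sublinear_expectation_space H E + compact_laws \<P>
  for H :: "('w \<Rightarrow> real) set" and E :: "('w \<Rightarrow> real) \<Rightarrow> real"
    and \<P> :: "(real \<Rightarrow> real^'d) measure set" +
  fixes G :: "real^'d^'d \<Rightarrow> real" and \<xi> :: "nat \<Rightarrow> 'w \<Rightarrow> real^'d"
  assumes iid: "iid_G_normal H E G \<xi>"
    and represents: "\<And>X v. L1G_value E \<xi> \<P> X v \<Longrightarrow> v = Ehat \<P> X"
begin

lemma Ehat_increments:
  assumes \<phi>: "\<phi> \<in> Cb_Lip_seq n" and n: "1 \<le> n" and t: "0 \<le> t 0" "strict_mono_on {..<n} t"
  shows "Ehat \<P> (\<lambda>\<omega>. \<phi> (increment t \<omega>)) =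
    E (\<lambda>w. \<phi> (\<lambda>i. sqrt (increment t (\<lambda>s. s) i) *\<^sub>R \<xi> i w))"
proof -
  let ?X = "\<lambda>\<omega>. \<phi> (increment t \<omega>)"
  let ?v = "E (\<lambda>w. \<phi> (\<lambda>i. sqrt (increment t (\<lambda>s. s) i) *\<^sub>R \<xi> i w))"
  have "?X \<in> cylinder {0..}"
    by (rule cylinder_Cb_Lip_seq[OF \<phi> finitely_Lipschitz_increment[OF _ t(2,1)]])
  then have meas: "?X \<in> borel_measurable Finf" by (rule cylinder_measurable)
  have "Lip_value E \<xi> ?X ?v"
    unfolding Lip_value_def
    by (intro exI[of _ n] exI[of _ t] bexI[OF _ \<phi>] conjI n t ballI) (simp_all add: B_def)
  moreover have "(SUP P\<in>\<P>. \<integral>\<^sup>+\<omega>. ennreal \<bar>?X \<omega> - ?X \<omega>\<bar> \<partial>P) = 0"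
    using nonempty by simp
  ultimately have "L1G_value E \<xi> \<P> ?X ?v"
    unfolding L1G_value_def using meas
    by (intro conjI exI[of _ "\<lambda>_. ?X"] exI[of _ "\<lambda>_. ?v"]) simp_all
  from represents[OF this] show ?thesis by simp
qed

lemma E_identical: "\<psi> \<in> Cb_Lip \<Longrightarrow> E (\<lambda>w. \<psi> (\<xi> i w)) = E (\<lambda>w. \<psi> (\<xi> j w))"
  using iid unfolding iid_G_normal_def identically_distributed_def by blast

lemma Ehat_value:
  assumes \<psi>: "\<psi> \<in> Cb_Lip" and "0 \<le> s"
  shows "Ehat \<P> (\<lambda>\<omega>. \<psi> (\<omega> s)) = E (\<lambda>w. \<psi> (sqrt s *\<^sub>R \<xi> 0 w))"
proof -
  have "(\<lambda>x. \<psi> (x 0)) \<in> Cb_Lip_seq 1"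
  proof -
    obtain L M where L: "0 \<le> L" "0 \<le> M" "\<And>x. \<bar>\<psi> x\<bar> \<le> M" "\<And>x y. \<bar>\<psi> x - \<psi> y\<bar> \<le> L * dist x y"
      using Cb_LipE[OF \<psi>] by blast
    then show ?thesis by (intro Cb_Lip_seqI[of _ M L]) (auto simp: dist_norm)
  qed
  moreover have "strict_mono_on {..<1} (\<lambda>_ :: nat. s)" by (auto simp: strict_mono_on_def)
  ultimately show ?thesis
    using Ehat_increments[of "\<lambda>x. \<psi> (x 0)" 1 "\<lambda>_. s"] \<open>0 \<le> s\<close> by (simp add: increment_def)
qed

lemma Ehat_increment:
  assumes \<psi>: "\<psi> \<in> Cb_Lip" and "0 \<le> t" "0 \<le> s"
  shows "Ehat \<P> (\<lambda>\<omega>. \<psi> (\<omega> (t + s) - \<omega> t)) = E (\<lambda>w. \<psi> (sqrt s *\<^sub>R \<xi> 0 w))"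
proof (cases "s = 0")
  case True then show ?thesis by (simp add: Ehat_const constant_preserving)
next
  case False
  have "(\<lambda>x. \<psi> (x 1)) \<in> Cb_Lip_seq 2"
  proof -
    obtain L M where L: "0 \<le> L" "0 \<le> M" "\<And>x. \<bar>\<psi> x\<bar> \<le> M" "\<And>x y. \<bar>\<psi> x - \<psi> y\<bar> \<le> L * dist x y"
      using Cb_LipE[OF \<psi>] by blast
    have "\<bar>\<psi> (x 1) - \<psi> (y 1)\<bar> \<le> L * (\<Sum>i<2. norm (x i - y i))" for x y :: "nat \<Rightarrow> real^'d"
    proof -
      have "norm (x 1 - y 1) \<le> (\<Sum>i<2. norm (x i - y i))" by (intro member_le_sum) auto
      then show ?thesis using L(4)[of "x 1" "y 1"] mult_left_mono[OF _ L(1)] by (fastforce simp: dist_norm)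
    qed
    then show ?thesis using L(1,3) by (intro Cb_Lip_seqI[of _ M L])
  qed
  from Ehat_increments[OF this, of "\<lambda>i. if i = 0 then t else t + s"] assms False
  have "Ehat \<P> (\<lambda>\<omega>. \<psi> (\<omega> (t + s) - \<omega> t)) = E (\<lambda>w. \<psi> (sqrt s *\<^sub>R \<xi> 1 w))"
    by (simp add: increment_def strict_mono_on_def)
  also have "\<dots> = E (\<lambda>w. \<psi> (sqrt s *\<^sub>R \<xi> 0 w))" by (rule E_identical[OF Cb_Lip_scaleR[OF \<psi>]])
  finally show ?thesis .
qed

lemma Ehat_increment_stationary:
  assumes \<psi>: "\<psi> \<in> Cb_Lip" and "0 \<le> t" "0 \<le> s"
  shows "Ehat \<P> (\<lambda>\<omega>. \<psi> (\<omega> (t + s) - \<omega> t)) = Ehat \<P> (\<lambda>\<omega>. \<psi> (\<omega> s))"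
  using Ehat_increment[OF assms] Ehat_value[OF \<psi> \<open>0 \<le> s\<close>] by simp

text \<open>Expectations of functions of \<open>\<xi> n\<close> are upper expectations of functions of the path, because \<open>\<xi> n\<close> is
  distributed as \<open>B\<close> at time one. Estimates for \<open>E\<close> can thus be read off from those for \<open>Ehat\<close>.\<close>

lemma E_slice:
  assumes "\<phi> \<in> Cb_Lip_seq (Suc n)" "0 \<le> c"
  shows "E (\<lambda>w. \<phi> (x(n := c *\<^sub>R \<xi> n w))) = Ehat \<P> (\<lambda>\<omega>. \<phi> (x(n := \<omega> (c\<^sup>2))))"
proof -
  note sl = Cb_Lip_seq_slice[OF assms(1), of x]
  have "E (\<lambda>w. \<phi> (x(n := c *\<^sub>R \<xi> n w))) = E (\<lambda>w. \<phi> (x(n := c *\<^sub>R \<xi> 0 w)))"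
    by (rule E_identical[OF Cb_Lip_scaleR[OF sl]])
  also have "\<dots> = Ehat \<P> (\<lambda>\<omega>. \<phi> (x(n := \<omega> (c\<^sup>2))))"
    using Ehat_value[OF sl, of "c\<^sup>2"] assms(2) by simp
  finally show ?thesis .
qed

lemma Cb_Lip_seq_Ehat:
  assumes cyl: "\<And>x. F x \<in> cylinder {0..}" and "0 \<le> L"
    and M: "\<And>x \<omega>. \<bar>F x \<omega>\<bar> \<le> M"
    and L: "\<And>x y \<omega>. \<bar>F x \<omega> - F y \<omega>\<bar> \<le> L * (\<Sum>i<n. norm (x i - y i))"
  shows "(\<lambda>x. Ehat \<P> (F x)) \<in> Cb_Lip_seq n"
proof (rule Cb_Lip_seqI[OF _ _ \<open>0 \<le> L\<close>])
  note bm = bounded_measurable_cylinder[OF cyl]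
  show "\<bar>Ehat \<P> (F x)\<bar> \<le> M" for x using M by (intro Ehat_abs_le bm)
  show "\<bar>Ehat \<P> (F x) - Ehat \<P> (F y)\<bar> \<le> L * (\<Sum>i<n. norm (x i - y i))" for x y
    using L by (intro Ehat_diff_le_sup bm)
qed

lemma Cb_Lip_seq_E_slice:
  assumes \<phi>: "\<phi> \<in> Cb_Lip_seq (Suc n)" and c: "0 \<le> c"
  shows "(\<lambda>x. E (\<lambda>w. \<phi> (x(n := c *\<^sub>R \<xi> n w)))) \<in> Cb_Lip_seq n"
  unfolding E_slice[OF assms]
proof -
  obtain L M where L: "0 \<le> L" "0 \<le> M" "\<And>x. \<bar>\<phi> x\<bar> \<le> M"
    "\<And>x y. \<bar>\<phi> x - \<phi> y\<bar> \<le> L * (\<Sum>i<Suc n. norm (x i - y i))"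
    using Cb_Lip_seq_sum_bound[OF \<phi>] by blast
  show "(\<lambda>x. Ehat \<P> (\<lambda>\<omega>. \<phi> (x(n := \<omega> (c\<^sup>2))))) \<in> Cb_Lip_seq n"
  proof (rule Cb_Lip_seq_Ehat[OF _ L(1)])
    show "(\<lambda>\<omega>. \<phi> (x(n := \<omega> (c\<^sup>2)))) \<in> cylinder {0..}" for x
      by (intro cylinder_Cb_Lip[OF Cb_Lip_seq_slice[OF \<phi>]] finitely_Lipschitz_coordinate) simp
    show "\<bar>\<phi> (x(n := \<omega> (c\<^sup>2)))\<bar> \<le> M" for x and \<omega> :: "real \<Rightarrow> real^'d" by (rule L(3))
    show "\<bar>\<phi> (x(n := \<omega> (c\<^sup>2))) - \<phi> (y(n := \<omega> (c\<^sup>2)))\<bar> \<le> L * (\<Sum>i<n. norm (x i - y i))"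
      for x y and \<omega> :: "real \<Rightarrow> real^'d"
    proof -
      have "(\<Sum>i<Suc n. norm ((x(n := \<omega> (c\<^sup>2))) i - (y(n := \<omega> (c\<^sup>2))) i)) = (\<Sum>i<n. norm (x i - y i))"
        by simp
      then show ?thesis using L(4)[of "x(n := \<omega> (c\<^sup>2))" "y(n := \<omega> (c\<^sup>2))"] by simp
    qed
  qed
qed

lemma E_last:
  assumes \<phi>: "\<phi> \<in> Cb_Lip_seq (Suc n)"
  shows "E (\<lambda>w. \<phi> (\<lambda>i. c i *\<^sub>R \<xi> i w)) =
    E (\<lambda>w. E (\<lambda>w'. \<phi> ((\<lambda>i. c i *\<^sub>R \<xi> i w)(n := c n *\<^sub>R \<xi> n w'))))"
proof (cases n)
  case 0
  have "\<phi> ((\<lambda>i. c i *\<^sub>R \<xi> i w)(0 := c 0 *\<^sub>R \<xi> 0 w')) = \<phi> (\<lambda>i. c i *\<^sub>R \<xi> i w')" for w w'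
    by (rule Cb_Lip_seq_cong[OF \<phi>]) (use 0 in auto)
  with 0 show ?thesis by (simp add: constant_preserving)
next
  case (Suc m)
  have "independent_from E (\<xi> n) n \<xi>"
    using iid Suc unfolding iid_G_normal_def by blast
  then have "E (\<lambda>w. \<phi> (\<lambda>i. c i *\<^sub>R ((\<lambda>i. \<xi> i w)(n := \<xi> n w)) i)) =
      E (\<lambda>w. E (\<lambda>w'. \<phi> (\<lambda>i. c i *\<^sub>R ((\<lambda>i. \<xi> i w)(n := \<xi> n w')) i)))"
    unfolding independent_from_def by (rule bspec[OF _ Cb_Lip_seq_scale[OF \<phi>]])
  moreover have "(\<lambda>i. c i *\<^sub>R ((\<lambda>i. \<xi> i w)(n := \<xi> n w')) i) = (\<lambda>i. c i *\<^sub>R \<xi> i w)(n := c n *\<^sub>R \<xi> n w')" for w w'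
    by auto
  moreover have "(\<lambda>i. c i *\<^sub>R \<xi> i w)(n := c n *\<^sub>R \<xi> n w) = (\<lambda>i. c i *\<^sub>R \<xi> i w)" for w
    by auto
  ultimately show ?thesis by (simp only:)
qed

text \<open>The defining independence concerns the last vector only; induction on the number of vectors
  extends it to a block of vectors.\<close>

lemma E_tower:
  assumes "\<phi> \<in> Cb_Lip_seq n" "m \<le> n" "\<And>i. i < n \<Longrightarrow> 0 \<le> c i"
  shows "E (\<lambda>w. \<phi> (\<lambda>i. c i *\<^sub>R \<xi> i w)) =
    E (\<lambda>w. E (\<lambda>w'. \<phi> (\<lambda>i. if i < m then c i *\<^sub>R \<xi> i w else c i *\<^sub>R \<xi> i w')))"
  using assms
proof (induction n arbitrary: \<phi>)
  case 0
  have "\<phi> x = \<phi> y" for x y by (rule Cb_Lip_seq_cong[OF 0(1)]) simp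
  then obtain d where "\<phi> = (\<lambda>_. d)" by blast
  then show ?case by (simp add: constant_preserving)
next
  case (Suc n)
  show ?case
  proof (cases "m = Suc n")
    case True
    have "\<phi> (\<lambda>i. if i < m then c i *\<^sub>R \<xi> i w else c i *\<^sub>R \<xi> i w') = \<phi> (\<lambda>i. c i *\<^sub>R \<xi> i w)" for w w'
      by (rule Cb_Lip_seq_cong[OF Suc.prems(1)]) (use True in auto)
    then show ?thesis by (simp add: constant_preserving)
  next
    case False
    then have m: "m \<le> n" using Suc.prems(2) by simp
    define \<eta> where "\<eta> x = E (\<lambda>w. \<phi> (x(n := c n *\<^sub>R \<xi> n w)))" for x
    have \<eta>: "\<eta> \<in> Cb_Lip_seq n"
      unfolding \<eta>_def[abs_def] by (rule Cb_Lip_seq_E_slice[OF Suc.prems(1)]) (simp add: Suc.prems(3))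
    have inner: "E (\<lambda>w'. \<eta> (\<lambda>i. if i < m then a i else c i *\<^sub>R \<xi> i w')) =
        E (\<lambda>w'. \<phi> (\<lambda>i. if i < m then a i else c i *\<^sub>R \<xi> i w'))" for a
    proof -
      have "(\<lambda>i. if i < m then a i else ((\<lambda>i. c i *\<^sub>R \<xi> i w)(n := y)) i) =
          (\<lambda>i. if i < m then a i else c i *\<^sub>R \<xi> i w)(n := y)" for w y
        using m by (auto simp: fun_eq_iff)
      then show ?thesis
        using E_last[OF Cb_Lip_seq_freeze[OF Suc.prems(1), of m a], of c] by (simp only: \<eta>_def)
    qed
    have "E (\<lambda>w. \<phi> (\<lambda>i. c i *\<^sub>R \<xi> i w)) = E (\<lambda>w. \<eta> (\<lambda>i. c i *\<^sub>R \<xi> i w))"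
      unfolding \<eta>_def by (rule E_last[OF Suc.prems(1)])
    also have "\<dots> = E (\<lambda>w. E (\<lambda>w'. \<eta> (\<lambda>i. if i < m then c i *\<^sub>R \<xi> i w else c i *\<^sub>R \<xi> i w')))"
      using Suc.prems(3) by (intro Suc.IH[OF \<eta> m]) simp
    finally show ?thesis unfolding inner .
  qed
qed

section \<open>Conditional expectation\<close>

text \<open>For a cylinder function this is the nonlinear conditional expectation given the past up to \<open>t\<close>.\<close>

definition cond :: "real \<Rightarrow> ((real \<Rightarrow> real^'d) \<Rightarrow> real) \<Rightarrow> (real \<Rightarrow> real^'d) \<Rightarrow> real" where
  "cond t X \<omega> = Ehat \<P> (\<lambda>\<omega>'. X (paste t \<omega> \<omega>'))"

lemma cylinder_paste:
  assumes "X \<in> cylinder {0..}" "0 \<le> t" "\<omega> \<in> Omega"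
  shows "(\<lambda>\<omega>'. X (paste t \<omega> \<omega>')) \<in> cylinder {0..}"
proof (rule cylinder_compose[OF assms(1)])
  show "paste t \<omega> \<omega>' \<in> Omega" if "\<omega>' \<in> Omega" for \<omega>' using paste_in_Omega assms that by blast
  fix s :: real assume s: "s \<in> {0..}"
  then have "(\<lambda>\<omega>'. paste t \<omega> \<omega>' s) = (\<lambda>\<omega>'. \<omega> (min s t) + (\<omega>' (max s t) - \<omega>' t))"
    by (simp add: paste_def)
  then show "finitely_Lipschitz {0..} (\<lambda>\<omega>'. paste t \<omega> \<omega>' s)"
    using s assms(2) by (simp only:) (intro finitely_Lipschitz_add finitely_Lipschitz_const
        finitely_Lipschitz_diff finitely_Lipschitz_coordinate; simp)
qed

lemma cond_cylinder:
  assumes X: "X \<in> cylinder {0..}" and t: "0 \<le> t"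
  shows "cond t X \<in> cylinder {0..t}"
proof -
  obtain S L where S: "finite S" "S \<subseteq> {0..}" and L: "0 \<le> L"
    and XL: "\<And>\<omega> \<omega>'. \<omega> \<in> Omega \<Longrightarrow> \<omega>' \<in> Omega \<Longrightarrow> norm (X \<omega> - X \<omega>') \<le> L * (\<Sum>s\<in>S. norm (\<omega> s - \<omega>' s))"
    using finitely_LipschitzE[OF cylinder_finitely_Lipschitz[OF X]] by blast
  obtain M where M: "\<And>\<omega>. \<omega> \<in> Omega \<Longrightarrow> \<bar>X \<omega>\<bar> \<le> M" using cylinder_bounded[OF X] by blast
  note bm = bounded_measurable_cylinder[OF cylinder_paste[OF X t]]
  show ?thesis
  proof (rule cylinderI)
    fix \<omega> :: "real \<Rightarrow> real^'d" assume om: "\<omega> \<in> Omega"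
    show "\<bar>cond t X \<omega>\<bar> \<le> M"
      unfolding cond_def using M paste_in_Omega[OF om _ t] by (intro Ehat_abs_le bm[OF om]) blast
  next
    show "finitely_Lipschitz {0..t} (cond t X)"
    proof (rule finitely_Lipschitz_dominated[OF S(1) _ L])
      show "finitely_Lipschitz {0..t} (\<lambda>\<omega>. \<omega> (min s t))" if "s \<in> S" for s
        using that S(2) t by (intro finitely_Lipschitz_coordinate) auto
      fix \<omega> \<omega>' :: "real \<Rightarrow> real^'d" assume om: "\<omega> \<in> Omega" "\<omega>' \<in> Omega"
      have "\<bar>cond t X \<omega> - cond t X \<omega>'\<bar> \<le> L * (\<Sum>s\<in>S. norm (\<omega> (min s t) - \<omega>' (min s t)))"
        unfolding cond_def
      proof (rule Ehat_diff_le_sup[OF bm[OF om(1)] bm[OF om(2)]])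
        fix \<omega>'' :: "real \<Rightarrow> real^'d" assume om'': "\<omega>'' \<in> Omega"
        have "norm (X (paste t \<omega> \<omega>'') - X (paste t \<omega>' \<omega>'')) \<le>
            L * (\<Sum>s\<in>S. norm (paste t \<omega> \<omega>'' s - paste t \<omega>' \<omega>'' s))"
          using om om'' t by (intro XL paste_in_Omega)
        also have "(\<Sum>s\<in>S. norm (paste t \<omega> \<omega>'' s - paste t \<omega>' \<omega>'' s)) =
            (\<Sum>s\<in>S. norm (\<omega> (min s t) - \<omega>' (min s t)))"
          using S(2) by (intro sum.cong) (auto simp: paste_def)
        finally show "\<bar>X (paste t \<omega> \<omega>'') - X (paste t \<omega>' \<omega>'')\<bar> \<le>
            L * (\<Sum>s\<in>S. norm (\<omega> (min s t) - \<omega>' (min s t)))" by simp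
      qed
      then show "norm (cond t X \<omega> - cond t X \<omega>') \<le> L * (\<Sum>s\<in>S. norm (\<omega> (min s t) - \<omega>' (min s t)))"
        by simp
    qed
  qed
qed

text \<open>In a grid that contains \<open>t\<close>, pasting at \<open>t\<close> exchanges the later increments, so the tower property
  of \<open>E\<close> applies.\<close>

lemma Ehat_cond:
  assumes X: "X \<in> cylinder {0..}" and t: "0 \<le> t"
  shows "Ehat \<P> (cond t X) = Ehat \<P> X"
proof -
  have "finite {t}" "{t} \<subseteq> {0..}" using t by auto
  then obtain n ts \<phi> where n: "1 \<le> n" and ts: "strict_mono_on {..<n} ts" "0 \<le> ts 0"
    and tin: "{t} \<subseteq> ts ` {..<n}" and \<phi>: "\<phi> \<in> Cb_Lip_seq n"
    and rep: "\<And>\<omega>. \<omega> \<in> Omega \<Longrightarrow> X \<omega> = \<phi> (increment ts \<omega>)"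
    using cylinder_representation[OF X] by metis
  from tin obtain k where k: "k < n" "ts k = t" by auto
  have ts_pos: "0 \<le> ts i" if "i < n" for i
    using strict_mono_onD[OF ts(1), of 0 i] ts(2) that by (cases "i = 0") auto
  have ts_le: "ts i \<le> t" if "i \<le> k" for i
    using strict_mono_onD[OF ts(1), of i k] k that by (cases "i = k") auto
  have ts_ge: "t \<le> ts i" if "k \<le> i" "i < n" for i
    using strict_mono_onD[OF ts(1), of k i] k that by (cases "i = k") auto
  define c where "c i = sqrt (increment ts (\<lambda>s. s) i)" for i
  have c: "0 \<le> c i" if "i < n" for i
  proof (cases "i = 0")
    case True then show ?thesis using ts(2) by (simp add: c_def increment_def)
  next
    case False
    then have "ts (i - 1) < ts i" using that by (intro strict_mono_onD[OF ts(1)]) auto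
    with False show ?thesis by (simp add: c_def increment_def)
  qed
  have inc: "increment ts (paste t \<omega> \<omega>') i = (if i < Suc k then increment ts \<omega> i else increment ts \<omega>' i)"
    if i: "i < n" for i and \<omega> \<omega>' :: "real \<Rightarrow> real^'d"
  proof (cases "i < Suc k")
    case True
    have "paste t \<omega> \<omega>' (ts j) = \<omega> (ts j)" if "j \<le> i" for j
      using True that i ts_le[of j] ts_pos[of j] by (simp add: paste_def min_absorb1 max_absorb2)
    with True show ?thesis by (simp add: increment_def)
  next
    case False
    have "paste t \<omega> \<omega>' (ts j) = \<omega> t + (\<omega>' (ts j) - \<omega>' t)" if "k \<le> j" "j \<le> i" for j
      using that i ts_ge[of j] ts_pos[of j] by (simp add: paste_def min_absorb2 max_absorb1)
    with False show ?thesis by (simp add: increment_def)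
  qed
  define \<psi> where "\<psi> a = Ehat \<P> (\<lambda>\<omega>. \<phi> (\<lambda>i. if i < Suc k then a i else increment ts \<omega> i))" for a
  have \<psi>E: "\<psi> a = E (\<lambda>w. \<phi> (\<lambda>i. if i < Suc k then a i else c i *\<^sub>R \<xi> i w))" for a
    unfolding \<psi>_def c_def by (rule Ehat_increments[OF Cb_Lip_seq_freeze[OF \<phi>] n ts(2,1)])
  obtain L M where L: "0 \<le> L" "0 \<le> M" "\<And>x. \<bar>\<phi> x\<bar> \<le> M"
    "\<And>x y. \<bar>\<phi> x - \<phi> y\<bar> \<le> L * (\<Sum>i<n. norm (x i - y i))"
    using Cb_Lip_seq_sum_bound[OF \<phi>] by blast
  have \<psi>: "\<psi> \<in> Cb_Lip_seq n"
    unfolding \<psi>_def[abs_def]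
  proof (rule Cb_Lip_seq_Ehat[OF _ L(1)])
    show "(\<lambda>\<omega>. \<phi> (\<lambda>i. if i < Suc k then a i else increment ts \<omega> i)) \<in> cylinder {0..}" for a
      by (rule cylinder_Cb_Lip_seq[OF Cb_Lip_seq_freeze[OF \<phi>] finitely_Lipschitz_increment[OF _ ts]])
    fix a b :: "nat \<Rightarrow> real^'d" and \<omega> :: "real \<Rightarrow> real^'d"
    let ?f = "\<lambda>a i. if i < Suc k then a i else increment ts \<omega> i"
    have "(\<Sum>i<n. norm (?f a i - ?f b i)) \<le> (\<Sum>i<n. norm (a i - b i))" by (intro sum_mono) auto
    then have "L * (\<Sum>i<n. norm (?f a i - ?f b i)) \<le> L * (\<Sum>i<n. norm (a i - b i))"
      using L(1) by (rule mult_left_mono)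
    with L(4)[of "?f a" "?f b"] show "\<bar>\<phi> (?f a) - \<phi> (?f b)\<bar> \<le> L * (\<Sum>i<n. norm (a i - b i))"
      by (rule order_trans)
  qed (rule L(3))
  have "cond t X \<omega> = \<psi> (increment ts \<omega>)" if om: "\<omega> \<in> Omega" for \<omega>
    unfolding cond_def \<psi>_def
  proof (rule Ehat_cong)
    fix \<omega>' :: "real \<Rightarrow> real^'d" assume "\<omega>' \<in> Omega"
    then have "X (paste t \<omega> \<omega>') = \<phi> (increment ts (paste t \<omega> \<omega>'))"
      using rep paste_in_Omega om t by blast
    also have "\<dots> = \<phi> (\<lambda>i. if i < Suc k then increment ts \<omega> i else increment ts \<omega>' i)"
      by (rule Cb_Lip_seq_cong[OF \<phi> inc])
    finally show "X (paste t \<omega> \<omega>') = \<phi> (\<lambda>i. if i < Suc k then increment ts \<omega> i else increment ts \<omega>' i)" .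
  qed
  then have "Ehat \<P> (cond t X) = Ehat \<P> (\<lambda>\<omega>. \<psi> (increment ts \<omega>))" by (rule Ehat_cong)
  also have "\<dots> = E (\<lambda>w. \<psi> (\<lambda>i. c i *\<^sub>R \<xi> i w))"
    unfolding c_def by (rule Ehat_increments[OF \<psi> n ts(2,1)])
  also have "\<dots> = E (\<lambda>w. \<phi> (\<lambda>i. c i *\<^sub>R \<xi> i w))"
    unfolding \<psi>E using k(1) by (intro E_tower[OF \<phi> _ c, symmetric]) auto
  also have "\<dots> = Ehat \<P> (\<lambda>\<omega>. \<phi> (increment ts \<omega>))"
    unfolding c_def by (rule Ehat_increments[OF \<phi> n ts(2,1), symmetric])
  also have "\<dots> = Ehat \<P> X" by (rule Ehat_cong) (rule rep[symmetric])
  finally show ?thesis .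
qed

end

section \<open>Smoothing by a bump function\<close>

text \<open>The exponent \<open>n \<ge> 2\<close> makes the one-sided derivatives at zero agree.\<close>

lemma DERIV_pos_part_power:
  fixes x :: real
  assumes "2 \<le> n"
  shows "((\<lambda>x. max 0 x ^ n) has_real_derivative real n * max 0 x ^ (n - 1)) (at x)"
proof -
  consider "x < 0" | "x = 0" | "0 < x" by linarith
  then show ?thesis
  proof cases
    case 1
    have ev: "\<forall>\<^sub>F y in nhds x. 0 = max 0 y ^ n"
      using eventually_nhds_in_open[of "{..<0}" x] 1 assms by (auto elim!: eventually_mono)
    have "((\<lambda>x. max 0 x ^ n) has_real_derivative 0) (at x)"
      by (rule DERIV_cong_ev[OF refl ev refl, THEN iffD1]) simp
    with 1 assms show ?thesis by (simp add: max_absorb1 power_0_left)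
  next
    case 2
    have "(\<lambda>h :: real. max 0 h ^ n / h) \<midarrow>0\<rightarrow> 0"
    proof (rule Lim_null_comparison)
      show "\<forall>\<^sub>F h in at 0. norm (max 0 h ^ n / h) \<le> \<bar>h\<bar> ^ (n - 1)"
      proof (rule always_eventually, rule allI)
        fix h :: real
        have "n = Suc (n - 1)" using assms by simp
        then have "\<bar>h\<bar> ^ n = \<bar>h\<bar> ^ (n - 1) * \<bar>h\<bar>" by (metis power_Suc2)
        moreover have "max 0 h ^ n \<le> \<bar>h\<bar> ^ n" by (intro power_mono) auto
        ultimately show "norm (max 0 h ^ n / h) \<le> \<bar>h\<bar> ^ (n - 1)"
          by (cases "h = 0") (auto simp: divide_le_eq)
      qed
      have "((\<lambda>h :: real. \<bar>h\<bar> ^ (n - 1)) \<longlongrightarrow> \<bar>0\<bar> ^ (n - 1)) (at 0)" by (intro tendsto_intros)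
      then show "((\<lambda>h :: real. \<bar>h\<bar> ^ (n - 1)) \<longlongrightarrow> 0) (at 0)" using assms by (simp add: power_0_left)
    qed
    then show ?thesis using 2 assms by (simp add: DERIV_def power_0_left)
  next
    case 3
    have ev: "\<forall>\<^sub>F y in nhds x. y ^ n = max 0 y ^ n"
      using eventually_nhds_in_open[of "{0<..}" x] 3 by (auto elim!: eventually_mono)
    have "((\<lambda>x. max 0 x ^ n) has_real_derivative real n * x ^ (n - 1)) (at x)"
      by (rule DERIV_cong_ev[OF refl ev refl, THEN iffD1]) (use DERIV_pow[of n x] in simp)
    with 3 show ?thesis by simp
  qed
qed

text \<open>The fourth power has bounded third derivatives along lines, and the support is the unit ball.\<close>

definition bump :: "'a::euclidean_space \<Rightarrow> real" where
  "bump z = max 0 (1 - (norm z)\<^sup>2) ^ 4"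

lemma bump_nonneg: "0 \<le> bump z" and bump_le_1: "bump z \<le> 1"
  and bump_outside: "1 \<le> norm z \<Longrightarrow> bump z = 0"
proof -
  show "0 \<le> bump z" by (simp add: bump_def)
  show "bump z \<le> 1" unfolding bump_def by (intro power_le_one) auto
  assume "1 \<le> norm z"
  then have "1 \<le> (norm z)\<^sup>2" by (rule one_le_power)
  then show "bump z = 0" by (simp add: bump_def)
qed

lemma bump_continuous: "continuous_on UNIV bump"
  unfolding bump_def[abs_def] by (intro continuous_intros)

text \<open>Taylor expansion of the even function along a line: in the difference of the two values the
  terms of order zero and two cancel.\<close>

lemma bump_difference:
  fixes z u :: "'a::euclidean_space"
  shows "\<bar>bump (z + u) - bump (z - u) + 16 * max 0 (1 - (norm z)\<^sup>2) ^ 3 * (z \<bullet> u)\<bar> \<le> 112 * norm u ^ 3"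
proof -
  define q where "q s = 1 - (norm (z + s *\<^sub>R u))\<^sup>2" for s
  define q' where "q' s = - 2 * ((z + s *\<^sub>R u) \<bullet> u)" for s
  define q'' where "q'' = - 2 * (u \<bullet> u)"
  define m where "m n s = max 0 (q s) ^ n" for n s
  have q_eq: "q s = 1 - (z \<bullet> z + 2 * s * (z \<bullet> u) + s\<^sup>2 * (u \<bullet> u))" for s
    unfolding q_def power2_norm_eq_inner
    by (simp add: inner_add_left inner_add_right inner_commute power2_eq_square)
  have dq: "(q has_real_derivative q' s) (at s)" for s
    unfolding q_eq[abs_def] q'_def
    by (auto intro!: derivative_eq_intros simp: inner_add_left algebra_simps)
  have dq': "(q' has_real_derivative q'') (at s)" for s
    unfolding q'_def[abs_def] q''_def
    by (auto intro!: derivative_eq_intros simp: inner_add_left)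
  have dm: "((m n) has_real_derivative real n * m (n - 1) s * q' s) (at s)" if "2 \<le> n" for n s
    unfolding m_def[abs_def] by (rule DERIV_chain2[OF DERIV_pos_part_power[OF that] dq])
  \<comment> \<open>The functions \<open>D 0\<close> to \<open>D 3\<close> are \<open>bump (z + s *\<^sub>R u)\<close> as a function of \<open>s\<close> and its derivatives.\<close>
  define D where "D k = (if k = 0 then m 4 else if k = Suc 0 then (\<lambda>s. 4 * m 3 s * q' s)
      else if k = 2 then (\<lambda>s. 12 * m 2 s * (q' s)\<^sup>2 + 4 * m 3 s * q'')
      else (\<lambda>s. 24 * m 1 s * q' s ^ 3 + 36 * m 2 s * q' s * q''))" for k :: nat
  have dD: "DERIV (D k) s :> D (Suc k) s" if "k < 3" for k s
  proof -
    note d4 = dm[of 4 s, simplified] and d3 = dm[of 3 s, simplified] and d2 = dm[of 2 s, simplified]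
    consider "k = 0" | "k = 1" | "k = 2" using \<open>k < 3\<close> by linarith
    then show ?thesis
    proof cases
      case 1 then show ?thesis using d4 by (simp add: D_def)
    next
      case 2
      show ?thesis unfolding D_def using 2
        by (auto intro!: derivative_eq_intros d3 dq' simp: power2_eq_square algebra_simps)
    next
      case 3
      show ?thesis unfolding D_def using 3
        by (auto intro!: derivative_eq_intros d3 d2 dq' simp: power2_eq_square power3_eq_cube algebra_simps)
    qed
  qed
  have D3: "\<bar>D 3 s\<bar> \<le> 336 * norm u ^ 3" for s
  proof (cases "q s \<le> 0")
    case True then show ?thesis by (simp add: D_def m_def max_absorb1)
  next
    case False
    have "q s \<le> 1" by (simp add: q_def)
    then have m1: "0 \<le> m n s" "m n s \<le> 1" for n
      unfolding m_def by (auto intro: power_le_one)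
    have "(norm (z + s *\<^sub>R u))\<^sup>2 \<le> 1\<^sup>2" using False by (simp add: q_def)
    then have "norm (z + s *\<^sub>R u) \<le> 1" by (rule power2_le_imp_le) simp
    then have "\<bar>(z + s *\<^sub>R u) \<bullet> u\<bar> \<le> 1 * norm u"
      by (intro order_trans[OF Cauchy_Schwarz_ineq2] mult_right_mono) auto
    then have q'b: "\<bar>q' s\<bar> \<le> 2 * norm u" by (simp add: q'_def abs_mult)
    have q''b: "\<bar>q''\<bar> = 2 * (norm u)\<^sup>2" by (simp add: q''_def power2_norm_eq_inner)
    have "\<bar>24 * m 1 s * q' s ^ 3\<bar> \<le> 24 * 1 * (2 * norm u) ^ 3"
      using m1[of 1] q'b unfolding abs_mult power_abs by (intro mult_mono power_mono) auto
    moreover have "\<bar>36 * m 2 s * q' s * q''\<bar> \<le> 36 * 1 * (2 * norm u) * (2 * (norm u)\<^sup>2)"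
      using m1[of 2] q'b q''b unfolding abs_mult by (intro mult_mono) auto
    ultimately have "\<bar>D 3 s\<bar> \<le> 24 * 1 * (2 * norm u) ^ 3 + 36 * 1 * (2 * norm u) * (2 * (norm u)\<^sup>2)"
      unfolding D_def by (simp del: mult_1_right)
    then show ?thesis by (simp add: power3_eq_cube power2_eq_square)
  qed
  have "\<exists>t>0. t < 1 \<and> m 4 1 = (\<Sum>k<3. D k 0 / fact k * 1 ^ k) + D 3 t / fact 3 * 1 ^ 3"
    by (rule Maclaurin) (simp_all add: D_def[of 0] dD)
  then obtain t where t: "m 4 1 = (\<Sum>k<3. D k 0 / fact k * 1 ^ k) + D 3 t / fact 3 * 1 ^ 3" by blast
  have "\<exists>t. -1 < t \<and> t < 0 \<and> m 4 (-1) = (\<Sum>k<3. D k 0 / fact k * (-1) ^ k) + D 3 t / fact 3 * (-1) ^ 3"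
    by (rule Maclaurin_minus) (simp_all add: D_def[of 0] dD)
  then obtain t' where t': "m 4 (-1) = (\<Sum>k<3. D k 0 / fact k * (-1) ^ k) + D 3 t' / fact 3 * (-1) ^ 3" by blast
  have "m 4 1 - m 4 (-1) = 2 * D 1 0 + (D 3 t + D 3 t') / 6"
    unfolding t t' by (simp add: eval_nat_numeral)
  moreover have "m 4 1 = bump (z + u)" "m 4 (-1) = bump (z - u)" by (simp_all add: m_def q_def bump_def)
  moreover have "D 1 0 = - 8 * max 0 (1 - (norm z)\<^sup>2) ^ 3 * (z \<bullet> u)"
    by (simp add: D_def m_def q_def q'_def)
  ultimately have "bump (z + u) - bump (z - u) + 16 * max 0 (1 - (norm z)\<^sup>2) ^ 3 * (z \<bullet> u) =
      (D 3 t + D 3 t') / 6" by simp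
  moreover have "\<bar>(D 3 t + D 3 t') / 6\<bar> \<le> 112 * norm u ^ 3"
    using order_trans[OF abs_triangle_ineq add_mono[OF D3[of t] D3[of t']]] by simp
  ultimately show ?thesis by simp
qed

lemma integrable_lborel_bounded_support:
  fixes f :: "'a::euclidean_space \<Rightarrow> 'b::{banach, second_countable_topology}"
  assumes "f \<in> borel_measurable borel" "\<And>z. norm (f z) \<le> M" "\<And>z. z \<notin> S \<Longrightarrow> f z = 0" "compact S"
  shows "integrable lborel f"
  by (rule integrableI_bounded_set[of S _ _ M])
    (use assms emeasure_compact_finite[OF assms(4)] in \<open>auto intro: borel_compact\<close>)

lemma integral_lborel_bounded_support:
  fixes f :: "'a::euclidean_space \<Rightarrow> 'b::{banach, second_countable_topology}"
  assumes "f \<in> borel_measurable borel" "\<And>z. norm (f z) \<le> M" "\<And>z. z \<notin> S \<Longrightarrow> f z = 0" "compact S"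
  shows "norm (\<integral>z. f z \<partial>lborel) \<le> M * measure lborel S"
proof -
  have S: "S \<in> sets lborel" "emeasure lborel S < \<infinity>"
    using emeasure_compact_finite[OF assms(4)] assms(4) by (auto intro: borel_compact)
  have "norm (\<integral>z. f z \<partial>lborel) \<le> (\<integral>z. M * indicator S z \<partial>lborel)"
  proof (rule Bochner_Integration.integral_norm_bound_integral)
    show "integrable lborel f" by (rule integrable_lborel_bounded_support[OF assms])
    show "integrable lborel (\<lambda>z. M * indicator S z)" using S by simp
    show "norm (f z) \<le> M * indicator S z" for z using assms(2,3)[of z] by (simp add: indicator_def)
  qed
  then show ?thesis by simp
qed

definition bump_mass :: "'a::euclidean_space itself \<Rightarrow> real" where
  "bump_mass _ = (\<integral>z. bump (z :: 'a) \<partial>lborel)"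

lemma bump_integrable: "integrable lborel (bump :: 'a::euclidean_space \<Rightarrow> real)"
proof (rule integrable_lborel_bounded_support[of _ 1 "cball 0 1"])
  show "bump \<in> borel_measurable borel" by (rule borel_measurable_continuous_onI[OF bump_continuous])
qed (simp_all add: bump_nonneg bump_le_1 bump_outside)

lemma bump_mass_pos: "0 < bump_mass TYPE('a::euclidean_space)"
proof -
  let ?B = "cball (0 :: 'a) (1 / 2)"
  have B: "emeasure lborel ?B < \<infinity>" by (rule emeasure_compact_finite) simp
  have "(\<integral>z. (81 / 256) * indicator ?B z \<partial>lborel) \<le> bump_mass TYPE('a)"
    unfolding bump_mass_def
  proof (rule integral_mono[OF _ bump_integrable])
    show "integrable lborel (\<lambda>z. (81 / 256) * indicator ?B z :: real)" using B by simp
    fix z :: 'a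
    show "(81 / 256) * indicator ?B z \<le> bump z"
    proof (cases "z \<in> ?B")
      case True
      then have "(norm z)\<^sup>2 \<le> (1 / 2)\<^sup>2" by (intro power_mono) auto
      then have "3 / 4 \<le> max 0 (1 - (norm z)\<^sup>2)" by (simp add: power2_eq_square)
      then have "(3 / 4) ^ 4 \<le> bump z" unfolding bump_def by (rule power_mono) simp
      moreover have "((3 :: real) / 4) ^ 4 = 81 / 256" by (simp add: eval_nat_numeral)
      ultimately show ?thesis using True by simp
    qed (simp add: bump_nonneg)
  qed
  then have "(81 / 256) * measure lborel ?B \<le> bump_mass TYPE('a)" using B by simp
  moreover have "0 < (81 / 256) * measure lborel ?B" by (intro mult_pos_pos content_cball_pos) simp_all
  ultimately show ?thesis by (rule less_le_trans[rotated])
qed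

text \<open>Normalised, the bump is the density of a probability measure, so that mollification is an
  average over random translates.\<close>

definition bump_law :: "'a::euclidean_space measure" where
  "bump_law = density lborel (\<lambda>z. ennreal (bump z / bump_mass TYPE('a)))"

lemma bump_measurable [measurable]: "bump \<in> borel_measurable borel"
  by (rule borel_measurable_continuous_onI[OF bump_continuous])

lemma sets_bump_law [simp]: "sets bump_law = sets borel" by (simp add: bump_law_def)

lemma space_bump_law [simp]: "space bump_law = UNIV" by (simp add: bump_law_def)

lemma prob_space_bump_law: "prob_space (bump_law :: 'a::euclidean_space measure)"
proof
  have "emeasure (bump_law :: 'a measure) (space bump_law) =
      (\<integral>\<^sup>+z. ennreal (bump (z :: 'a) / bump_mass TYPE('a)) \<partial>lborel)"
    by (simp add: bump_law_def emeasure_density)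
  also have "\<dots> = ennreal (\<integral>z. bump (z :: 'a) / bump_mass TYPE('a) \<partial>lborel)"
    using bump_integrable less_imp_le[OF bump_mass_pos[where 'a = 'a]]
    by (intro nn_integral_eq_integral) (auto simp: bump_nonneg)
  also have "(\<integral>z. bump (z :: 'a) / bump_mass TYPE('a) \<partial>lborel) = 1"
    using bump_mass_pos[where 'a = 'a] by (simp add: bump_mass_def)
  finally show "emeasure (bump_law :: 'a measure) (space bump_law) = 1" by simp
qed

lemma bump_law_UNIV [simp]: "measure (bump_law :: 'a::euclidean_space measure) UNIV = 1"
  using prob_space.prob_space[OF prob_space_bump_law[where 'a = 'a]] by simp

lemma integral_bump_law:
  fixes f :: "'a::euclidean_space \<Rightarrow> real"
  assumes "f \<in> borel_measurable borel"
  shows "(\<integral>z. f z \<partial>bump_law) = (\<integral>z. bump z * f z \<partial>lborel) / bump_mass TYPE('a)"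
proof -
  have "(\<integral>z. f z \<partial>bump_law) = (\<integral>z. (bump z / bump_mass TYPE('a)) * f z \<partial>lborel)"
    unfolding bump_law_def using assms less_imp_le[OF bump_mass_pos[where 'a = 'a]]
    by (subst integral_density) (auto simp: bump_nonneg)
  then show ?thesis by simp
qed

lemma AE_bump_law: "AE z in bump_law. norm (z :: 'a::euclidean_space) \<le> 1"
proof -
  have "AE z in lborel. 0 < ennreal (bump z / bump_mass TYPE('a)) \<longrightarrow> norm (z :: 'a) \<le> 1"
  proof (rule AE_I2, rule impI)
    fix z :: 'a assume "0 < ennreal (bump z / bump_mass TYPE('a))"
    then have "bump z \<noteq> 0" by auto
    then show "norm z \<le> 1" using bump_outside[of z] by linarith
  qed
  then show ?thesis unfolding bump_law_def by (subst AE_density) auto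
qed

definition mollify :: "real \<Rightarrow> ('a::euclidean_space \<Rightarrow> real) \<Rightarrow> 'a \<Rightarrow> real" where
  "mollify \<epsilon> v x = (\<integral>z. v (x + \<epsilon> *\<^sub>R z) \<partial>bump_law)"

lemma Cb_Lip_shift_measurable:
  fixes v :: "'a::euclidean_space \<Rightarrow> real"
  assumes "v \<in> Cb_Lip" shows "(\<lambda>z. v (x + \<epsilon> *\<^sub>R z)) \<in> borel_measurable borel"
proof (rule borel_measurable_continuous_onI)
  show "continuous_on UNIV (\<lambda>z. v (x + \<epsilon> *\<^sub>R z))"
    by (rule continuous_on_compose2[OF Cb_Lip_continuous[OF assms]]) (auto intro!: continuous_intros)
qed

lemma Cb_Lip_bump_law_integrable:
  fixes v :: "'a::euclidean_space \<Rightarrow> real"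
  assumes "v \<in> Cb_Lip" shows "integrable bump_law (\<lambda>z. v (x + \<epsilon> *\<^sub>R z))"
proof -
  interpret prob_space "bump_law :: 'a measure" by (rule prob_space_bump_law)
  obtain L M where L: "0 \<le> L" "0 \<le> M" "\<And>x. \<bar>v x\<bar> \<le> M" "\<And>x y. \<bar>v x - v y\<bar> \<le> L * dist x y"
    using Cb_LipE[OF assms] by blast
  have "AE z in bump_law. norm (v (x + \<epsilon> *\<^sub>R z)) \<le> M" using L(3) by (intro AE_I2) simp
  moreover have "(\<lambda>z. v (x + \<epsilon> *\<^sub>R z)) \<in> borel_measurable bump_law"
    using Cb_Lip_shift_measurable[OF assms] measurable_cong_sets[OF sets_bump_law refl] by blast
  ultimately show ?thesis by (rule integrable_const_bound)
qed

lemma mollify_abs_le: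
  fixes v :: "'a::euclidean_space \<Rightarrow> real"
  assumes "v \<in> Cb_Lip" "\<And>x. \<bar>v x\<bar> \<le> M" shows "\<bar>mollify \<epsilon> v x\<bar> \<le> M"
proof -
  interpret prob_space "bump_law :: 'a measure" by (rule prob_space_bump_law)
  have "\<bar>mollify \<epsilon> v x\<bar> \<le> (\<integral>z. M \<partial>(bump_law :: 'a measure))"
    unfolding mollify_def real_norm_def[symmetric]
    by (rule Bochner_Integration.integral_norm_bound_integral[OF Cb_Lip_bump_law_integrable[OF assms(1)]]) (simp_all add: assms(2))
  then show ?thesis by simp
qed

lemma mollify_Lipschitz:
  fixes v :: "'a::euclidean_space \<Rightarrow> real"
  assumes "v \<in> Cb_Lip" "\<And>x y. \<bar>v x - v y\<bar> \<le> L * dist x y"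
  shows "\<bar>mollify \<epsilon> v x - mollify \<epsilon> v y\<bar> \<le> L * dist x y"
proof -
  interpret prob_space "bump_law :: 'a measure" by (rule prob_space_bump_law)
  note i = Cb_Lip_bump_law_integrable[OF assms(1)]
  have "\<bar>mollify \<epsilon> v x - mollify \<epsilon> v y\<bar> = norm (\<integral>z. v (x + \<epsilon> *\<^sub>R z) - v (y + \<epsilon> *\<^sub>R z) \<partial>bump_law)"
    unfolding mollify_def using Bochner_Integration.integral_diff[OF i i, of x \<epsilon> y \<epsilon>] by simp
  also have "\<dots> \<le> (\<integral>z. L * dist x y \<partial>(bump_law :: 'a measure))"
  proof (rule Bochner_Integration.integral_norm_bound_integral[OF Bochner_Integration.integrable_diff[OF i i]])
    show "norm (v (x + \<epsilon> *\<^sub>R z) - v (y + \<epsilon> *\<^sub>R z)) \<le> L * dist x y" for z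
      using assms(2)[of "x + \<epsilon> *\<^sub>R z" "y + \<epsilon> *\<^sub>R z"] by simp
  qed simp
  finally show ?thesis by simp
qed

lemma mollify_Cb_Lip:
  fixes v :: "'a::euclidean_space \<Rightarrow> real"
  assumes "v \<in> Cb_Lip" shows "mollify \<epsilon> v \<in> Cb_Lip"
proof -
  obtain L M where L: "0 \<le> L" "0 \<le> M" "\<And>x. \<bar>v x\<bar> \<le> M" "\<And>x y. \<bar>v x - v y\<bar> \<le> L * dist x y"
    using Cb_LipE[OF assms] by blast
  show ?thesis
    by (rule Cb_LipI[OF mollify_abs_le[OF assms L(3)] mollify_Lipschitz[OF assms L(4)] L(1)])
qed

lemma mollify_approx:
  fixes v :: "'a::euclidean_space \<Rightarrow> real"
  assumes "v \<in> Cb_Lip" "\<And>x y. \<bar>v x - v y\<bar> \<le> L * dist x y" "0 \<le> L" "0 \<le> \<epsilon>"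
  shows "\<bar>mollify \<epsilon> v x - v x\<bar> \<le> L * \<epsilon>"
proof -
  interpret prob_space "bump_law :: 'a measure" by (rule prob_space_bump_law)
  note i = Cb_Lip_bump_law_integrable[OF assms(1)]
  have "\<bar>mollify \<epsilon> v x - v x\<bar> = norm (\<integral>z. v (x + \<epsilon> *\<^sub>R z) - v x \<partial>bump_law)"
    unfolding mollify_def using i by simp
  also have "\<dots> \<le> (\<integral>z. L * \<epsilon> \<partial>(bump_law :: 'a measure))"
  proof (rule order_trans[OF integral_norm_bound integral_mono_AE])
    show "AE z in bump_law. norm (v (x + \<epsilon> *\<^sub>R z) - v x) \<le> L * \<epsilon>"
      using AE_bump_law
    proof (rule AE_mp, intro AE_I2 impI)
      fix z :: 'a assume z: "norm z \<le> 1"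
      have "dist (x + \<epsilon> *\<^sub>R z) x \<le> \<epsilon> * 1"
        using mult_left_mono[OF z assms(4)] assms(4) by (simp add: dist_norm)
      then have "L * dist (x + \<epsilon> *\<^sub>R z) x \<le> L * \<epsilon>" using assms(3) by (simp add: mult_left_mono)
      with assms(2)[of "x + \<epsilon> *\<^sub>R z" x] show "norm (v (x + \<epsilon> *\<^sub>R z) - v x) \<le> L * \<epsilon>" by simp
    qed
  qed (use i in simp_all)
  finally show ?thesis by simp
qed

lemma lborel_integral_shift:
  fixes f :: "'a::euclidean_space \<Rightarrow> real"
  assumes "f \<in> borel_measurable borel"
  shows "(\<integral>z. f (z + u) \<partial>lborel) = (\<integral>z. f z \<partial>lborel)"
proof -
  have "(\<integral>z. f z \<partial>lborel) = (\<integral>z. f z \<partial>distr lborel borel ((+) u))"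
    by (simp only: lborel_distr_plus)
  also have "\<dots> = (\<integral>z. f (u + z) \<partial>lborel)" using assms by (subst integral_distr) auto
  finally show ?thesis by (simp add: add.commute)
qed

text \<open>The even part of the Taylor expansion cancels in \<open>w (x - y) - w (x + y)\<close>, so for a mollified
  function \<open>w\<close> only the linear term and an error of third order remain.\<close>

lemma mollify_odd_part:
  fixes M \<epsilon> :: real
  assumes "0 < \<epsilon>" "0 \<le> M"
  obtains C where "0 \<le> C" "\<And>(v :: 'a::euclidean_space \<Rightarrow> real) x. v \<in> Cb_Lip \<Longrightarrow> (\<And>x. \<bar>v x\<bar> \<le> M) \<Longrightarrow>
    \<exists>p. norm p \<le> C \<and> (\<forall>y. \<bar>mollify \<epsilon> v (x - y) - mollify \<epsilon> v (x + y) + 2 * (p \<bullet> y)\<bar> \<le> C * norm y ^ 3)"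
proof -
  let ?V = "measure lborel (cball (0 :: 'a) 1)" and ?Z = "bump_mass TYPE('a)"
  define C1 where "C1 = 8 / (?Z * \<epsilon>) * (M * ?V)"
  define C2 where "C2 = M * 112 * (3 * ?V) / (?Z * \<epsilon> ^ 3)"
  have Z: "0 < ?Z" by (rule bump_mass_pos)
  have C12: "0 \<le> C1" "0 \<le> C2" using Z assms by (simp_all add: C1_def C2_def)
  have "\<exists>p. norm p \<le> C1 + C2 \<and>
      (\<forall>y. \<bar>mollify \<epsilon> v (x - y) - mollify \<epsilon> v (x + y) + 2 * (p \<bullet> y)\<bar> \<le> (C1 + C2) * norm y ^ 3)"
    if v: "v \<in> Cb_Lip" and vM: "\<And>x. \<bar>v x\<bar> \<le> M" for v :: "'a \<Rightarrow> real" and x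
  proof -
    define g where "g z = max 0 (1 - (norm z)\<^sup>2) ^ 3" for z :: 'a
    have g01: "0 \<le> g z" "g z \<le> 1" for z unfolding g_def by (auto intro: power_le_one)
    have g0: "g z = 0" if "z \<notin> cball 0 1" for z
    proof -
      have "1 \<le> (norm z)\<^sup>2" using that by (intro one_le_power) auto
      then show ?thesis by (simp add: g_def)
    qed
    have [measurable]: "g \<in> borel_measurable borel"
      unfolding g_def[abs_def] by (intro borel_measurable_continuous_onI continuous_intros)
    have [measurable]: "(\<lambda>z. v (x + \<epsilon> *\<^sub>R z)) \<in> borel_measurable borel"
      by (rule Cb_Lip_shift_measurable[OF v])
    \<comment> \<open>The gradient of \<open>bump\<close> is \<open>- 8 * g z *\<^sub>R z\<close>, so this integral is the gradient of the mollified
      function up to a factor.\<close>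
    define F where "F z = (v (x + \<epsilon> *\<^sub>R z) * g z) *\<^sub>R z" for z
    have Fm: "F \<in> borel_measurable borel" unfolding F_def[abs_def] by measurable
    have FM: "norm (F z) \<le> M" for z
    proof (cases "z \<in> cball 0 1")
      case True
      have "\<bar>v (x + \<epsilon> *\<^sub>R z)\<bar> * g z * norm z \<le> M * 1 * 1"
        using True g01 vM assms(2) by (intro mult_mono) auto
      then show ?thesis using g01 by (simp add: F_def abs_mult)
    next
      case False then show ?thesis using g0 assms(2) by (simp add: F_def)
    qed
    have F0: "F z = 0" if "z \<notin> cball 0 1" for z using g0[OF that] by (simp add: F_def)
    have Fi: "integrable lborel F"
      by (rule integrable_lborel_bounded_support[OF Fm FM F0 compact_cball[of 0 1]])
    define p where "p = (8 / (?Z * \<epsilon>)) *\<^sub>R (\<integral>z. F z \<partial>lborel)"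
    have "norm (\<integral>z. F z \<partial>lborel) \<le> M * ?V"
      by (rule integral_lborel_bounded_support[OF Fm FM F0 compact_cball])
    then have "norm p \<le> C1"
      using Z assms(1) unfolding p_def C1_def by (simp add: mult_left_mono divide_right_mono)
    moreover have "\<bar>mollify \<epsilon> v (x - y) - mollify \<epsilon> v (x + y) + 2 * (p \<bullet> y)\<bar> \<le> C2 * norm y ^ 3" for y
    proof -
      define u where "u = y /\<^sub>R \<epsilon>"
      have moll: "?Z * mollify \<epsilon> v (x + s *\<^sub>R y) = (\<integral>z. v (x + \<epsilon> *\<^sub>R z) * bump (z - s *\<^sub>R u) \<partial>lborel)" for s
      proof -
        have "?Z * mollify \<epsilon> v (x + s *\<^sub>R y) = (\<integral>z. bump z * v (x + s *\<^sub>R y + \<epsilon> *\<^sub>R z) \<partial>lborel)"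
          unfolding mollify_def integral_bump_law[OF Cb_Lip_shift_measurable[OF v]] using Z by simp
        also have "\<dots> = (\<integral>z. v (x + \<epsilon> *\<^sub>R (z + s *\<^sub>R u)) * bump (z + s *\<^sub>R u - s *\<^sub>R u) \<partial>lborel)"
        proof -
          have "\<epsilon> *\<^sub>R (s *\<^sub>R u) = s *\<^sub>R y" using assms(1) by (simp add: u_def)
          then have "x + \<epsilon> *\<^sub>R (z + s *\<^sub>R u) = x + s *\<^sub>R y + \<epsilon> *\<^sub>R z" for z
            by (simp only: scaleR_add_right ac_simps)
          then show ?thesis by (simp add: mult.commute add.assoc)
        qed
        also have "\<dots> = (\<integral>z. v (x + \<epsilon> *\<^sub>R z) * bump (z - s *\<^sub>R u) \<partial>lborel)"
          by (rule lborel_integral_shift[of "\<lambda>z. v (x + \<epsilon> *\<^sub>R z) * bump (z - s *\<^sub>R u)"]) measurable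
        finally show ?thesis .
      qed
      have bi: "integrable lborel (\<lambda>z. v (x + \<epsilon> *\<^sub>R z) * bump (z - c))" for c
      proof (rule integrable_lborel_bounded_support[of _ M "cball c 1"])
        show "norm (v (x + \<epsilon> *\<^sub>R z) * bump (z - c)) \<le> M" for z
        proof -
          have "\<bar>v (x + \<epsilon> *\<^sub>R z)\<bar> * bump (z - c) \<le> M * 1"
            using vM assms(2) bump_nonneg[of "z - c"] bump_le_1[of "z - c"] by (intro mult_mono) auto
          then show ?thesis using bump_nonneg[of "z - c"] by (simp add: abs_mult)
        qed
        show "v (x + \<epsilon> *\<^sub>R z) * bump (z - c) = 0" if "z \<notin> cball c 1" for z
          using that bump_outside[of "z - c"] by (simp add: dist_norm norm_minus_commute)
      qed simp_all
      have pu: "?Z * (2 * (p \<bullet> y)) = (\<integral>z. 16 * (F z \<bullet> u) \<partial>lborel)"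
        using Fi Z assms(1) by (simp add: p_def u_def) (simp add: field_simps)
      let ?r = "\<lambda>z. v (x + \<epsilon> *\<^sub>R z) * (bump (z + u) - bump (z - u) + 16 * g z * (z \<bullet> u))"
      let ?S = "cball 0 1 \<union> cball u 1 \<union> cball (- u) 1"
      have eq: "?Z * (mollify \<epsilon> v (x - y) - mollify \<epsilon> v (x + y) + 2 * (p \<bullet> y)) = (\<integral>z. ?r z \<partial>lborel)"
      proof -
        have "(\<integral>z. ?r z \<partial>lborel) = (\<integral>z. v (x + \<epsilon> *\<^sub>R z) * bump (z - (- u)) -
            v (x + \<epsilon> *\<^sub>R z) * bump (z - u) + 16 * (F z \<bullet> u) \<partial>lborel)"
          by (simp add: F_def algebra_simps)
        also have "\<dots> = (\<integral>z. v (x + \<epsilon> *\<^sub>R z) * bump (z - (- u)) \<partial>lborel) -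
            (\<integral>z. v (x + \<epsilon> *\<^sub>R z) * bump (z - u) \<partial>lborel) + (\<integral>z. 16 * (F z \<bullet> u) \<partial>lborel)"
          using Fi bi[of u] bi[of "- u"] by simp
        finally show ?thesis using moll[of 1] moll[of "-1"] pu by (simp add: distrib_left right_diff_distrib)
      qed
      have bound: "norm (\<integral>z. ?r z \<partial>lborel) \<le> (M * (112 * norm u ^ 3)) * measure lborel ?S"
      proof (rule integral_lborel_bounded_support)
        show "?r \<in> borel_measurable borel" by measurable
        show "norm (?r z) \<le> M * (112 * norm u ^ 3)" for z
          unfolding real_norm_def abs_mult[of "v (x + \<epsilon> *\<^sub>R z)"] g_def
          using vM bump_difference[of z u] assms(2) by (intro mult_mono) auto
        show "?r z = 0" if "z \<notin> ?S" for z
        proof -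
          have "1 \<le> norm (z - u)" "1 \<le> norm (z + u)" "z \<notin> cball 0 1"
            using that by (auto simp: dist_norm norm_minus_commute)
          then show ?thesis by (simp add: bump_outside g0)
        qed
        show "compact ?S" by (intro compact_Un compact_cball)
      qed
      have "measure lborel ?S \<le> 3 * ?V"
      proof -
        have c: "measure lborel (cball c 1) = ?V" for c :: 'a
          using content_ball_conv_unit_ball[of 1 c] by (simp add: content_cball_conv_ball)
        have "measure lborel ?S \<le> measure lborel (cball 0 1 \<union> cball u 1) + measure lborel (cball (- u) 1)"
          by (rule measure_Un_le) auto
        moreover have "measure lborel (cball 0 1 \<union> cball u 1) \<le> measure lborel (cball (0::'a) 1) + measure lborel (cball u 1)"
          by (rule measure_Un_le) auto
        ultimately show ?thesis using c[of u] c[of "- u"] by linarith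
      qed
      then have "(M * (112 * norm u ^ 3)) * measure lborel ?S \<le> (M * (112 * norm u ^ 3)) * (3 * ?V)"
        using assms(2) by (intro mult_left_mono) auto
      from order_trans[OF bound this] have "\<bar>?Z * (mollify \<epsilon> v (x - y) - mollify \<epsilon> v (x + y) + 2 * (p \<bullet> y))\<bar> \<le>
          (M * (112 * norm u ^ 3)) * (3 * ?V)" unfolding eq real_norm_def .
      also have "\<dots> = ?Z * (C2 * norm y ^ 3)"
      proof -
        have "norm u = norm y / \<epsilon>" using assms(1) by (simp add: u_def divide_inverse_commute)
        then have "norm u ^ 3 = norm y ^ 3 / \<epsilon> ^ 3" by (simp only: power_divide)
        then show ?thesis using Z by (simp add: C2_def)
      qed
      finally show ?thesis using Z by (simp add: abs_mult)
    qed
    moreover have "C2 * norm y ^ 3 \<le> (C1 + C2) * norm y ^ 3" for y :: 'a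
      using C12 by (intro mult_right_mono) auto
    ultimately have "norm p \<le> C1 + C2"
      "\<bar>mollify \<epsilon> v (x - y) - mollify \<epsilon> v (x + y) + 2 * (p \<bullet> y)\<bar> \<le> (C1 + C2) * norm y ^ 3" for y
      using C12 by (linarith, meson order_trans)
    then show ?thesis by blast
  qed
  then show thesis using C12 by (intro that[of "C1 + C2"]) auto
qed

section \<open>Truncation\<close>

definition clip :: "real \<Rightarrow> real \<Rightarrow> real" where
  "clip N y = max (- N) (min N y)"

lemma clip_abs_le: "0 \<le> N \<Longrightarrow> \<bar>clip N y\<bar> \<le> N"
  by (auto simp: clip_def)

lemma clip_nonneg: "0 \<le> N \<Longrightarrow> 0 \<le> y \<Longrightarrow> clip N y = min N y"
  by (auto simp: clip_def)

lemma clip_Lipschitz: "\<bar>clip N x - clip N y\<bar> \<le> \<bar>x - y\<bar>"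
  by (auto simp: clip_def)

text \<open>Truncating at \<open>N\<close> changes \<open>y\<close> only if \<open>N < \<bar>y\<bar>\<close>, and then by at most \<open>\<bar>y\<bar>\<close>.\<close>

lemma clip_error:
  assumes "0 < N" shows "\<bar>y - clip N y\<bar> \<le> y\<^sup>2 / N"
proof (cases "\<bar>y\<bar> \<le> N")
  case True then show ?thesis using assms by (auto simp: clip_def)
next
  case False
  have "\<bar>y - clip N y\<bar> \<le> \<bar>y\<bar>" using False assms by (auto simp: clip_def)
  moreover have "N * \<bar>y\<bar> \<le> y\<^sup>2"
    using mult_right_mono[of N "\<bar>y\<bar>" "\<bar>y\<bar>"] False by (simp add: power2_eq_square)
  ultimately show ?thesis using assms by (simp add: pos_le_divide_eq mult.commute) (meson mult_left_mono order_trans less_imp_le)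
qed

lemma clip_Cb_Lip: "0 \<le> N \<Longrightarrow> clip N \<in> Cb_Lip"
  by (rule Cb_LipI[of _ N 1]) (simp_all add: clip_abs_le dist_real_def clip_Lipschitz)

lemma Cb_Lip_affine:
  fixes \<psi> :: "'b::real_normed_vector \<Rightarrow> real"
  assumes "\<psi> \<in> Cb_Lip" shows "(\<lambda>y. \<psi> (x + c *\<^sub>R y)) \<in> Cb_Lip"
proof -
  obtain L M where L: "0 \<le> L" "0 \<le> M" "\<And>x. \<bar>\<psi> x\<bar> \<le> M" "\<And>x y. \<bar>\<psi> x - \<psi> y\<bar> \<le> L * dist x y"
    using Cb_LipE[OF assms] by blast
  show ?thesis
  proof (rule Cb_LipI[OF L(3)])
    show "\<bar>\<psi> (x + c *\<^sub>R y) - \<psi> (x + c *\<^sub>R z)\<bar> \<le> L * \<bar>c\<bar> * dist y z" for y z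
      using L(4)[of "x + c *\<^sub>R y" "x + c *\<^sub>R z"]
      by (simp add: dist_norm mult.assoc flip: scaleR_diff_right)
  qed (use L(1) in simp)
qed

lemma Cb_Lip_clip_inner: "0 \<le> N \<Longrightarrow> (\<lambda>y. clip N (q \<bullet> y)) \<in> Cb_Lip"
proof (rule Cb_LipI)
  show "\<bar>clip N (q \<bullet> y) - clip N (q \<bullet> z)\<bar> \<le> norm q * dist y z" for y z
    using clip_Lipschitz[of N "q \<bullet> y" "q \<bullet> z"] Cauchy_Schwarz_ineq2[of q "y - z"]
    by (simp add: dist_norm inner_diff_right)
qed (auto intro: clip_abs_le)

lemma Cb_Lip_min_square:
  fixes N :: real
  assumes "0 \<le> N" shows "(\<lambda>y :: 'a::real_inner. min (N\<^sup>2) (y \<bullet> y)) \<in> Cb_Lip"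
proof (rule Cb_LipI)
  have eq: "min (N\<^sup>2) (y \<bullet> y) = (min N (norm y))\<^sup>2" for y :: 'a
    using assms by (auto simp: min_def power2_norm_eq_inner[symmetric] power2_le_iff_abs_le dest: power_mono)
  show "\<bar>min (N\<^sup>2) (y \<bullet> y)\<bar> \<le> N\<^sup>2" for y :: 'a by simp
  show "\<bar>min (N\<^sup>2) (y \<bullet> y) - min (N\<^sup>2) (z \<bullet> z)\<bar> \<le> (2 * N) * dist y z" for y z :: 'a
  proof -
    let ?a = "min N (norm y)" and ?b = "min N (norm z)"
    have "\<bar>?a\<^sup>2 - ?b\<^sup>2\<bar> = \<bar>?a + ?b\<bar> * \<bar>?a - ?b\<bar>"
      by (simp add: abs_mult[symmetric] power2_eq_square algebra_simps)
    also have "\<dots> \<le> (2 * N) * dist y z"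
    proof (rule mult_mono)
      show "\<bar>?a + ?b\<bar> \<le> 2 * N" using assms by (auto simp: min_def)
      have "\<bar>?a - ?b\<bar> \<le> \<bar>norm y - norm z\<bar>" by (auto simp: min_def)
      also have "\<dots> \<le> dist y z" unfolding dist_norm by (rule norm_triangle_ineq3)
      finally show "\<bar>?a - ?b\<bar> \<le> dist y z" .
    qed (use assms in auto)
    finally show ?thesis unfolding eq .
  qed
qed (use assms in simp)

context g_expectation
begin

section \<open>Moments of the G-normal distribution\<close>

lemma const_mem: "(\<lambda>w. c) \<in> H"
proof -
  have "(\<lambda>_ :: nat \<Rightarrow> real. c) \<in> Cb_Lip_seq 0" by (rule Cb_Lip_seqI[of _ "\<bar>c\<bar>" 0]) auto
  from Cb_Lip_mem[OF this, of "\<lambda>_ _. 0"] show ?thesis by simp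
qed

lemma sum_mem: "(\<And>j. j \<in> A \<Longrightarrow> X j \<in> H) \<Longrightarrow> (\<lambda>w. \<Sum>j\<in>A. X j w) \<in> H"
  by (induction A rule: infinite_finite_induct) (simp_all add: const_mem add_mem)

lemma Cb_Lip_mem1:
  assumes g: "g \<in> Cb_Lip" and X: "X \<in> H"
  shows "(\<lambda>w. g (X w :: real)) \<in> H"
proof -
  obtain L M where L: "0 \<le> L" "0 \<le> M" "\<And>x. \<bar>g x\<bar> \<le> M" "\<And>x y. \<bar>g x - g y\<bar> \<le> L * dist x y"
    using Cb_LipE[OF g] by blast
  have "(\<lambda>x. g (x 0)) \<in> Cb_Lip_seq 1"
    using L(4) by (intro Cb_Lip_seqI[OF L(3) _ L(1)]) (simp add: dist_norm)
  from Cb_Lip_mem[OF this, of "\<lambda>_. X"] X show ?thesis by simp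
qed

lemma E_add_const:
  assumes "X \<in> H" shows "E (\<lambda>w. X w + c) = E X + c"
proof (rule antisym)
  show "E (\<lambda>w. X w + c) \<le> E X + c"
    using subadditive[OF assms const_mem[of c]] by (simp add: constant_preserving)
  show "E X + c \<le> E (\<lambda>w. X w + c)"
    using subadditive[OF add_mem[OF assms const_mem[of c]] const_mem[of "- c"]]
    by (simp add: constant_preserving)
qed

lemma E_abs_diff_le:
  assumes X: "X \<in> H" and Y: "Y \<in> H" and D: "D \<in> H" and le: "\<And>w. \<bar>X w - Y w\<bar> \<le> D w"
  shows "\<bar>E X - E Y\<bar> \<le> E D"
proof -
  have *: "E X \<le> E Y + E D" if "X \<in> H" "Y \<in> H" "\<And>w. \<bar>X w - Y w\<bar> \<le> D w" for X Y
  proof -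
    have "E X \<le> E (\<lambda>w. Y w + D w)"
    proof (rule monotone[OF that(1) add_mem[OF that(2) D]])
      show "X w \<le> Y w + D w" for w using that(3)[of w] by linarith
    qed
    also have "\<dots> \<le> E Y + E D" by (rule subadditive[OF that(2) D])
    finally show ?thesis .
  qed
  have "\<bar>Y w - X w\<bar> \<le> D w" for w using le[of w] by (simp add: abs_minus_commute)
  from *[OF X Y le] *[OF Y X this] show ?thesis by linarith
qed

lemma \<xi>_inner_mem: "(\<lambda>w. q \<bullet> \<xi> i w) \<in> H"
proof -
  have "(\<lambda>w. \<xi> i w $ j) \<in> H" for j
    using iid unfolding iid_G_normal_def G_normal_def random_vector_def by blast
  then have "(\<lambda>w. \<Sum>j\<in>UNIV. q $ j * \<xi> i w $ j) \<in> H" by (intro sum_mem scale_mem)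
  then show ?thesis by (simp add: inner_vec_def)
qed

lemma \<xi>_square_mem: "(\<lambda>w. \<xi> i w \<bullet> \<xi> i w) \<in> H"
proof -
  have "mat 1 \<in> (symmetric_matrices :: (real^'d^'d) set)" by (simp add: symmetric_matrices_def)
  then have "(\<lambda>w. (mat 1 *v \<xi> i w) \<bullet> \<xi> i w) \<in> H"
    using iid unfolding iid_G_normal_def G_normal_def by blast
  then show ?thesis by simp
qed

definition second_moment :: real where
  "second_moment = E (\<lambda>w. \<xi> 0 w \<bullet> \<xi> 0 w)"

lemma second_moment_nonneg: "0 \<le> second_moment"
proof -
  have "E (\<lambda>w. 0) \<le> E (\<lambda>w. \<xi> 0 w \<bullet> \<xi> 0 w)" by (rule monotone[OF const_mem \<xi>_square_mem]) simp
  then show ?thesis by (simp add: constant_preserving second_moment_def)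
qed

text \<open>The space carries two independent copies of \<open>\<xi> 0\<close> whose sum is distributed as \<open>sqrt 2 * \<xi> 0\<close>,
  so the mean \<open>m\<close> satisfies \<open>sqrt 2 * m = 2 * m\<close>. As equality in distribution only concerns bounded
  functions, linear functions are truncated, at a cost that the second moments control.\<close>

lemma mean_zero: "E (\<lambda>w. q \<bullet> \<xi> 0 w) = 0"
proof -
  define e where "e = E (\<lambda>w. q \<bullet> \<xi> 0 w)"
  let ?s = "\<lambda>i w. \<xi> i w \<bullet> \<xi> i w"
  define K where "K = 3 * (norm q)\<^sup>2 * (second_moment + E (?s 1))"
  have E1: "0 \<le> E (?s 1)"
    using monotone[OF const_mem[of 0] \<xi>_square_mem[of 1]] by (simp add: constant_preserving)
  have K: "0 \<le> K" using second_moment_nonneg E1 by (simp add: K_def)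
  have sq: "(q \<bullet> x)\<^sup>2 \<le> (norm q)\<^sup>2 * (x \<bullet> x)" for x
    using Cauchy_Schwarz_ineq[of q x] by (simp add: power2_norm_eq_inner)
  have bound: "\<bar>sqrt 2 * e - 2 * e\<bar> \<le> 4 * K / N" if N: "0 < N" for N
  proof -
    let ?c = "clip N"
    have N0: "0 \<le> N" using N by simp
    have cm: "(\<lambda>w. ?c (X w)) \<in> H" if "X \<in> H" for X by (rule Cb_Lip_mem1[OF clip_Cb_Lip[OF N0] that])
    have scaled: "\<bar>a * e - E (\<lambda>w. ?c (a * (q \<bullet> \<xi> 0 w)))\<bar> \<le> K / N" if a: "0 \<le> a" "a\<^sup>2 \<le> 2" for a
    proof -
      have "\<bar>E (\<lambda>w. a * (q \<bullet> \<xi> 0 w)) - E (\<lambda>w. ?c (a * (q \<bullet> \<xi> 0 w)))\<bar> \<le>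
          E (\<lambda>w. (2 * (norm q)\<^sup>2 / N) * ?s 0 w)"
      proof (rule E_abs_diff_le)
        show "\<bar>a * (q \<bullet> \<xi> 0 w) - ?c (a * (q \<bullet> \<xi> 0 w))\<bar> \<le> (2 * (norm q)\<^sup>2 / N) * ?s 0 w" for w
        proof -
          have "(a * (q \<bullet> \<xi> 0 w))\<^sup>2 \<le> 2 * ((norm q)\<^sup>2 * ?s 0 w)"
            unfolding power_mult_distrib using a sq by (intro mult_mono) auto
          then have "(a * (q \<bullet> \<xi> 0 w))\<^sup>2 / N \<le> 2 * ((norm q)\<^sup>2 * ?s 0 w) / N"
            using N by (intro divide_right_mono) auto
          with clip_error[OF N, of "a * (q \<bullet> \<xi> 0 w)"] show ?thesis by simp
        qed
      qed (intro scale_mem cm \<xi>_inner_mem \<xi>_square_mem)+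
      moreover have "E (\<lambda>w. a * (q \<bullet> \<xi> 0 w)) = a * e"
        unfolding e_def by (rule positively_homogeneous[OF a(1) \<xi>_inner_mem])
      moreover have "E (\<lambda>w. (2 * (norm q)\<^sup>2 / N) * ?s 0 w) = (2 * (norm q)\<^sup>2 / N) * second_moment"
        unfolding second_moment_def using N by (intro positively_homogeneous \<xi>_square_mem) simp
      moreover have "(2 * (norm q)\<^sup>2 / N) * second_moment \<le> K / N"
      proof -
        have "2 * (norm q)\<^sup>2 * second_moment \<le> K"
          unfolding K_def using second_moment_nonneg E1 by (intro mult_mono) auto
        then have "2 * (norm q)\<^sup>2 * second_moment / N \<le> K / N" using N by (intro divide_right_mono) auto
        then show ?thesis by simp
      qed
      ultimately show ?thesis by linarith
    qed
    have clip2: "(\<lambda>x. ?c (q \<bullet> (x 0 + x 1))) \<in> Cb_Lip_seq 2"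
    proof (rule Cb_Lip_seqI)
      fix x y :: "nat \<Rightarrow> real^'d"
      have "\<bar>?c (q \<bullet> (x 0 + x 1)) - ?c (q \<bullet> (y 0 + y 1))\<bar> \<le> \<bar>q \<bullet> ((x 0 + x 1) - (y 0 + y 1))\<bar>"
        unfolding inner_diff_right by (rule clip_Lipschitz)
      also have "\<dots> \<le> norm q * norm ((x 0 + x 1) - (y 0 + y 1))" by (rule Cauchy_Schwarz_ineq2)
      also have "\<dots> \<le> norm q * (norm (x 0 - y 0) + norm (x 1 - y 1))"
        unfolding add_diff_add by (intro mult_left_mono norm_triangle_ineq) simp
      finally show "\<bar>?c (q \<bullet> (x 0 + x 1)) - ?c (q \<bullet> (y 0 + y 1))\<bar> \<le> norm q * (\<Sum>i<2. norm (x i - y i))"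
        by (simp add: numeral_2_eq_2)
    qed (auto intro: clip_abs_le N0)
    have sep: "(\<lambda>x. ?c (q \<bullet> x 0) + ?c (q \<bullet> x 1)) \<in> Cb_Lip_seq 2"
    proof (rule Cb_Lip_seqI)
      show "\<bar>?c (q \<bullet> x 0) + ?c (q \<bullet> x 1)\<bar> \<le> 2 * N" for x
        using clip_abs_le[OF N0, of "q \<bullet> x 0"] clip_abs_le[OF N0, of "q \<bullet> x 1"] by linarith
      fix x y :: "nat \<Rightarrow> real^'d"
      have 1: "\<bar>?c (q \<bullet> x i) - ?c (q \<bullet> y i)\<bar> \<le> norm q * norm (x i - y i)" for i
        using clip_Lipschitz[of N "q \<bullet> x i" "q \<bullet> y i"] Cauchy_Schwarz_ineq2[of q "x i - y i"]
        by (simp add: inner_diff_right)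
      have "\<bar>?c (q \<bullet> x 0) + ?c (q \<bullet> x 1) - (?c (q \<bullet> y 0) + ?c (q \<bullet> y 1))\<bar> \<le>
          norm q * norm (x 0 - y 0) + norm q * norm (x 1 - y 1)"
        using 1[of 0] 1[of 1] by linarith
      then show "\<bar>?c (q \<bullet> x 0) + ?c (q \<bullet> x 1) - (?c (q \<bullet> y 0) + ?c (q \<bullet> y 1))\<bar> \<le>
          norm q * (\<Sum>i<2. norm (x i - y i))"
        by (simp add: numeral_2_eq_2 distrib_left)
    qed simp
    let ?t = "\<lambda>i :: nat. real (Suc i)"
    have t: "0 \<le> ?t 0" "strict_mono_on {..<2} ?t" by (auto simp: strict_mono_on_def)
    have "Ehat \<P> (\<lambda>\<omega>. ?c (q \<bullet> (increment ?t \<omega> 0 + increment ?t \<omega> 1))) =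
        E (\<lambda>w. ?c (q \<bullet> (sqrt (increment ?t (\<lambda>s. s) 0) *\<^sub>R \<xi> 0 w + sqrt (increment ?t (\<lambda>s. s) 1) *\<^sub>R \<xi> 1 w)))"
      by (rule Ehat_increments[OF clip2 _ t]) simp
    then have "Ehat \<P> (\<lambda>\<omega>. ?c (q \<bullet> \<omega> 2)) = E (\<lambda>w. ?c (q \<bullet> (\<xi> 0 w + \<xi> 1 w)))"
      by (simp add: increment_def)
    moreover have "Ehat \<P> (\<lambda>\<omega>. ?c (q \<bullet> \<omega> 2)) = E (\<lambda>w. ?c (q \<bullet> (sqrt 2 *\<^sub>R \<xi> 0 w)))"
      by (rule Ehat_value[OF Cb_Lip_clip_inner[OF N0]]) simp
    ultimately have sum: "E (\<lambda>w. ?c (q \<bullet> \<xi> 0 w + q \<bullet> \<xi> 1 w)) = E (\<lambda>w. ?c (sqrt 2 * (q \<bullet> \<xi> 0 w)))"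
      by (simp add: inner_add_right)
    have "E (\<lambda>w. ?c (q \<bullet> \<xi> 0 w) + ?c (q \<bullet> \<xi> 1 w)) =
        E (\<lambda>w. E (\<lambda>w'. ?c (q \<bullet> \<xi> 0 w) + ?c (q \<bullet> \<xi> 1 w')))"
      using E_last[of "\<lambda>x. ?c (q \<bullet> x 0) + ?c (q \<bullet> x 1)" 1 "\<lambda>_. 1"] sep by (simp add: numeral_2_eq_2)
    also have "\<dots> = E (\<lambda>w. ?c (q \<bullet> \<xi> 0 w) + E (\<lambda>w'. ?c (q \<bullet> \<xi> 1 w')))"
      using E_add_const[OF cm[OF \<xi>_inner_mem[of q 1]]] by (simp add: add.commute)
    also have "\<dots> = E (\<lambda>w. ?c (q \<bullet> \<xi> 0 w)) + E (\<lambda>w. ?c (q \<bullet> \<xi> 1 w))"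
      by (rule E_add_const[OF cm[OF \<xi>_inner_mem]])
    also have "E (\<lambda>w. ?c (q \<bullet> \<xi> 1 w)) = E (\<lambda>w. ?c (q \<bullet> \<xi> 0 w))"
      by (rule E_identical[OF Cb_Lip_clip_inner[OF N0]])
    finally have split: "E (\<lambda>w. ?c (q \<bullet> \<xi> 0 w) + ?c (q \<bullet> \<xi> 1 w)) = 2 * E (\<lambda>w. ?c (q \<bullet> \<xi> 0 w))"
      by simp
    have "\<bar>E (\<lambda>w. ?c (q \<bullet> \<xi> 0 w + q \<bullet> \<xi> 1 w)) - E (\<lambda>w. ?c (q \<bullet> \<xi> 0 w) + ?c (q \<bullet> \<xi> 1 w))\<bar> \<le>
        E (\<lambda>w. (3 * (norm q)\<^sup>2 / N) * (?s 0 w + ?s 1 w))"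
    proof (rule E_abs_diff_le)
      fix w
      let ?x = "q \<bullet> \<xi> 0 w" and ?y = "q \<bullet> \<xi> 1 w"
      have "\<bar>?c (?x + ?y) - (?c ?x + ?c ?y)\<bar> \<le> (?x + ?y)\<^sup>2 / N + ?x\<^sup>2 / N + ?y\<^sup>2 / N"
        using clip_error[OF N, of ?x] clip_error[OF N, of ?y] clip_error[OF N, of "?x + ?y"] by linarith
      also have "\<dots> = ((?x + ?y)\<^sup>2 + ?x\<^sup>2 + ?y\<^sup>2) / N" by (simp add: add_divide_distrib)
      also have "\<dots> \<le> (3 * ((norm q)\<^sup>2 * (?s 0 w) + (norm q)\<^sup>2 * ?s 1 w)) / N"
      proof (rule divide_right_mono)
        have "(?x + ?y)\<^sup>2 + ?x\<^sup>2 + ?y\<^sup>2 \<le> 3 * (?x\<^sup>2 + ?y\<^sup>2)"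
          using sum_squares_bound[of ?x ?y] by (simp add: power2_sum)
        also have "\<dots> \<le> 3 * ((norm q)\<^sup>2 * (?s 0 w) + (norm q)\<^sup>2 * ?s 1 w)"
          by (intro mult_left_mono add_mono sq) simp
        finally show "(?x + ?y)\<^sup>2 + ?x\<^sup>2 + ?y\<^sup>2 \<le> 3 * ((norm q)\<^sup>2 * (?s 0 w) + (norm q)\<^sup>2 * ?s 1 w)" .
      qed (use N in simp)
      finally show "\<bar>?c (?x + ?y) - (?c ?x + ?c ?y)\<bar> \<le> (3 * (norm q)\<^sup>2 / N) * (?s 0 w + ?s 1 w)"
        by (simp add: distrib_left add_divide_distrib mult.assoc)
    qed (intro scale_mem add_mem cm \<xi>_inner_mem \<xi>_square_mem)+
    also have "\<dots> = (3 * (norm q)\<^sup>2 / N) * E (\<lambda>w. ?s 0 w + ?s 1 w)"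
      using N by (intro positively_homogeneous add_mem \<xi>_square_mem) simp
    also have "\<dots> \<le> (3 * (norm q)\<^sup>2 / N) * (second_moment + E (?s 1))"
      unfolding second_moment_def using N by (intro mult_left_mono subadditive \<xi>_square_mem) simp
    also have "\<dots> = K / N" by (simp add: K_def)
    finally have "\<bar>E (\<lambda>w. ?c (sqrt 2 * (q \<bullet> \<xi> 0 w))) - 2 * E (\<lambda>w. ?c (q \<bullet> \<xi> 0 w))\<bar> \<le> K / N"
      unfolding sum split .
    moreover have "\<bar>sqrt 2 * e - E (\<lambda>w. ?c (sqrt 2 * (q \<bullet> \<xi> 0 w)))\<bar> \<le> K / N" by (rule scaled) simp_all
    moreover have "\<bar>e - E (\<lambda>w. ?c (q \<bullet> \<xi> 0 w))\<bar> \<le> K / N" using scaled[of 1] by simp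
    moreover have "4 * K / N = K / N + K / N + K / N + K / N" by simp
    ultimately show ?thesis by linarith
  qed
  have "\<bar>sqrt 2 * e - 2 * e\<bar> \<le> 0"
  proof (rule field_le_epsilon)
    fix r :: real assume r: "0 < r"
    have "4 * K / ((4 * K + 1) / r) \<le> r" using r K by (simp add: field_simps)
    then show "\<bar>sqrt 2 * e - 2 * e\<bar> \<le> 0 + r" using bound[of "(4 * K + 1) / r"] r K by simp
  qed
  then have "(sqrt 2 - 2) * e = 0" by (simp add: left_diff_distrib)
  moreover have "sqrt 2 \<noteq> 2"
  proof
    assume "sqrt 2 = 2" then have "(sqrt 2)\<^sup>2 = 2\<^sup>2" by simp
    then show False by simp
  qed
  ultimately show ?thesis by (simp add: e_def)
qed

text \<open>The truncated second moment under each law is bounded by that of \<open>sqrt h *\<^sub>R \<xi> 0\<close>; monotone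
  convergence removes the truncation.\<close>

lemma law_second_moment:
  assumes P: "P \<in> \<P>" and h: "0 \<le> h"
  shows "integrable P (\<lambda>\<omega>. \<omega> h \<bullet> \<omega> h)" and "(\<integral>\<omega>. \<omega> h \<bullet> \<omega> h \<partial>P) \<le> h * second_moment"
proof -
  let ?f = "\<lambda>(N::nat) \<omega>. min ((real N)\<^sup>2) (\<omega> h \<bullet> \<omega> h)"
  have cyl: "?f N \<in> cylinder {0..}" for N
    using h by (intro cylinder_Cb_Lip[OF Cb_Lip_min_square] finitely_Lipschitz_coordinate) auto
  note bm = bounded_measurable_cylinder[OF cyl]
  have le: "(\<integral>\<omega>. ?f N \<omega> \<partial>P) \<le> h * second_moment" for N
  proof -
    have "(\<integral>\<omega>. ?f N \<omega> \<partial>P) \<le> Ehat \<P> (?f N)" by (rule expectation_le_Ehat[OF P bm])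
    also have "\<dots> = E (\<lambda>w. min ((real N)\<^sup>2) ((sqrt h *\<^sub>R \<xi> 0 w) \<bullet> (sqrt h *\<^sub>R \<xi> 0 w)))"
      by (rule Ehat_value[OF Cb_Lip_min_square h]) simp
    also have "\<dots> = E (\<lambda>w. min ((real N)\<^sup>2) (h * (\<xi> 0 w \<bullet> \<xi> 0 w)))"
      using h by (simp flip: mult.assoc)
    also have "\<dots> \<le> E (\<lambda>w. h * (\<xi> 0 w \<bullet> \<xi> 0 w))"
    proof (rule monotone)
      have "(\<lambda>w. clip ((real N)\<^sup>2) (h * (\<xi> 0 w \<bullet> \<xi> 0 w))) \<in> H"
        by (rule Cb_Lip_mem1[OF clip_Cb_Lip scale_mem[OF \<xi>_square_mem]]) simp
      moreover have "clip ((real N)\<^sup>2) (h * (\<xi> 0 w \<bullet> \<xi> 0 w)) = min ((real N)\<^sup>2) (h * (\<xi> 0 w \<bullet> \<xi> 0 w))" for w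
        using h by (intro clip_nonneg) simp_all
      ultimately show "(\<lambda>w. min ((real N)\<^sup>2) (h * (\<xi> 0 w \<bullet> \<xi> 0 w))) \<in> H" by simp
    qed (intro scale_mem \<xi>_square_mem, simp)
    also have "\<dots> = h * second_moment"
      unfolding second_moment_def by (rule positively_homogeneous[OF h \<xi>_square_mem])
    finally show ?thesis .
  qed
  have mono: "?f N \<omega> \<le> ?f N' \<omega>" if "N \<le> N'" for N N' and \<omega> :: "real \<Rightarrow> real^'d"
  proof -
    have "(real N)\<^sup>2 \<le> (real N')\<^sup>2" using that by (intro power_mono) auto
    then show ?thesis by (rule min.mono) simp
  qed
  have lim: "(\<lambda>N. ?f N \<omega>) \<longlonglongrightarrow> \<omega> h \<bullet> \<omega> h" for \<omega> :: "real \<Rightarrow> real^'d"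
  proof (rule tendsto_eventually)
    obtain k :: nat where k: "\<omega> h \<bullet> \<omega> h \<le> real k" using real_arch_simple by blast
    have "?f N \<omega> = \<omega> h \<bullet> \<omega> h" if "max 1 k \<le> N" for N
    proof -
      have "real k \<le> real N * 1" "real N * 1 \<le> real N * real N" using that by (simp, intro mult_left_mono) auto
      with k show ?thesis by (simp add: power2_eq_square)
    qed
    then show "\<forall>\<^sub>F N in sequentially. ?f N \<omega> = \<omega> h \<bullet> \<omega> h" unfolding eventually_sequentially by blast
  qed
  have int_mono: "incseq (\<lambda>N. \<integral>\<omega>. ?f N \<omega> \<partial>P)"
    unfolding incseq_def using mono by (intro allI impI integral_law_mono[OF laws[OF P] bm bm])
  obtain L where L: "(\<lambda>N. \<integral>\<omega>. ?f N \<omega> \<partial>P) \<longlonglongrightarrow> L"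
    using incseq_convergent[OF int_mono, of "h * second_moment"] le by blast
  have meas: "(\<lambda>\<omega>. \<omega> h \<bullet> \<omega> h) \<in> borel_measurable P"
    using borel_measurable_inner[OF coordinate_measurable_Finf[OF h] coordinate_measurable_Finf[OF h]]
      measurable_cong_sets[OF prob_lawsD(2)[OF laws[OF P]] refl] by blast
  note int = bounded_measurable_integrable[OF laws[OF P] bm]
  have ae: "AE \<omega> in P. mono (\<lambda>N. ?f N \<omega>)" "AE \<omega> in P. (\<lambda>N. ?f N \<omega>) \<longlonglongrightarrow> \<omega> h \<bullet> \<omega> h"
    using mono lim by (auto intro!: AE_I2 monoI)
  show "integrable P (\<lambda>\<omega>. \<omega> h \<bullet> \<omega> h)" by (rule integrable_monotone_convergence[OF int ae L meas])
  have "(\<integral>\<omega>. \<omega> h \<bullet> \<omega> h \<partial>P) = L" by (rule integral_monotone_convergence[OF int ae L meas])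
  moreover have "L \<le> h * second_moment" using LIMSEQ_le_const2[OF L] le by blast
  ultimately show "(\<integral>\<omega>. \<omega> h \<bullet> \<omega> h \<partial>P) \<le> h * second_moment" by simp
qed

text \<open>For each \<open>q\<close> the mean is at most that of \<open>sqrt h * (q \<bullet> \<xi> 0)\<close>, up to a truncation error, hence
  nonpositive. Applied to \<open>q\<close> and \<open>- q\<close> this gives zero under every single law.\<close>

lemma law_mean_zero:
  assumes P: "P \<in> \<P>" and h: "0 \<le> h"
  shows "integrable P (\<lambda>\<omega>. q \<bullet> \<omega> h)" and "(\<integral>\<omega>. q \<bullet> \<omega> h \<partial>P) = 0"
proof -
  interpret prob_space P using laws[OF P] by (rule prob_lawsD)
  have meas: "(\<lambda>\<omega>. q \<bullet> \<omega> h) \<in> borel_measurable P" for q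
    using borel_measurable_inner[OF borel_measurable_const coordinate_measurable_Finf[OF h]]
      measurable_cong_sets[OF prob_lawsD(2)[OF laws[OF P]] refl] by blast
  have sq: "(q \<bullet> x)\<^sup>2 \<le> (norm q)\<^sup>2 * (x \<bullet> x)" for q x :: "real^'d"
    using Cauchy_Schwarz_ineq[of q x] by (simp add: power2_norm_eq_inner)
  have int: "integrable P (\<lambda>\<omega>. q \<bullet> \<omega> h)" for q
  proof (rule Bochner_Integration.integrable_bound[OF _ meas])
    show "integrable P (\<lambda>\<omega>. 1 + (norm q)\<^sup>2 * (\<omega> h \<bullet> \<omega> h))"
      using law_second_moment(1)[OF P h] by simp
    show "AE \<omega> in P. norm (q \<bullet> \<omega> h) \<le> norm (1 + (norm q)\<^sup>2 * (\<omega> h \<bullet> \<omega> h))"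
    proof (rule AE_I2)
      fix \<omega> :: "real \<Rightarrow> real^'d"
      have "0 \<le> (\<bar>q \<bullet> \<omega> h\<bar> - 1)\<^sup>2" by simp
      then have "2 * \<bar>q \<bullet> \<omega> h\<bar> \<le> 1 + (q \<bullet> \<omega> h)\<^sup>2" by (simp add: power2_diff)
      with sq[of q "\<omega> h"] show "norm (q \<bullet> \<omega> h) \<le> norm (1 + (norm q)\<^sup>2 * (\<omega> h \<bullet> \<omega> h))" by simp
    qed
  qed
  show "integrable P (\<lambda>\<omega>. q \<bullet> \<omega> h)" by (rule int)
  have le0: "(\<integral>\<omega>. q \<bullet> \<omega> h \<partial>P) \<le> 0" for q
  proof (rule field_le_epsilon)
    fix r :: real assume r: "0 < r"
    define K where "K = (norm q)\<^sup>2 * (h * second_moment)"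
    have K: "0 \<le> K" using h second_moment_nonneg by (simp add: K_def)
    define N where "N = (2 * K + 1) / r"
    have N: "0 < N" "0 \<le> N" using K r by (simp_all add: N_def)
    let ?c = "clip N"
    have cyl: "(\<lambda>\<omega>. ?c (q \<bullet> \<omega> h)) \<in> cylinder {0..}"
      using h by (intro cylinder_Cb_Lip[OF Cb_Lip_clip_inner[OF N(2)]] finitely_Lipschitz_coordinate) simp
    note bm = bounded_measurable_cylinder[OF cyl]
    have "(\<integral>\<omega>. q \<bullet> \<omega> h \<partial>P) \<le> (\<integral>\<omega>. ?c (q \<bullet> \<omega> h) + ((norm q)\<^sup>2 / N) * (\<omega> h \<bullet> \<omega> h) \<partial>P)"
    proof (rule integral_mono[OF int])
      show "integrable P (\<lambda>\<omega>. ?c (q \<bullet> \<omega> h) + ((norm q)\<^sup>2 / N) * (\<omega> h \<bullet> \<omega> h))"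
        using law_second_moment(1)[OF P h] bounded_measurable_integrable[OF laws[OF P] bm] by simp
      fix \<omega> :: "real \<Rightarrow> real^'d"
      have "(q \<bullet> \<omega> h)\<^sup>2 / N \<le> (norm q)\<^sup>2 * (\<omega> h \<bullet> \<omega> h) / N"
        using sq N by (intro divide_right_mono) auto
      with clip_error[OF N(1), of "q \<bullet> \<omega> h"]
      show "q \<bullet> \<omega> h \<le> ?c (q \<bullet> \<omega> h) + ((norm q)\<^sup>2 / N) * (\<omega> h \<bullet> \<omega> h)" by simp
    qed
    also have "\<dots> = (\<integral>\<omega>. ?c (q \<bullet> \<omega> h) \<partial>P) + ((norm q)\<^sup>2 / N) * (\<integral>\<omega>. \<omega> h \<bullet> \<omega> h \<partial>P)"
      using law_second_moment(1)[OF P h] bounded_measurable_integrable[OF laws[OF P] bm] by simp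
    finally have 1: "(\<integral>\<omega>. q \<bullet> \<omega> h \<partial>P) \<le> (\<integral>\<omega>. ?c (q \<bullet> \<omega> h) \<partial>P) + ((norm q)\<^sup>2 / N) * (\<integral>\<omega>. \<omega> h \<bullet> \<omega> h \<partial>P)" .
    have "((norm q)\<^sup>2 / N) * (\<integral>\<omega>. \<omega> h \<bullet> \<omega> h \<partial>P) \<le> ((norm q)\<^sup>2 / N) * (h * second_moment)"
      using law_second_moment(2)[OF P h] N by (intro mult_left_mono) auto
    then have 2: "((norm q)\<^sup>2 / N) * (\<integral>\<omega>. \<omega> h \<bullet> \<omega> h \<partial>P) \<le> K / N" by (simp add: K_def)
    have "(\<integral>\<omega>. ?c (q \<bullet> \<omega> h) \<partial>P) \<le> Ehat \<P> (\<lambda>\<omega>. ?c (q \<bullet> \<omega> h))" by (rule expectation_le_Ehat[OF P bm])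
    also have "\<dots> = E (\<lambda>w. ?c (q \<bullet> (sqrt h *\<^sub>R \<xi> 0 w)))" by (rule Ehat_value[OF Cb_Lip_clip_inner[OF N(2)] h])
    also have "\<dots> = E (\<lambda>w. ?c ((sqrt h *\<^sub>R q) \<bullet> \<xi> 0 w))" by simp
    also have "\<dots> \<le> K / N"
    proof -
      let ?q = "sqrt h *\<^sub>R q"
      have "\<bar>E (\<lambda>w. ?c (?q \<bullet> \<xi> 0 w)) - E (\<lambda>w. ?q \<bullet> \<xi> 0 w)\<bar> \<le> E (\<lambda>w. ((norm ?q)\<^sup>2 / N) * (\<xi> 0 w \<bullet> \<xi> 0 w))"
      proof (rule E_abs_diff_le)
        fix w
        have "(?q \<bullet> \<xi> 0 w)\<^sup>2 / N \<le> (norm ?q)\<^sup>2 * (\<xi> 0 w \<bullet> \<xi> 0 w) / N"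
          using N(2) by (rule divide_right_mono[OF sq])
        with clip_error[OF N(1), of "?q \<bullet> \<xi> 0 w"]
        show "\<bar>?c (?q \<bullet> \<xi> 0 w) - ?q \<bullet> \<xi> 0 w\<bar> \<le> ((norm ?q)\<^sup>2 / N) * (\<xi> 0 w \<bullet> \<xi> 0 w)"
          by (simp only: abs_minus_commute times_divide_eq_left)
      qed (intro Cb_Lip_mem1[OF clip_Cb_Lip[OF N(2)] \<xi>_inner_mem] scale_mem \<xi>_inner_mem \<xi>_square_mem)+
      also have "\<dots> = ((norm ?q)\<^sup>2 / N) * second_moment"
        unfolding second_moment_def using N by (intro positively_homogeneous \<xi>_square_mem) simp
      also have "\<dots> = K / N" using h by (simp add: K_def power_mult_distrib)
      finally show ?thesis unfolding mean_zero by linarith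
    qed
    finally have 3: "(\<integral>\<omega>. ?c (q \<bullet> \<omega> h) \<partial>P) \<le> K / N" .
    have "2 * K \<le> r * N" using r by (simp add: N_def)
    then have "2 * K / N \<le> r" by (simp only: pos_divide_le_eq[OF N(1)])
    then have "K / N + K / N \<le> r" by simp
    with 1 2 3 show "(\<integral>\<omega>. q \<bullet> \<omega> h \<partial>P) \<le> 0 + r" by linarith
  qed
  have "(\<integral>\<omega>. (- q) \<bullet> \<omega> h \<partial>P) = - (\<integral>\<omega>. q \<bullet> \<omega> h \<partial>P)" by simp
  with le0[of q] le0[of "- q"] show "(\<integral>\<omega>. q \<bullet> \<omega> h \<partial>P) = 0" by linarith
qed

end

section \<open>The nonlinear semigroup\<close>

text \<open>A rearrangement of \<open>(1 - q) ^ n \<le> 1 / (1 + n * q)\<close>.\<close>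

lemma prod_one_minus_le:
  fixes q :: real
  assumes "0 \<le> q" "q \<le> 1"
  shows "real n * q \<le> (1 - (1 - q) ^ n) * (1 + real n * q)"
proof -
  have "(1 - q) ^ n * (1 + real n * q) \<le> (1 - q) ^ n * (1 + q) ^ n"
    using Bernoulli_inequality[of q n] assms by (intro mult_left_mono) auto
  also have "\<dots> = (1 - q\<^sup>2) ^ n" by (simp add: power2_eq_square algebra_simps flip: power_mult_distrib)
  also have "\<dots> \<le> 1" using assms by (intro power_le_one) (auto simp: power_le_one)
  finally show ?thesis by (simp add: algebra_simps)
qed

text \<open>A bounded Lipschitz function between the indicators of \<open>{y. a \<le> norm y}\<close> and \<open>{y. a / 2 < norm y}\<close>.\<close>

definition jump_test :: "real \<Rightarrow> 'a::real_normed_vector \<Rightarrow> real" where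
  "jump_test a y = min 1 (max 0 (2 * norm y / a - 1))"

lemma jump_test_bounds: "0 \<le> jump_test a y" "jump_test a y \<le> 1"
  by (simp_all add: jump_test_def)

lemma jump_test_eq_1: "0 < a \<Longrightarrow> a \<le> norm y \<Longrightarrow> jump_test a y = 1"
  by (simp add: jump_test_def min_def max_def field_simps)

lemma jump_test_eq_0: "0 < a \<Longrightarrow> norm y \<le> a / 2 \<Longrightarrow> jump_test a y = 0"
  by (simp add: jump_test_def min_def max_def field_simps)

lemma jump_test_Cb_Lip:
  assumes "0 < a" shows "jump_test a \<in> Cb_Lip"
proof (rule Cb_LipI)
  show "\<bar>jump_test a y\<bar> \<le> 1" for y :: 'a using jump_test_bounds[of a y] by simp
  show "\<bar>jump_test a y - jump_test a z\<bar> \<le> (2 / a) * dist y z" for y z :: 'a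
  proof -
    have "\<bar>jump_test a y - jump_test a z\<bar> \<le> \<bar>2 * norm y / a - 2 * norm z / a\<bar>"
      unfolding jump_test_def by (auto simp: min_def max_def)
    also have "2 * norm y / a - 2 * norm z / a = (2 / a) * (norm y - norm z)"
      by (simp add: right_diff_distrib)
    also have "\<bar>(2 / a) * (norm y - norm z)\<bar> \<le> (2 / a) * dist y z"
      unfolding abs_mult dist_norm using assms by (intro mult_mono norm_triangle_ineq3) auto
    finally show ?thesis .
  qed
qed (use assms in simp)

context g_expectation
begin

text \<open>The sign \<open>s\<close> allows a simultaneous treatment of the semigroup (\<open>s = 1\<close>) and its reflection
  (\<open>s = - 1\<close>).\<close>

definition flow :: "real \<Rightarrow> real \<Rightarrow> (real^'d \<Rightarrow> real) \<Rightarrow> real^'d \<Rightarrow> real" where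
  "flow s h \<phi> x = Ehat \<P> (\<lambda>\<omega>. \<phi> (x + s *\<^sub>R \<omega> h))"

lemma flow_bm:
  "\<phi> \<in> Cb_Lip \<Longrightarrow> 0 \<le> h \<Longrightarrow> bounded_measurable (\<lambda>\<omega>. \<phi> (x + s *\<^sub>R \<omega> h))"
  by (intro bounded_measurable_cylinder cylinder_Cb_Lip[of \<phi>] finitely_Lipschitz_add
      finitely_Lipschitz_const finitely_Lipschitz_scaleR finitely_Lipschitz_coordinate) simp_all

lemma flow_abs_le:
  assumes "\<phi> \<in> Cb_Lip" "0 \<le> h" "\<And>x. \<bar>\<phi> x\<bar> \<le> M" shows "\<bar>flow s h \<phi> x\<bar> \<le> M"
  unfolding flow_def by (rule Ehat_abs_le[OF flow_bm[OF assms(1,2)] assms(3)])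

lemma flow_Lipschitz:
  assumes "\<phi> \<in> Cb_Lip" "0 \<le> h" "\<And>x y. \<bar>\<phi> x - \<phi> y\<bar> \<le> L * dist x y"
  shows "\<bar>flow s h \<phi> x - flow s h \<phi> y\<bar> \<le> L * dist x y"
  unfolding flow_def
proof (rule Ehat_diff_le_sup[OF flow_bm[OF assms(1,2)] flow_bm[OF assms(1,2)]])
  show "\<bar>\<phi> (x + s *\<^sub>R \<omega> h) - \<phi> (y + s *\<^sub>R \<omega> h)\<bar> \<le> L * dist x y" for \<omega>
    using assms(3)[of "x + s *\<^sub>R \<omega> h" "y + s *\<^sub>R \<omega> h"] by simp
qed

lemma flow_Cb_Lip:
  assumes "\<phi> \<in> Cb_Lip" "0 \<le> h" shows "flow s h \<phi> \<in> Cb_Lip"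
proof -
  obtain L M where L: "0 \<le> L" "0 \<le> M" "\<And>x. \<bar>\<phi> x\<bar> \<le> M" "\<And>x y. \<bar>\<phi> x - \<phi> y\<bar> \<le> L * dist x y"
    using Cb_LipE[OF assms(1)] by blast
  show ?thesis
    by (rule Cb_LipI[OF flow_abs_le[OF assms L(3)] flow_Lipschitz[OF assms L(4)] L(1)])
qed

lemma flow_mono:
  assumes "\<phi> \<in> Cb_Lip" "\<psi> \<in> Cb_Lip" "0 \<le> h" "\<And>x. \<phi> x \<le> \<psi> x + c"
  shows "flow s h \<phi> x \<le> flow s h \<psi> x + c"
proof -
  have "flow s h \<phi> x \<le> Ehat \<P> (\<lambda>\<omega>. c + 1 * \<psi> (x + s *\<^sub>R \<omega> h))"
    unfolding flow_def
  proof (rule Ehat_mono[OF flow_bm[OF assms(1,3)]])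
    show "bounded_measurable (\<lambda>\<omega>. c + 1 * \<psi> (x + s *\<^sub>R \<omega> h))"
      by (intro bounded_measurable_add bounded_measurable_mult bounded_measurable_const flow_bm[OF assms(2,3)])
    show "\<phi> (x + s *\<^sub>R \<omega> h) \<le> c + 1 * \<psi> (x + s *\<^sub>R \<omega> h)" for \<omega>
      using assms(4)[of "x + s *\<^sub>R \<omega> h"] by simp
  qed
  also have "\<dots> = c + 1 * flow s h \<psi> x"
    unfolding flow_def by (rule Ehat_affine[OF flow_bm[OF assms(2,3)]]) simp
  finally show ?thesis by simp
qed

lemma flow_zero:
  assumes "\<phi> \<in> Cb_Lip" shows "flow s 0 \<phi> x = \<phi> x"
  unfolding flow_def using Ehat_value[OF Cb_Lip_affine[OF assms, of x s], of 0]
  by (simp add: constant_preserving)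

lemma flow_semigroup:
  assumes \<phi>: "\<phi> \<in> Cb_Lip" and h: "0 \<le> h" "0 \<le> k"
  shows "flow s h (flow s k \<phi>) x = flow s (h + k) \<phi> x"
proof -
  let ?X = "\<lambda>\<omega>. \<phi> (x + s *\<^sub>R \<omega> (h + k))"
  have X: "?X \<in> cylinder {0..}"
    using h by (intro cylinder_Cb_Lip[OF \<phi>] finitely_Lipschitz_add
      finitely_Lipschitz_const finitely_Lipschitz_scaleR finitely_Lipschitz_coordinate) simp
  have "cond h ?X \<omega> = flow s k \<phi> (x + s *\<^sub>R \<omega> h)" for \<omega>
  proof -
    have "cond h ?X \<omega> = Ehat \<P> (\<lambda>\<omega>'. \<phi> ((x + s *\<^sub>R \<omega> h) + s *\<^sub>R (\<omega>' (h + k) - \<omega>' h)))"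
      unfolding cond_def using h by (simp add: paste_def scaleR_add_right add.assoc)
    also have "\<dots> = flow s k \<phi> (x + s *\<^sub>R \<omega> h)"
      unfolding flow_def by (rule Ehat_increment_stationary[OF Cb_Lip_affine[OF \<phi>] h])
    finally show ?thesis .
  qed
  then have "cond h ?X = (\<lambda>\<omega>. flow s k \<phi> (x + s *\<^sub>R \<omega> h))" by blast
  with Ehat_cond[OF X h(1)] show ?thesis unfolding flow_def by simp
qed

text \<open>Averaging over translates commutes with each linear expectation, and the supremum of averages is
  at most the average of the suprema. So mollifying a trajectory of the semigroup yields a smooth
  supersolution.\<close>

lemma flow_mollify_le:
  assumes \<phi>: "\<phi> \<in> Cb_Lip" and h: "0 \<le> h"
  shows "flow 1 h (mollify \<epsilon> \<phi>) x \<le> mollify \<epsilon> (flow 1 h \<phi>) x"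
  unfolding flow_def[of 1 h "mollify \<epsilon> \<phi>"]
proof (rule Ehat_least)
  fix P assume P: "P \<in> \<P>"
  interpret P: prob_space P using laws[OF P] by (rule prob_lawsD)
  interpret K: prob_space "bump_law :: (real^'d) measure" by (rule prob_space_bump_law)
  interpret pair_sigma_finite P "bump_law :: (real^'d) measure" ..
  interpret PK: pair_prob_space P "bump_law :: (real^'d) measure" ..
  obtain L M where L: "0 \<le> L" "0 \<le> M" "\<And>x. \<bar>\<phi> x\<bar> \<le> M" "\<And>x y. \<bar>\<phi> x - \<phi> y\<bar> \<le> L * dist x y"
    using Cb_LipE[OF \<phi>] by blast
  have [measurable]: "(\<lambda>\<omega>. \<omega> h) \<in> borel_measurable P"
    using coordinate_measurable_Finf[OF h] measurable_cong_sets[OF prob_lawsD(2)[OF laws[OF P]] refl] by blast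
  have [measurable]: "\<phi> \<in> borel_measurable borel"
    by (rule borel_measurable_continuous_onI[OF Cb_Lip_continuous[OF \<phi>]])
  have [measurable]: "(\<lambda>z :: real^'d. z) \<in> borel_measurable bump_law"
    by (simp add: measurable_cong_sets[OF sets_bump_law refl])
  have meas: "(\<lambda>(\<omega>, z). \<phi> (x + 1 *\<^sub>R \<omega> h + \<epsilon> *\<^sub>R z)) \<in> borel_measurable (P \<Otimes>\<^sub>M bump_law)"
    by measurable
  have int: "integrable (P \<Otimes>\<^sub>M bump_law) (\<lambda>(\<omega>, z). \<phi> (x + 1 *\<^sub>R \<omega> h + \<epsilon> *\<^sub>R z))"
    by (rule PK.P.integrable_const_bound[OF _ meas, of M]) (simp add: L(3) split_beta)
  have "(\<integral>\<omega>. mollify \<epsilon> \<phi> (x + 1 *\<^sub>R \<omega> h) \<partial>P) = (\<integral>z. (\<integral>\<omega>. \<phi> (x + 1 *\<^sub>R \<omega> h + \<epsilon> *\<^sub>R z) \<partial>P) \<partial>bump_law)"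
    unfolding mollify_def by (rule Fubini_integral[OF int, symmetric])
  also have "\<dots> \<le> (\<integral>z. flow 1 h \<phi> (x + \<epsilon> *\<^sub>R z) \<partial>bump_law)"
  proof (rule integral_mono)
    show "integrable bump_law (\<lambda>z. \<integral>\<omega>. \<phi> (x + 1 *\<^sub>R \<omega> h + \<epsilon> *\<^sub>R z) \<partial>P)"
      using integrable_snd[OF int] by simp
    show "integrable bump_law (\<lambda>z. flow 1 h \<phi> (x + \<epsilon> *\<^sub>R z))"
      by (rule Cb_Lip_bump_law_integrable[OF flow_Cb_Lip[OF \<phi> h]])
    show "(\<integral>\<omega>. \<phi> (x + 1 *\<^sub>R \<omega> h + \<epsilon> *\<^sub>R z) \<partial>P) \<le> flow 1 h \<phi> (x + \<epsilon> *\<^sub>R z)" for z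
    proof -
      have "x + 1 *\<^sub>R \<omega> h + \<epsilon> *\<^sub>R z = (x + \<epsilon> *\<^sub>R z) + 1 *\<^sub>R \<omega> h" for \<omega> :: "real \<Rightarrow> real^'d"
        by (simp only: ac_simps)
      then show ?thesis
        using expectation_le_Ehat[OF P flow_bm[OF \<phi> h, of "x + \<epsilon> *\<^sub>R z" 1]] by (simp only: flow_def)
    qed
  qed
  finally show "(\<integral>\<omega>. mollify \<epsilon> \<phi> (x + 1 *\<^sub>R \<omega> h) \<partial>P) \<le> mollify \<epsilon> (flow 1 h \<phi>) x"
    by (simp add: mollify_def)
qed

text \<open>With \<open>f\<close> close to an indicator, \<open>1 - (\<Prod>k<n. 1 - f (\<dots>))\<close> indicates that one of the first \<open>n\<close>
  increments lies in a given set. Conditioning on all increments but the last one multiplies the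
  complementary expectation by \<open>1 - q\<close>.\<close>

lemma Ehat_some_jump:
  assumes f: "f \<in> Cb_Lip" and f01: "\<And>y. 0 \<le> f y \<and> f y \<le> 1" and h: "0 \<le> h"
  shows "(\<lambda>\<omega>. 1 - (\<Prod>k<n. 1 - f (\<omega> (real k * h + h) - \<omega> (real k * h)))) \<in> cylinder {0..}"
    and "Ehat \<P> (\<lambda>\<omega>. 1 - (\<Prod>k<n. 1 - f (\<omega> (real k * h + h) - \<omega> (real k * h)))) =
      1 - (1 - Ehat \<P> (\<lambda>\<omega>. f (\<omega> h))) ^ n"
proof -
  let ?D = "\<lambda>k \<omega>. f (\<omega> (real k * h + h) - \<omega> (real k * h))"
  let ?p = "\<lambda>n \<omega>. \<Prod>k<n. 1 - ?D k \<omega>"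
  define q where "q = Ehat \<P> (\<lambda>\<omega>. f (\<omega> h))"
  have D: "?D k \<in> cylinder {0..}" for k
    using h by (intro cylinder_Cb_Lip[OF f] finitely_Lipschitz_diff finitely_Lipschitz_coordinate) simp_all
  have p: "?p n \<in> cylinder {0..}" for n
    by (induction n) (simp_all add: cylinder_const cylinder_mult cylinder_diff D)
  then show cyl: "(\<lambda>\<omega>. 1 - ?p n \<omega>) \<in> cylinder {0..}" for n by (intro cylinder_diff cylinder_const)
  have p0: "0 \<le> ?p n \<omega>" for n \<omega> using f01 by (intro prod_nonneg) simp
  show "Ehat \<P> (\<lambda>\<omega>. 1 - ?p n \<omega>) = 1 - (1 - Ehat \<P> (\<lambda>\<omega>. f (\<omega> h))) ^ n"
    unfolding q_def[symmetric]
  proof (induction n)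
    case 0 then show ?case by (simp add: Ehat_const)
  next
    case (Suc n)
    let ?t = "real n * h"
    have t: "0 \<le> ?t" using h by simp
    have "cond ?t (\<lambda>\<omega>. 1 - ?p (Suc n) \<omega>) \<omega> = q + (1 - q) * (1 - ?p n \<omega>)" for \<omega>
    proof -
      have past: "?D k (paste ?t \<omega> \<omega>') = ?D k \<omega>" if "k < n" for k \<omega>'
      proof -
        have "(real k + 1) * h \<le> ?t" using that h by (intro mult_right_mono) auto
        then have "real k * h + h \<le> ?t" by (simp add: distrib_right)
        moreover have "0 \<le> real k * h" using h by simp
        ultimately show ?thesis using h by (simp add: paste_def min_absorb1 max_absorb2)
      qed
      have pres: "?D n (paste ?t \<omega> \<omega>') = ?D n \<omega>'" for \<omega>'
        using h t by (simp add: paste_def)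
      have "cond ?t (\<lambda>\<omega>. 1 - ?p (Suc n) \<omega>) \<omega> = Ehat \<P> (\<lambda>\<omega>'. (1 - ?p n \<omega>) + ?p n \<omega> * ?D n \<omega>')"
        unfolding cond_def
      proof (rule Ehat_cong)
        fix \<omega>' :: "real \<Rightarrow> real^'d"
        have "?p n (paste ?t \<omega> \<omega>') = ?p n \<omega>" by (rule prod.cong[OF refl]) (simp only: past lessThan_iff)
        moreover have "?p (Suc n) (paste ?t \<omega> \<omega>') = ?p n (paste ?t \<omega> \<omega>') * (1 - ?D n (paste ?t \<omega> \<omega>'))"
          by (simp only: prod.lessThan_Suc)
        ultimately have "?p (Suc n) (paste ?t \<omega> \<omega>') = ?p n \<omega> * (1 - ?D n \<omega>')" by (simp only: pres)
        then show "1 - ?p (Suc n) (paste ?t \<omega> \<omega>') = (1 - ?p n \<omega>) + ?p n \<omega> * ?D n \<omega>'"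
          by (simp add: right_diff_distrib)
      qed
      also have "\<dots> = (1 - ?p n \<omega>) + ?p n \<omega> * Ehat \<P> (?D n)"
        by (rule Ehat_affine[OF bounded_measurable_cylinder[OF D] p0])
      also have "Ehat \<P> (?D n) = q"
        unfolding q_def by (rule Ehat_increment_stationary[OF f t h])
      finally show ?thesis by (simp add: algebra_simps)
    qed
    then have "cond ?t (\<lambda>\<omega>. 1 - ?p (Suc n) \<omega>) = (\<lambda>\<omega>. q + (1 - q) * (1 - ?p n \<omega>))" by blast
    then have "Ehat \<P> (\<lambda>\<omega>. 1 - ?p (Suc n) \<omega>) = Ehat \<P> (\<lambda>\<omega>. q + (1 - q) * (1 - ?p n \<omega>))"
      using Ehat_cond[OF cyl t, of "Suc n"] by simp
    also have "\<dots> = q + (1 - q) * Ehat \<P> (\<lambda>\<omega>. 1 - ?p n \<omega>)"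
    proof (rule Ehat_affine[OF bounded_measurable_cylinder[OF cyl]])
      have "bounded_measurable (\<lambda>\<omega>. f (\<omega> h))"
        using flow_bm[OF f h, of 0 1] by simp
      then have "q \<le> Ehat \<P> (\<lambda>_. 1)"
        unfolding q_def using f01 by (intro Ehat_mono bounded_measurable_const) auto
      then show "0 \<le> 1 - q" by (simp add: Ehat_const)
    qed
    also have "\<dots> = 1 - (1 - q) ^ Suc n" unfolding Suc.IH by (simp add: algebra_simps)
    finally show ?case .
  qed
qed

text \<open>That one of the increments over a grid of mesh \<open>1 / n\<close> is large has small capacity by uniform
  continuity of the paths, and this capacity is comparable with \<open>n\<close> times that for a single
  increment. Such an estimate is indispensable for symmetry: compensated upward jumps, of sizes \<open>r > 0\<close> that
  a control may choose and at rate \<open>1 / r\<^sup>2\<close>, give a stable distribution with bounded second moments that is not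
  symmetric. Taking \<open>n = m + 2\<close> ensures \<open>1 / n < 1 / (m + 1)\<close>, so that the
  modulus for the distance \<open>1 / (m + 1)\<close> applies.\<close>

lemma jump_probability_small:
  assumes a: "0 < a"
  shows "(\<lambda>m. real (m + 2) * Ehat \<P> (\<lambda>\<omega>. jump_test a (\<omega> (1 / real (m + 2))))) \<longlonglongrightarrow> 0"
proof -
  define q where "q m = Ehat \<P> (\<lambda>\<omega>. jump_test a (\<omega> (1 / real (m + 2))))" for m
  define y where "y m = 1 - (1 - q m) ^ (m + 2)" for m
  define b where "b = min 1 (a / 2)"
  have b: "0 < b" using a by (simp add: b_def)
  note f = jump_test_Cb_Lip[OF a]
  have q01: "0 \<le> q m" "q m \<le> 1" for m
  proof -
    have bm: "bounded_measurable (\<lambda>\<omega>. jump_test a (\<omega> (1 / real (m + 2))))"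
      using flow_bm[OF f, of "1 / real (m + 2)" 0 1] by simp
    have "Ehat \<P> (\<lambda>_. 0) \<le> q m" "q m \<le> Ehat \<P> (\<lambda>_. 1)"
      unfolding q_def by (intro Ehat_mono bm bounded_measurable_const jump_test_bounds)+
    then show "0 \<le> q m" "q m \<le> 1" by (simp_all add: Ehat_const)
  qed
  have y0: "0 \<le> y m" for m
  proof -
    have "(1 - q m) ^ (m + 2) \<le> 1" using q01[of m] by (intro power_le_one) simp_all
    then show ?thesis unfolding y_def by linarith
  qed
  have yle: "y m \<le> (1 / b) * Ehat \<P> (modulus 2 (inverse (real (Suc m))))" for m
  proof -
    let ?h = "1 / real (m + 2)" and ?d = "inverse (real (Suc m))"
    let ?X = "\<lambda>\<omega> :: real \<Rightarrow> real^'d. 1 - (\<Prod>k<m+2. 1 - jump_test a (\<omega> (real k * ?h + ?h) - \<omega> (real k * ?h)))"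
    have h0: "0 \<le> ?h" by simp
    have f01: "0 \<le> jump_test a y \<and> jump_test a y \<le> 1" for y :: "real^'d"
      by (simp add: jump_test_bounds)
    have bmod: "bounded_measurable (modulus 2 ?d :: (real \<Rightarrow> real^'d) \<Rightarrow> real)"
    proof (rule bounded_measurableI)
      show "modulus 2 ?d \<in> borel_measurable Finf" by (rule modulus_measurable) simp_all
      show "\<bar>modulus 2 ?d \<omega>\<bar> \<le> 1" for \<omega> :: "real \<Rightarrow> real^'d"
        using modulus_bounds[of 2 ?d \<omega>] by simp
    qed
    have "y m = Ehat \<P> ?X"
      unfolding y_def q_def by (rule Ehat_some_jump(2)[OF f f01 h0, symmetric])
    also have "\<dots> \<le> Ehat \<P> (\<lambda>\<omega>. 0 + (1 / b) * modulus 2 ?d \<omega>)"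
    proof (rule Ehat_mono)
      show "bounded_measurable ?X"
        by (rule bounded_measurable_cylinder[OF Ehat_some_jump(1)[OF f f01 h0]])
      show "bounded_measurable (\<lambda>\<omega> :: real \<Rightarrow> real^'d. 0 + (1 / b) * modulus 2 ?d \<omega>)"
        by (intro bounded_measurable_add bounded_measurable_mult bounded_measurable_const bmod)
      fix \<omega> :: "real \<Rightarrow> real^'d" assume om: "\<omega> \<in> Omega"
      have mod0: "0 \<le> modulus 2 ?d \<omega>" by (rule modulus_bounds) simp_all
      show "?X \<omega> \<le> 0 + (1 / b) * modulus 2 ?d \<omega>"
      proof (cases "\<exists>k<m+2. a / 2 < norm (\<omega> (real k * ?h + ?h) - \<omega> (real k * ?h))")
        case True
        then obtain k where k: "k < m + 2" "a / 2 < norm (\<omega> (real k * ?h + ?h) - \<omega> (real k * ?h))" by blast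
        have "(real k + 1) * ?h \<le> real (m + 2) * ?h" using k(1) by (intro mult_right_mono) auto
        moreover have "real (m + 2) * ?h = 1" by simp
        ultimately have le1: "real k * ?h + ?h \<le> 1" by (simp only: distrib_right mult_1_left)
        have hd: "?h < ?d" by (simp add: field_simps)
        have upper: "min 1 (norm (\<omega> (real k * ?h + ?h) - \<omega> (real k * ?h))) \<le> modulus (1 + 1) ?d \<omega>"
        proof (rule increment_le_modulus[OF om])
          have "0 \<le> real k * ?h" "0 \<le> ?h" by simp_all
          then show "0 \<le> real k * ?h + ?h" "0 \<le> real k * ?h" "real k * ?h \<le> 1" using le1 by linarith+
          show "\<bar>real k * ?h + ?h - real k * ?h\<bar> < ?d" using hd by simp
        qed (rule le1)
        have "b \<le> min 1 (norm (\<omega> (real k * ?h + ?h) - \<omega> (real k * ?h)))"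
          using k(2) unfolding b_def by (intro min.mono) simp_all
        from order_trans[OF this upper] have "b \<le> modulus 2 ?d \<omega>" by simp
        then have "1 \<le> (1 / b) * modulus 2 ?d \<omega>" using b by simp
        moreover have "0 \<le> (\<Prod>k<m+2. 1 - jump_test a (\<omega> (real k * ?h + ?h) - \<omega> (real k * ?h)))"
          by (intro prod_nonneg) (simp add: jump_test_bounds)
        ultimately show ?thesis by linarith
      next
        case False
        have "jump_test a (\<omega> (real k * ?h + ?h) - \<omega> (real k * ?h)) = 0" if "k < m + 2" for k
        proof (rule jump_test_eq_0[OF a], rule leI)
          show "\<not> a / 2 < norm (\<omega> (real k * ?h + ?h) - \<omega> (real k * ?h))" using False that by blast
        qed
        then have "(\<Prod>k<m+2. 1 - jump_test a (\<omega> (real k * ?h + ?h) - \<omega> (real k * ?h))) = 1"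
          by (intro prod.neutral) auto
        moreover have "0 \<le> (1 / b) * modulus 2 ?d \<omega>" using b mod0 by simp
        ultimately show ?thesis by simp
      qed
    qed
    also have "\<dots> = 0 + (1 / b) * Ehat \<P> (modulus 2 ?d)"
      using b by (intro Ehat_affine[OF bmod]) simp
    finally show ?thesis by simp
  qed
  have ylim: "y \<longlonglongrightarrow> 0"
  proof (rule tendsto_sandwich[OF _ _ tendsto_const])
    show "\<forall>\<^sub>F m in sequentially. 0 \<le> y m" using y0 by (intro always_eventually) blast
    show "\<forall>\<^sub>F m in sequentially. y m \<le> (1 / b) * Ehat \<P> (modulus 2 (inverse (real (Suc m))))"
      using yle by (intro always_eventually) blast
    have "(\<lambda>m. (1 / b) * Ehat \<P> (modulus 2 (inverse (real (Suc m))))) \<longlonglongrightarrow> (1 / b) * 0"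
      by (intro tendsto_mult tendsto_const Ehat_modulus_tendsto_zero) simp
    then show "(\<lambda>m. (1 / b) * Ehat \<P> (modulus 2 (inverse (real (Suc m))))) \<longlonglongrightarrow> 0" by simp
  qed
  have "\<forall>\<^sub>F m in sequentially. y m < 1 / 2" by (rule order_tendstoD(2)[OF ylim]) simp
  then have ev: "\<forall>\<^sub>F m in sequentially. real (m + 2) * q m \<le> 2 * y m"
  proof (rule eventually_mono)
    fix m assume m: "y m < 1 / 2"
    define z where "z = real (m + 2) * q m"
    have z0: "0 \<le> z" using q01[of m] by (simp add: z_def)
    have "z \<le> y m * (1 + z)" unfolding y_def z_def by (rule prod_one_minus_le[OF q01])
    then have "z \<le> y m + y m * z" by (simp only: distrib_left mult_1_right)
    moreover have "y m * z \<le> (1 / 2) * z" using m z0 by (intro mult_right_mono) auto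
    ultimately show "real (m + 2) * q m \<le> 2 * y m" unfolding z_def[symmetric] by linarith
  qed
  have "(\<lambda>m. real (m + 2) * q m) \<longlonglongrightarrow> 0"
  proof (rule tendsto_sandwich[OF _ ev tendsto_const])
    show "\<forall>\<^sub>F m in sequentially. 0 \<le> real (m + 2) * q m"
      using q01 by (intro always_eventually allI mult_nonneg_nonneg) simp_all
    show "(\<lambda>m. 2 * y m) \<longlonglongrightarrow> 0" using tendsto_mult[OF tendsto_const ylim, of 2] by simp
  qed
  then show ?thesis by (simp only: q_def)
qed

end

section \<open>Path transformations\<close>

lemma cylinder_determined:
  assumes "X \<in> cylinder I" "\<omega> \<in> Omega" "\<omega>' \<in> Omega" "\<And>s. s \<in> I \<Longrightarrow> \<omega> s = \<omega>' s"
  shows "X \<omega> = X \<omega>'"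
proof -
  obtain S L where S: "finite S" "S \<subseteq> I" "0 \<le> L"
    "\<And>\<omega> \<omega>'. \<omega> \<in> Omega \<Longrightarrow> \<omega>' \<in> Omega \<Longrightarrow> norm (X \<omega> - X \<omega>') \<le> L * (\<Sum>s\<in>S. norm (\<omega> s - \<omega>' s))"
    using finitely_LipschitzE[OF cylinder_finitely_Lipschitz[OF assms(1)]] by blast
  have "(\<Sum>s\<in>S. norm (\<omega> s - \<omega>' s)) = 0"
    by (rule sum.neutral) (use assms(4) S(2) in auto)
  with S(4)[OF assms(2,3)] show ?thesis by simp
qed

definition negate_path :: "(real \<Rightarrow> real^'d) \<Rightarrow> real \<Rightarrow> real^'d" where
  "negate_path \<omega> = restrict (\<lambda>s. - \<omega> s) {0..}"

lemma negate_path_in_Omega: "\<omega> \<in> Omega \<Longrightarrow> negate_path \<omega> \<in> Omega"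
  unfolding negate_path_def by (intro OmegaI continuous_on_minus) (simp add: Omega_def)

definition reflect_on :: "real \<Rightarrow> (real \<Rightarrow> real^'d) set \<Rightarrow> (real \<Rightarrow> real^'d) \<Rightarrow> real \<Rightarrow> real^'d" where
  "reflect_on t A \<omega> = (if \<omega> \<in> A then reflect t \<omega> else \<omega>)"

lemma reflect_on_in_Omega: "\<omega> \<in> Omega \<Longrightarrow> 0 \<le> t \<Longrightarrow> reflect_on t A \<omega> \<in> Omega"
  by (simp add: reflect_on_def reflect_in_Omega)

lemma reflect_on_measurable:
  fixes A :: "(real \<Rightarrow> real^'d) set"
  assumes A: "A \<in> sets Finf" and t: "0 \<le> t"
  shows "reflect_on t A \<in> measurable Finf Finf"
proof (rule measurable_into_Finf)
  show "reflect_on t A \<omega> \<in> Omega" if "\<omega> \<in> space Finf" for \<omega> using that t by (simp add: reflect_on_in_Omega)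
  fix s :: real assume s: "0 \<le> s"
  have [measurable]: "(\<lambda>\<omega> :: real \<Rightarrow> real^'d. \<omega> s) \<in> borel_measurable Finf"
    "(\<lambda>\<omega> :: real \<Rightarrow> real^'d. \<omega> (min s t)) \<in> borel_measurable Finf"
    using s t by (simp_all add: coordinate_measurable_Finf)
  have [measurable]: "Measurable.pred Finf (\<lambda>\<omega>. \<omega> \<in> A)" using A by simp
  have "(\<lambda>\<omega>. reflect_on t A \<omega> s) = (\<lambda>\<omega>. if \<omega> \<in> A then 2 *\<^sub>R \<omega> (min s t) - \<omega> s else \<omega> s)"
    using s by (auto simp: reflect_on_def reflect_def)
  also have "\<dots> \<in> borel_measurable Finf" by measurable
  finally show "(\<lambda>\<omega>. reflect_on t A \<omega> s) \<in> borel_measurable Finf" .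
qed

context g_expectation
begin

section \<open>Symmetry of the G-normal distribution\<close>

text \<open>One step of length \<open>h\<close>. For \<open>norm y \<le> a\<close> the third-order error is at most \<open>C * a * (y \<bullet> y)\<close>; for
  larger \<open>y\<close> the linear term is bounded by means of \<open>2 * norm y \<le> (y \<bullet> y) / N + N\<close>, and the jump test
  function equals one.\<close>

lemma flow_reflect_step:
  assumes v: "v \<in> Cb_Lip" and vM: "\<And>x. \<bar>v x\<bar> \<le> M" and C: "0 \<le> C" and M: "0 \<le> M"
    and odd: "\<exists>p. norm p \<le> C \<and> (\<forall>y. \<bar>mollify \<epsilon> v (x - y) - mollify \<epsilon> v (x + y) + 2 * (p \<bullet> y)\<bar> \<le> C * norm y ^ 3)"
    and a: "0 < a" and N: "0 < N" and h: "0 \<le> h"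
  shows "flow (- 1) h (mollify \<epsilon> v) x \<le> flow 1 h (mollify \<epsilon> v) x +
    (C * (a + 1 / N) * (h * second_moment) + (2 * M + C * N) * Ehat \<P> (\<lambda>\<omega>. jump_test a (\<omega> h)))"
  unfolding flow_def[of "- 1"]
proof (rule Ehat_least)
  fix P assume P: "P \<in> \<P>"
  let ?w = "mollify \<epsilon> v" and ?J = "jump_test a :: real^'d \<Rightarrow> real"
  have w: "?w \<in> Cb_Lip" by (rule mollify_Cb_Lip[OF v])
  have wM: "\<bar>?w y\<bar> \<le> M" for y by (rule mollify_abs_le[OF v vM])
  obtain p where p: "norm p \<le> C"
    "\<And>y. \<bar>?w (x - y) - ?w (x + y) + 2 * (p \<bullet> y)\<bar> \<le> C * norm y ^ 3" using odd by blast
  have pointwise: "?w (x - y) \<le> ?w (x + y) - 2 * (p \<bullet> y) + C * (a + 1 / N) * (y \<bullet> y) + (2 * M + C * N) * ?J y" for y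
  proof (cases "norm y \<le> a")
    case True
    have "C * norm y ^ 3 = C * (norm y * (y \<bullet> y))"
      by (simp add: power3_eq_cube power2_norm_eq_inner[symmetric] power2_eq_square)
    also have "\<dots> \<le> C * (a * (y \<bullet> y))" using True C by (intro mult_left_mono mult_right_mono) auto
    finally have "?w (x - y) - ?w (x + y) + 2 * (p \<bullet> y) \<le> C * (a * (y \<bullet> y))" using p(2)[of y] by linarith
    moreover have "0 \<le> C * (1 / N) * (y \<bullet> y)" "0 \<le> (2 * M + C * N) * ?J y"
      using C N M jump_test_bounds(1)[of a y] by simp_all
    moreover have "C * (a + 1 / N) * (y \<bullet> y) = C * (a * (y \<bullet> y)) + C * (1 / N) * (y \<bullet> y)"
      by (simp add: algebra_simps)
    ultimately show ?thesis by linarith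
  next
    case False
    have J1: "?J y = 1" using False by (intro jump_test_eq_1[OF a]) simp
    have "\<bar>p \<bullet> y\<bar> \<le> C * norm y"
      using order_trans[OF Cauchy_Schwarz_ineq2 mult_right_mono[OF p(1) norm_ge_zero]] .
    moreover have "2 * (C * norm y) \<le> C * (1 / N) * (y \<bullet> y) + C * N"
    proof -
      have "0 \<le> (norm y - N)\<^sup>2 / N" using N by simp
      also have "(norm y - N)\<^sup>2 = (y \<bullet> y) + N * N - 2 * norm y * N"
        by (simp add: power2_diff power2_norm_eq_inner) (simp add: power2_eq_square)
      also have "\<dots> / N = (y \<bullet> y) / N + N - 2 * norm y"
        using N by (simp add: diff_divide_distrib add_divide_distrib)
      finally have "2 * norm y \<le> (y \<bullet> y) / N + N" by simp
      from mult_left_mono[OF this C] show ?thesis by (simp add: algebra_simps)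
    qed
    moreover have "0 \<le> C * a * (y \<bullet> y)" using C a by simp
    moreover have "C * (a + 1 / N) * (y \<bullet> y) = C * a * (y \<bullet> y) + C * (1 / N) * (y \<bullet> y)"
      by (simp add: algebra_simps)
    moreover have "m \<le> m' - 2 * r + b + (2 * M + c) * 1"
      if "\<bar>r\<bar> \<le> k" "2 * k \<le> b2 + c" "0 \<le> b1" "b = b1 + b2" "\<bar>m\<bar> \<le> M" "\<bar>m'\<bar> \<le> M"
      for m m' r b c k b1 b2 :: real
    proof -
      have "r \<le> k" "m \<le> M" "- M \<le> m'" using that(1,5,6) by (simp_all add: abs_le_iff)
      with that(2-4) show ?thesis by simp
    qed
    ultimately show ?thesis using wM[of "x - y"] wM[of "x + y"] unfolding J1 by blast
  qed
  have bw: "bounded_measurable (\<lambda>\<omega>. ?w (x + s *\<^sub>R \<omega> h))" for s by (rule flow_bm[OF w h])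
  have bJ: "bounded_measurable (\<lambda>\<omega>. ?J (\<omega> h))" using flow_bm[OF jump_test_Cb_Lip[OF a] h, of 0 1] by simp
  note iw = bounded_measurable_integrable[OF laws[OF P] bw]
  note iJ = bounded_measurable_integrable[OF laws[OF P] bJ]
  note im = law_second_moment[OF P h] and ip = law_mean_zero[OF P h, of p]
  have "(\<integral>\<omega>. ?w (x + - 1 *\<^sub>R \<omega> h) \<partial>P) \<le> (\<integral>\<omega>. ?w (x + 1 *\<^sub>R \<omega> h) - 2 * (p \<bullet> \<omega> h) +
      C * (a + 1 / N) * (\<omega> h \<bullet> \<omega> h) + (2 * M + C * N) * ?J (\<omega> h) \<partial>P)"
  proof (rule integral_mono[OF iw])
    show "integrable P (\<lambda>\<omega>. ?w (x + 1 *\<^sub>R \<omega> h) - 2 * (p \<bullet> \<omega> h) +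
      C * (a + 1 / N) * (\<omega> h \<bullet> \<omega> h) + (2 * M + C * N) * ?J (\<omega> h))"
      by (intro Bochner_Integration.integrable_add Bochner_Integration.integrable_diff
          integrable_mult_right iw iJ im(1) ip(1))
    show "?w (x + - 1 *\<^sub>R \<omega> h) \<le> ?w (x + 1 *\<^sub>R \<omega> h) - 2 * (p \<bullet> \<omega> h) +
      C * (a + 1 / N) * (\<omega> h \<bullet> \<omega> h) + (2 * M + C * N) * ?J (\<omega> h)" for \<omega>
      using pointwise[of "\<omega> h"] by simp
  qed
  also have "\<dots> = (\<integral>\<omega>. ?w (x + 1 *\<^sub>R \<omega> h) \<partial>P) - 2 * (\<integral>\<omega>. p \<bullet> \<omega> h \<partial>P) +
      C * (a + 1 / N) * (\<integral>\<omega>. \<omega> h \<bullet> \<omega> h \<partial>P) + (2 * M + C * N) * (\<integral>\<omega>. ?J (\<omega> h) \<partial>P)"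
    using iw[of 1] iJ im(1) ip(1) by simp
  also have "\<dots> \<le> flow 1 h ?w x - 2 * 0 + C * (a + 1 / N) * (h * second_moment) +
      (2 * M + C * N) * Ehat \<P> (\<lambda>\<omega>. ?J (\<omega> h))"
    unfolding ip(2) using C a N M
    by (intro add_mono diff_mono mult_left_mono im(2) expectation_le_Ehat[OF P bJ]
        expectation_le_Ehat[OF P bw, of 1, folded flow_def]) simp_all
  finally show "(\<integral>\<omega>. ?w (x + - 1 *\<^sub>R \<omega> h) \<partial>P) \<le> flow 1 h ?w x +
      (C * (a + 1 / N) * (h * second_moment) + (2 * M + C * N) * Ehat \<P> (\<lambda>\<omega>. ?J (\<omega> h)))" by simp
qed

text \<open>The error of one step is at most \<open>h\<close> times an arbitrarily small number, once \<open>a\<close> and \<open>N = 1 / a\<close> are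
  fixed and \<open>h = 1 / n\<close> is small. The total error \<open>e\<close> consists of two halves of \<open>e / 2\<close>: one for
  the \<open>n\<close> steps, and one for the two replacements of functions by their mollifications.\<close>

lemma flow_reflect_le:
  assumes \<phi>: "\<phi> \<in> Cb_Lip"
  shows "flow (- 1) 1 \<phi> 0 \<le> flow 1 1 \<phi> 0"
proof (rule field_le_epsilon)
  fix e :: real assume e: "0 < e"
  obtain L M where L: "0 \<le> L" and M: "0 \<le> M" and \<phi>M: "\<And>x. \<bar>\<phi> x\<bar> \<le> M"
    and \<phi>L: "\<And>x y. \<bar>\<phi> x - \<phi> y\<bar> \<le> L * dist x y"
    using Cb_LipE[OF \<phi>] by blast
  define \<epsilon> where "\<epsilon> = (e / 4) / (L + 1)"
  have \<epsilon>: "0 < \<epsilon>" "0 \<le> \<epsilon>" using e L by (simp_all add: \<epsilon>_def)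
  have L\<epsilon>: "L * \<epsilon> \<le> e / 4"
  proof -
    have "L * \<epsilon> \<le> (L + 1) * \<epsilon>" using \<epsilon>(2) by (intro mult_right_mono) auto
    also have "\<dots> = e / 4"
    proof -
      have "b * (r / b) = r" if "b \<noteq> 0" for b r :: real using that by simp
      from this[of "L + 1" "e / 4"] L show ?thesis unfolding \<epsilon>_def by linarith
    qed
    finally show ?thesis .
  qed
  obtain C where C: "0 \<le> C" and odd: "\<And>(v :: real^'d \<Rightarrow> real) x. v \<in> Cb_Lip \<Longrightarrow> (\<And>x. \<bar>v x\<bar> \<le> M) \<Longrightarrow>
    \<exists>p. norm p \<le> C \<and> (\<forall>y. \<bar>mollify \<epsilon> v (x - y) - mollify \<epsilon> v (x + y) + 2 * (p \<bullet> y)\<bar> \<le> C * norm y ^ 3)"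
    using mollify_odd_part[OF \<epsilon>(1) M, where 'a = "real^'d"] by blast
  define a where "a = (e / 8) / (C * second_moment + 1)"
  have Ck: "0 \<le> C * second_moment" using C second_moment_nonneg by simp
  have a: "0 < a" using e Ck by (simp add: a_def)
  have aC: "C * (a + 1 / (1 / a)) * second_moment \<le> e / 4"
  proof -
    have "C * (a + 1 / (1 / a)) * second_moment = 2 * a * (C * second_moment)" by simp
    also have "\<dots> \<le> 2 * a * (C * second_moment + 1)" using a by (intro mult_left_mono) auto
    also have "\<dots> = e / 4"
    proof -
      have "2 * (r / b) * b = 2 * r" if "b \<noteq> 0" for b r :: real using that by simp
      from this[of "C * second_moment + 1" "e / 8"] Ck show ?thesis unfolding a_def by linarith
    qed
    finally show ?thesis .
  qed
  let ?q = "\<lambda>m. Ehat \<P> (\<lambda>\<omega>. jump_test a (\<omega> (1 / real (m + 2))))"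
  have "(\<lambda>m. (2 * M + C * (1 / a)) * (real (m + 2) * ?q m)) \<longlonglongrightarrow> (2 * M + C * (1 / a)) * 0"
    by (intro tendsto_mult tendsto_const jump_probability_small[OF a])
  then have "\<forall>\<^sub>F m in sequentially. (2 * M + C * (1 / a)) * (real (m + 2) * ?q m) < e / 4"
    using e by (intro order_tendstoD) auto
  then obtain m where m: "(2 * M + C * (1 / a)) * (real (m + 2) * ?q m) < e / 4"
    by (auto simp: eventually_sequentially)
  define n where "n = m + 2"
  define h where "h = 1 / real n"
  have n: "real n * h = 1" and h: "0 \<le> h" by (simp_all add: n_def h_def)
  define \<delta> where "\<delta> = C * (a + 1 / (1 / a)) * (h * second_moment) +
    (2 * M + C * (1 / a)) * Ehat \<P> (\<lambda>\<omega>. jump_test a (\<omega> h))"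
  have n\<delta>: "real n * \<delta> \<le> e / 2"
  proof -
    have "real n * \<delta> = (real n * h) * (C * (a + 1 / (1 / a)) * second_moment) +
        (2 * M + C * (1 / a)) * (real n * ?q m)"
      unfolding \<delta>_def by (simp add: h_def n_def distrib_left mult.assoc mult.left_commute)
    also have "\<dots> \<le> e / 4 + e / 4" unfolding n mult_1_left unfolding n_def by (rule add_mono[OF aC less_imp_le[OF m]])
    finally show ?thesis by simp
  qed
  have main: "flow (- 1) (real k * h) (mollify \<epsilon> \<phi>) x \<le> mollify \<epsilon> (flow 1 (real k * h) \<phi>) x + real k * \<delta>" for k x
  proof (induction k arbitrary: x)
    case 0
    have "flow 1 0 \<phi> = \<phi>" using flow_zero[OF \<phi>] by blast
    then show ?case using flow_zero[OF mollify_Cb_Lip[OF \<phi>]] by simp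
  next
    case (Suc k)
    let ?v = "flow 1 (real k * h) \<phi>"
    have kh: "0 \<le> real k * h" using h by simp
    have Sk: "real (Suc k) * h = h + real k * h" by (simp add: distrib_right)
    note v = flow_Cb_Lip[OF \<phi> kh]
    have vM: "\<bar>?v y\<bar> \<le> M" for y by (rule flow_abs_le[OF \<phi> kh \<phi>M])
    have "flow (- 1) (real (Suc k) * h) (mollify \<epsilon> \<phi>) x = flow (- 1) h (flow (- 1) (real k * h) (mollify \<epsilon> \<phi>)) x"
      unfolding Sk by (rule flow_semigroup[OF mollify_Cb_Lip[OF \<phi>] h kh, symmetric])
    also have "\<dots> \<le> flow (- 1) h (mollify \<epsilon> ?v) x + real k * \<delta>"
      by (rule flow_mono[OF flow_Cb_Lip[OF mollify_Cb_Lip[OF \<phi>] kh] mollify_Cb_Lip[OF v] h Suc.IH])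
    also have "flow (- 1) h (mollify \<epsilon> ?v) x \<le> flow 1 h (mollify \<epsilon> ?v) x + \<delta>"
      unfolding \<delta>_def using a by (intro flow_reflect_step[OF v vM C M odd[OF v vM] a _ h]) simp
    also have "flow 1 h (mollify \<epsilon> ?v) x \<le> mollify \<epsilon> (flow 1 h ?v) x" by (rule flow_mollify_le[OF v h])
    also have "flow 1 h ?v = flow 1 (real (Suc k) * h) \<phi>"
      unfolding Sk using flow_semigroup[OF \<phi> h kh] by blast
    finally show ?case by (simp add: distrib_right)
  qed
  have near: "\<bar>mollify \<epsilon> \<phi> x - \<phi> x\<bar> \<le> e / 4" for x
    using mollify_approx[OF \<phi> \<phi>L L \<epsilon>(2), of x] L\<epsilon> by linarith
  have "flow (- 1) 1 \<phi> 0 \<le> flow (- 1) 1 (mollify \<epsilon> \<phi>) 0 + e / 4"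
  proof (rule flow_mono[OF \<phi> mollify_Cb_Lip[OF \<phi>]])
    show "\<phi> x \<le> mollify \<epsilon> \<phi> x + e / 4" for x using near[of x] by linarith
  qed simp
  also have "flow (- 1) 1 (mollify \<epsilon> \<phi>) 0 \<le> mollify \<epsilon> (flow 1 1 \<phi>) 0 + e / 2"
    using main[of n 0] n\<delta> unfolding n by linarith
  also have "mollify \<epsilon> (flow 1 1 \<phi>) 0 \<le> flow 1 1 \<phi> 0 + e / 4"
    using mollify_approx[OF flow_Cb_Lip[OF \<phi> zero_le_one] flow_Lipschitz[OF \<phi> zero_le_one \<phi>L] L \<epsilon>(2), of 1 0] L\<epsilon>
    by linarith
  finally show "flow (- 1) 1 \<phi> 0 \<le> flow 1 1 \<phi> 0 + e" by simp
qed

lemma E_symmetric: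
  assumes \<phi>: "\<phi> \<in> Cb_Lip"
  shows "E (\<lambda>w. \<phi> (- \<xi> i w)) = E (\<lambda>w. \<phi> (\<xi> i w))"
proof -
  have neg: "(\<lambda>x. \<phi> (- x)) \<in> Cb_Lip" using Cb_Lip_scaleR[OF \<phi>, of "- 1"] by simp
  have flowE: "flow s 1 \<psi> 0 = E (\<lambda>w. \<psi> (s *\<^sub>R \<xi> 0 w))" if "\<psi> \<in> Cb_Lip" for \<psi> s
    unfolding flow_def using Ehat_value[OF Cb_Lip_affine[OF that, of 0 s], of 1] by simp
  have "E (\<lambda>w. \<phi> (- \<xi> 0 w)) \<le> E (\<lambda>w. \<phi> (\<xi> 0 w))"
    using flow_reflect_le[OF \<phi>] unfolding flowE[OF \<phi>] by simp
  moreover have "E (\<lambda>w. \<phi> (\<xi> 0 w)) \<le> E (\<lambda>w. \<phi> (- \<xi> 0 w))"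
    using flow_reflect_le[OF neg] unfolding flowE[OF neg] by simp
  ultimately show ?thesis using E_identical[OF neg, of i 0] E_identical[OF \<phi>, of i 0] by simp
qed

text \<open>Flipping the last sign is the symmetry of a single vector with the others frozen; the rest is
  induction.\<close>

lemma E_signs:
  assumes "\<phi> \<in> Cb_Lip_seq n" "\<And>i. i < n \<Longrightarrow> 0 \<le> c i"
  shows "E (\<lambda>w. \<phi> (\<lambda>i. - c i *\<^sub>R \<xi> i w)) = E (\<lambda>w. \<phi> (\<lambda>i. c i *\<^sub>R \<xi> i w))"
  using assms
proof (induction n arbitrary: \<phi>)
  case 0
  have "\<phi> x = \<phi> y" for x y by (rule Cb_Lip_seq_cong[OF 0(1)]) simp
  then obtain d where "\<phi> = (\<lambda>_. d)" by blast
  then show ?case by simp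
next
  case (Suc n)
  define \<eta> where "\<eta> x = E (\<lambda>w. \<phi> (x(n := c n *\<^sub>R \<xi> n w)))" for x
  have \<eta>: "\<eta> \<in> Cb_Lip_seq n"
    unfolding \<eta>_def[abs_def] by (rule Cb_Lip_seq_E_slice[OF Suc.prems(1)]) (simp add: Suc.prems(2))
  have neg: "E (\<lambda>w. \<phi> (x(n := - c n *\<^sub>R \<xi> n w))) = \<eta> x" for x
    using E_symmetric[OF Cb_Lip_scaleR[OF Cb_Lip_seq_slice[OF Suc.prems(1), of x], of "c n"], of n]
    unfolding \<eta>_def by (simp only: scaleR_minus_right scaleR_minus_left)
  have "E (\<lambda>w. \<phi> (\<lambda>i. - c i *\<^sub>R \<xi> i w)) = E (\<lambda>w. \<eta> (\<lambda>i. - c i *\<^sub>R \<xi> i w))"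
    unfolding E_last[OF Suc.prems(1), of "\<lambda>i. - c i"] neg ..
  also have "\<dots> = E (\<lambda>w. \<eta> (\<lambda>i. c i *\<^sub>R \<xi> i w))" using Suc.prems(2) by (intro Suc.IH[OF \<eta>]) simp
  also have "\<dots> = E (\<lambda>w. \<phi> (\<lambda>i. c i *\<^sub>R \<xi> i w))"
    unfolding E_last[OF Suc.prems(1), of c] \<eta>_def ..
  finally show ?case .
qed

lemma Ehat_negate_path:
  assumes Y: "Y \<in> cylinder {0..}"
  shows "Ehat \<P> (\<lambda>\<omega>. Y (negate_path \<omega>)) = Ehat \<P> Y"
proof -
  have "finite {}" "{} \<subseteq> {0::real..}" by auto
  then obtain n t \<phi> where n: "1 \<le> n" and t: "strict_mono_on {..<n} t" "0 \<le> t 0"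
    and \<phi>: "\<phi> \<in> Cb_Lip_seq n" and rep: "\<And>\<omega>. \<omega> \<in> Omega \<Longrightarrow> Y \<omega> = \<phi> (increment t \<omega>)"
    using cylinder_representation[OF Y] by metis
  have t_pos: "0 \<le> t i" if "i < n" for i
    using strict_mono_onD[OF t(1), of 0 i] t(2) that by (cases "i = 0") auto
  define c where "c i = sqrt (increment t (\<lambda>s. s) i)" for i
  have c: "0 \<le> c i" if "i < n" for i
  proof (cases "i = 0")
    case True then show ?thesis using t(2) by (simp add: c_def increment_def)
  next
    case False
    then have "t (i - 1) < t i" using that by (intro strict_mono_onD[OF t(1)]) auto
    with False show ?thesis by (simp add: c_def increment_def)
  qed
  have neg: "(\<lambda>x. \<phi> (\<lambda>i. - 1 *\<^sub>R x i)) \<in> Cb_Lip_seq n" by (rule Cb_Lip_seq_scale[OF \<phi>])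
  have "Ehat \<P> (\<lambda>\<omega>. Y (negate_path \<omega>)) = Ehat \<P> (\<lambda>\<omega>. \<phi> (\<lambda>i. - 1 *\<^sub>R increment t \<omega> i))"
  proof (rule Ehat_cong)
    fix \<omega> :: "real \<Rightarrow> real^'d" assume om: "\<omega> \<in> Omega"
    have "Y (negate_path \<omega>) = \<phi> (increment t (negate_path \<omega>))" by (rule rep[OF negate_path_in_Omega[OF om]])
    also have "\<dots> = \<phi> (\<lambda>i. - 1 *\<^sub>R increment t \<omega> i)"
    proof (rule Cb_Lip_seq_cong[OF \<phi>])
      fix i assume i: "i < n"
      then have "0 \<le> t i" "0 \<le> t (i - 1)" using t_pos[of i] t_pos[of "i - 1"] by auto
      then show "increment t (negate_path \<omega>) i = - 1 *\<^sub>R increment t \<omega> i"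
        using t(2) by (simp add: increment_def negate_path_def)
    qed
    finally show "Y (negate_path \<omega>) = \<phi> (\<lambda>i. - 1 *\<^sub>R increment t \<omega> i)" .
  qed
  also have "\<dots> = E (\<lambda>w. \<phi> (\<lambda>i. - 1 *\<^sub>R (c i *\<^sub>R \<xi> i w)))"
    unfolding c_def by (rule Ehat_increments[OF neg n t(2,1)])
  also have "\<dots> = E (\<lambda>w. \<phi> (\<lambda>i. - c i *\<^sub>R \<xi> i w))" by simp
  also have "\<dots> = E (\<lambda>w. \<phi> (\<lambda>i. c i *\<^sub>R \<xi> i w))" by (rule E_signs[OF \<phi> c])
  also have "\<dots> = Ehat \<P> (\<lambda>\<omega>. \<phi> (increment t \<omega>))"
    unfolding c_def by (rule Ehat_increments[OF \<phi> n t(2,1), symmetric])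
  also have "\<dots> = Ehat \<P> Y" by (rule Ehat_cong) (rule rep[symmetric])
  finally show ?thesis .
qed

section \<open>Reflection at a deterministic time on an event of the past\<close>

lemma cylinder_reflect:
  assumes "X \<in> cylinder {0..}" "0 \<le> t"
  shows "(\<lambda>\<omega>. X (reflect t \<omega>)) \<in> cylinder {0..}"
proof (rule cylinder_compose[OF assms(1) reflect_in_Omega[OF _ assms(2)]])
  fix s :: real assume s: "s \<in> {0..}"
  then have eq: "(\<lambda>\<omega>. reflect t \<omega> s) = (\<lambda>\<omega>. 2 *\<^sub>R \<omega> (min s t) - \<omega> s)" by (simp add: reflect_def)
  show "finitely_Lipschitz {0..} (\<lambda>\<omega>. reflect t \<omega> s)"
    unfolding eq using s assms(2)
    by (intro finitely_Lipschitz_diff finitely_Lipschitz_scaleR finitely_Lipschitz_coordinate) simp_all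
qed

text \<open>Reflection after \<open>t\<close> only changes the sign of the path that is pasted at \<open>t\<close>.\<close>

lemma cond_reflect:
  assumes X: "X \<in> cylinder {0..}" and t: "0 \<le> t" and om: "\<omega> \<in> Omega"
  shows "cond t (\<lambda>\<omega>. X (reflect t \<omega>)) \<omega> = cond t X \<omega>"
proof -
  have "reflect t (paste t \<omega> \<omega>') = paste t \<omega> (negate_path \<omega>')" for \<omega>'
  proof
    fix s
    show "reflect t (paste t \<omega> \<omega>') s = paste t \<omega> (negate_path \<omega>') s"
    proof (cases "0 \<le> s")
      case True
      then have "0 \<le> min s t" "0 \<le> max s t" "max (min s t) t = t" "min (min s t) t = min s t"
        using t by auto
      then show ?thesis using True t by (simp add: reflect_def paste_def negate_path_def scaleR_2)
    qed (simp add: reflect_def paste_def)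
  qed
  then have "cond t (\<lambda>\<omega>. X (reflect t \<omega>)) \<omega> = Ehat \<P> (\<lambda>\<omega>'. X (paste t \<omega> (negate_path \<omega>')))"
    unfolding cond_def by simp
  also have "\<dots> = cond t X \<omega>"
    unfolding cond_def by (rule Ehat_negate_path[OF cylinder_paste[OF X t om]])
  finally show ?thesis .
qed

text \<open>A nonnegative factor known at time \<open>t\<close> can be taken out of the conditional expectation.\<close>

lemma Ehat_past_times_innovation:
  assumes h: "h \<in> cylinder {0..t}" and h0: "\<And>\<omega>. \<omega> \<in> Omega \<Longrightarrow> 0 \<le> h \<omega>"
    and X: "X \<in> cylinder {0..}" and t: "0 \<le> t"
  shows "Ehat \<P> (\<lambda>\<omega>. h \<omega> * (X \<omega> - cond t X \<omega>)) = 0"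
proof -
  let ?Y = "\<lambda>\<omega>. h \<omega> * (X \<omega> - cond t X \<omega>)"
  note cX = cond_cylinder[OF X t]
  have Y: "?Y \<in> cylinder {0..}"
    by (intro cylinder_mult cylinder_diff X cylinder_mono[OF h] cylinder_mono[OF cX]) auto
  have "cond t ?Y \<omega> = 0" if om: "\<omega> \<in> Omega" for \<omega>
  proof -
    have "cond t ?Y \<omega> = Ehat \<P> (\<lambda>\<omega>'. - (h \<omega> * cond t X \<omega>) + h \<omega> * X (paste t \<omega> \<omega>'))"
      unfolding cond_def[of t ?Y]
    proof (rule Ehat_cong)
      fix \<omega>' :: "real \<Rightarrow> real^'d" assume om': "\<omega>' \<in> Omega"
      have p: "paste t \<omega> \<omega>' \<in> Omega" by (rule paste_in_Omega[OF om om' t])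
      have past: "paste t \<omega> \<omega>' s = \<omega> s" if "s \<in> {0..t}" for s
        using that by (simp add: paste_def min_absorb1 max_absorb2)
      have "h (paste t \<omega> \<omega>') = h \<omega>" "cond t X (paste t \<omega> \<omega>') = cond t X \<omega>"
        by (rule cylinder_determined[OF h p om past] cylinder_determined[OF cX p om past], assumption)+
      then show "h (paste t \<omega> \<omega>') * (X (paste t \<omega> \<omega>') - cond t X (paste t \<omega> \<omega>')) =
          - (h \<omega> * cond t X \<omega>) + h \<omega> * X (paste t \<omega> \<omega>')" by (simp add: right_diff_distrib)
    qed
    also have "\<dots> = - (h \<omega> * cond t X \<omega>) + h \<omega> * cond t X \<omega>"
      unfolding cond_def
      by (rule Ehat_affine[OF bounded_measurable_cylinder[OF cylinder_paste[OF X t om]] h0[OF om]])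
    finally show ?thesis by simp
  qed
  then have "Ehat \<P> (cond t ?Y) = Ehat \<P> (\<lambda>_. 0)" by (rule Ehat_cong)
  then show ?thesis unfolding Ehat_cond[OF Y t] by (simp add: Ehat_const)
qed

text \<open>For a cylinder function of the past in place of the indicator, domination and the preceding lemma
  give the inequality; inner regularity in the sigma-algebra of the past carries it over to events.\<close>

lemma dominated_conditional:
  assumes Q: "dominated Q" and A: "A \<in> sets (Ft t)" and X: "X \<in> cylinder {0..}" and t: "0 \<le> t"
  shows "(\<integral>\<omega>. indicator A \<omega> * (X \<omega> - cond t X \<omega>) \<partial>Q) \<le> 0"
proof (rule field_le_epsilon)
  fix e :: real assume e: "0 < e"
  have Ql: "Q \<in> prob_laws" using Q by (simp add: dominated_def)
  interpret prob_space Q using Ql by (rule prob_lawsD)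
  let ?Y = "\<lambda>\<omega>. X \<omega> - cond t X \<omega>"
  have I: "{0..t} \<subseteq> {0..}" by auto
  have Y: "?Y \<in> cylinder {0..}"
    by (intro cylinder_diff X cylinder_mono[OF cond_cylinder[OF X t]] I)
  obtain M where M: "0 \<le> M" "\<And>\<omega>. \<omega> \<in> Omega \<Longrightarrow> \<bar>?Y \<omega>\<bar> \<le> M" using cylinder_bounded[OF Y] by blast
  have A': "A \<in> sets (path_algebra {0..t})" using A by (simp add: Ft_eq_path_algebra)
  then have AF: "A \<in> sets Finf" using sets_path_algebra_mono[OF I] sets_Finf by blast
  have "0 < e / (M + 1)" using e M(1) by simp
  from cylinder_inner_regular[OF Ql I A' this]
  obtain C where C: "cylinder_closed {0..t} C" "C \<subseteq> A" "prob A - e / (M + 1) < prob C" by blast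
  have CF: "C \<in> sets Finf" by (rule cylinder_closed_measurable[OF C(1) I])
  obtain h where h: "C \<subseteq> Omega" "\<And>n::nat. h n \<in> cylinder {0..t}" "\<And>n \<omega>. \<omega> \<in> Omega \<Longrightarrow> 0 \<le> h n \<omega>"
    "\<And>n \<omega>. \<omega> \<in> Omega \<Longrightarrow> h n \<omega> \<le> 1" "\<And>n \<omega>. \<omega> \<in> Omega \<Longrightarrow> h (Suc n) \<omega> \<le> h n \<omega>"
    "\<And>\<omega>. \<omega> \<in> Omega \<Longrightarrow> (\<lambda>n. h n \<omega>) \<longlonglongrightarrow> indicator C \<omega>"
    using cylinder_closedE[OF C(1)] by blast
  have bY: "bounded_measurable ?Y" by (rule bounded_measurable_cylinder[OF Y])
  have bh: "bounded_measurable (\<lambda>\<omega>. h n \<omega> * ?Y \<omega>)" for n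
    by (intro bounded_measurable_cylinder cylinder_mult Y cylinder_mono[OF h(2) I])
  have bI: "bounded_measurable (\<lambda>\<omega>. indicator D \<omega> * ?Y \<omega>)" if "D \<in> sets Finf" for D
    by (intro bounded_measurable_mult bounded_measurable_indicator bY that)
  have hle: "(\<integral>\<omega>. h n \<omega> * ?Y \<omega> \<partial>Q) \<le> 0" for n
    using dominated_bounded_measurable[OF Q bh] Ehat_past_times_innovation[OF h(2) h(3) X t] by simp
  have "(\<lambda>n. \<integral>\<omega>. h n \<omega> * ?Y \<omega> \<partial>Q) \<longlonglongrightarrow> (\<integral>\<omega>. indicator C \<omega> * ?Y \<omega> \<partial>Q)"
  proof (rule integral_dominated_convergence[where w = "\<lambda>_. M"])
    show "(\<lambda>\<omega>. indicator C \<omega> * ?Y \<omega>) \<in> borel_measurable Q" by (rule bounded_measurable_law[OF Ql bI[OF CF]])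
    show "(\<lambda>\<omega>. h n \<omega> * ?Y \<omega>) \<in> borel_measurable Q" for n by (rule bounded_measurable_law[OF Ql bh])
    show "AE \<omega> in Q. (\<lambda>n. h n \<omega> * ?Y \<omega>) \<longlonglongrightarrow> indicator C \<omega> * ?Y \<omega>"
      using prob_lawsD(3)[OF Ql] by (intro AE_I2 tendsto_mult tendsto_const h(6)) simp
    show "AE \<omega> in Q. norm (h n \<omega> * ?Y \<omega>) \<le> M" for n
    proof (rule AE_I2)
      fix \<omega> assume "\<omega> \<in> space Q"
      then have om: "\<omega> \<in> Omega" using prob_lawsD(3)[OF Ql] by simp
      have "\<bar>h n \<omega>\<bar> * \<bar>?Y \<omega>\<bar> \<le> 1 * M"
        using h(3)[OF om, of n] h(4)[OF om, of n] M(2)[OF om] by (intro mult_mono) auto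
      then show "norm (h n \<omega> * ?Y \<omega>) \<le> M" by (simp add: abs_mult)
    qed
  qed simp
  then have Cle: "(\<integral>\<omega>. indicator C \<omega> * ?Y \<omega> \<partial>Q) \<le> 0" using LIMSEQ_le_const2 hle by blast
  have bA: "bounded_measurable (\<lambda>\<omega>. indicator C \<omega> * ?Y \<omega> + M * (indicator A \<omega> + - 1 * indicator C \<omega>))"
    by (intro bounded_measurable_add bounded_measurable_mult bounded_measurable_const
        bounded_measurable_indicator bY AF CF)
  have ev: "A \<in> events" "C \<in> events" using AF CF prob_lawsD(2)[OF Ql] by auto
  have "(\<integral>\<omega>. indicator A \<omega> * ?Y \<omega> \<partial>Q) \<le>
      (\<integral>\<omega>. indicator C \<omega> * ?Y \<omega> + M * (indicator A \<omega> + - 1 * indicator C \<omega>) \<partial>Q)"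
  proof (rule integral_law_mono[OF Ql bI[OF AF] bA])
    fix \<omega> :: "real \<Rightarrow> real^'d" assume "\<omega> \<in> Omega"
    then have "?Y \<omega> \<le> M" using M(2)[of \<omega>] by linarith
    then show "indicator A \<omega> * ?Y \<omega> \<le> indicator C \<omega> * ?Y \<omega> + M * (indicator A \<omega> + - 1 * indicator C \<omega>)"
      using C(2) by (auto simp: indicator_def)
  qed
  also have "\<dots> = (\<integral>\<omega>. indicator C \<omega> * ?Y \<omega> \<partial>Q) + M * (prob A - prob C)"
  proof -
    have "integrable Q (\<lambda>\<omega>. indicator C \<omega> * ?Y \<omega>)" by (rule bounded_measurable_integrable[OF Ql bI[OF CF]])
    moreover have "integrable Q (indicator A :: _ \<Rightarrow> real)" "integrable Q (indicator C :: _ \<Rightarrow> real)"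
      by (intro bounded_measurable_integrable[OF Ql] bounded_measurable_indicator AF CF)+
    moreover have "space Q \<inter> A = A" "space Q \<inter> C = C" using ev sets.sets_into_space by blast+
    ultimately show ?thesis by (simp add: Int_commute)
  qed
  also have "M * (prob A - prob C) \<le> M * (e / (M + 1))" using C(3) M(1) by (intro mult_left_mono) auto
  also have "\<dots> \<le> e" using e M(1) by (simp add: field_simps)
  finally show "(\<integral>\<omega>. indicator A \<omega> * ?Y \<omega> \<partial>Q) \<le> 0 + e" using Cle by simp
qed

text \<open>On \<open>A\<close> the reflected function and on the complement the function itself is replaced by its
  nonlinear conditional expectation. Both replacements increase the expectation, and by symmetry they
  lead to the same function \<open>cond t X\<close>.\<close>

lemma dominated_reflect_on:
  assumes Q: "dominated Q" and A: "A \<in> sets (Ft t)" and t: "0 \<le> t"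
  shows "dominated (distr Q Finf (reflect_on t A))"
proof -
  have Ql: "Q \<in> prob_laws" using Q by (simp add: dominated_def)
  interpret prob_space Q using Ql by (rule prob_lawsD)
  have I: "{0..t} \<subseteq> {0..}" by auto
  have AF: "A \<in> sets Finf"
    using A sets_path_algebra_mono[OF I] sets_Finf by (auto simp: Ft_eq_path_algebra)
  have AcF: "Omega - A \<in> sets (Ft t)"
    using sets.compl_sets[OF A] by (simp add: Ft_eq_path_algebra)
  have meas: "reflect_on t A \<in> measurable Q Finf"
    using reflect_on_measurable[OF AF t] measurable_cong_sets[OF prob_lawsD(2)[OF Ql] refl] by blast
  have law: "distr Q Finf (reflect_on t A) \<in> prob_laws"
    unfolding prob_laws_def using prob_space_distr[OF meas] by simp
  have "(\<integral>\<omega>. X \<omega> \<partial>distr Q Finf (reflect_on t A)) \<le> Ehat \<P> X" if X: "X \<in> cylinder {0..}" for X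
  proof -
    let ?R = "\<lambda>\<omega>. X (reflect t \<omega>)"
    note R = cylinder_reflect[OF X t]
    have cX: "bounded_measurable (cond t X)"
      by (intro bounded_measurable_cylinder cylinder_mono[OF cond_cylinder[OF X t] I])
    have cR: "bounded_measurable (cond t ?R)"
      by (intro bounded_measurable_cylinder cylinder_mono[OF cond_cylinder[OF R t] I])
    have b1: "bounded_measurable (\<lambda>\<omega>. indicator A \<omega> * (?R \<omega> - cond t ?R \<omega>))"
      by (intro bounded_measurable_mult bounded_measurable_indicator AF bounded_measurable_cylinder
          cylinder_diff R cylinder_mono[OF cond_cylinder[OF R t] I])
    have b2: "bounded_measurable (\<lambda>\<omega>. indicator (Omega - A) \<omega> * (X \<omega> - cond t X \<omega>))"
      using AcF sets_path_algebra_mono[OF I] sets_Finf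
      by (intro bounded_measurable_mult bounded_measurable_indicator bounded_measurable_cylinder
          cylinder_diff X cylinder_mono[OF cond_cylinder[OF X t] I]) (auto simp: Ft_eq_path_algebra)
    have "(\<integral>\<omega>. X \<omega> \<partial>distr Q Finf (reflect_on t A)) = (\<integral>\<omega>. X (reflect_on t A \<omega>) \<partial>Q)"
      by (rule integral_distr[OF meas cylinder_measurable[OF X]])
    also have "\<dots> = (\<integral>\<omega>. indicator A \<omega> * (?R \<omega> - cond t ?R \<omega>) +
        indicator (Omega - A) \<omega> * (X \<omega> - cond t X \<omega>) + cond t X \<omega> \<partial>Q)"
    proof (rule Bochner_Integration.integral_cong[OF refl])
      fix \<omega> assume "\<omega> \<in> space Q"
      then have om: "\<omega> \<in> Omega" using prob_lawsD(3)[OF Ql] by simp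
      show "X (reflect_on t A \<omega>) = indicator A \<omega> * (?R \<omega> - cond t ?R \<omega>) +
        indicator (Omega - A) \<omega> * (X \<omega> - cond t X \<omega>) + cond t X \<omega>"
        using om cond_reflect[OF X t om] by (simp add: reflect_on_def)
    qed
    also have "\<dots> = (\<integral>\<omega>. indicator A \<omega> * (?R \<omega> - cond t ?R \<omega>) \<partial>Q) +
        (\<integral>\<omega>. indicator (Omega - A) \<omega> * (X \<omega> - cond t X \<omega>) \<partial>Q) + (\<integral>\<omega>. cond t X \<omega> \<partial>Q)"
      using bounded_measurable_integrable[OF Ql b1] bounded_measurable_integrable[OF Ql b2]
        bounded_measurable_integrable[OF Ql cX] by simp
    also have "\<dots> \<le> 0 + 0 + Ehat \<P> (cond t X)"
      by (intro add_mono dominated_conditional[OF Q A R t] dominated_conditional[OF Q AcF X t]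
          dominated_bounded_measurable[OF Q cX])
    also have "\<dots> = Ehat \<P> X" using Ehat_cond[OF X t] by simp
    finally show ?thesis .
  qed
  with law show ?thesis unfolding dominated_def by blast
qed

end

section \<open>Reflection at stopping times with values in a grid\<close>

lemma reflect_reflect:
  assumes "\<omega> \<in> Omega" "0 \<le> t"
  shows "reflect t (reflect t \<omega>) = \<omega>"
proof
  fix s
  show "reflect t (reflect t \<omega>) s = \<omega> s"
  proof (cases "0 \<le> s")
    case True
    then have "0 \<le> min s t" "min (min s t) t = min s t" using assms(2) by auto
    with True show ?thesis by (simp add: reflect_def scaleR_2)
  next
    case False
    have "\<omega> \<in> extensional {0..}" using assms(1) by (simp add: Omega_def)
    then have "\<omega> s = undefined" using False by (simp add: extensional_def)
    with False show ?thesis by (simp add: reflect_def)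
  qed
qed

lemma reflect_keeps_past:
  assumes "A \<in> sets (Ft t)" "\<omega> \<in> Omega" "0 \<le> t"
  shows "reflect t \<omega> \<in> A \<longleftrightarrow> \<omega> \<in> A"
proof (rule path_algebra_determined)
  show "A \<in> sets (path_algebra {0..t})" using assms(1) by (simp add: Ft_eq_path_algebra)
  show "reflect t \<omega> s = \<omega> s" if "s \<in> {0..t}" for s
    using that by (simp add: reflect_def min_absorb1 scaleR_2)
qed (use assms reflect_in_Omega in auto)

text \<open>If the events \<open>A k\<close> are \<open>{\<sigma> = t k}\<close> for a stopping time \<open>\<sigma>\<close>, this reflects the path at \<open>\<sigma>\<close>, provided
  \<open>\<sigma>\<close> is one of the first \<open>N\<close> grid points. The recursion writes this map as a composition of
  reflections at deterministic times.\<close>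

primrec reflect_steps :: "(nat \<Rightarrow> real) \<Rightarrow> (nat \<Rightarrow> (real \<Rightarrow> real^'d) set) \<Rightarrow> nat \<Rightarrow>
    (real \<Rightarrow> real^'d) \<Rightarrow> real \<Rightarrow> real^'d" where
  "reflect_steps t A 0 \<omega> = \<omega>"
| "reflect_steps t A (Suc N) \<omega> = reflect_steps t A N (reflect_on (t N) (A N) \<omega>)"

lemma reflect_steps_outside:
  "(\<And>k. k < N \<Longrightarrow> \<omega> \<notin> A k) \<Longrightarrow> reflect_steps t A N \<omega> = \<omega>"
  by (induction N) (simp_all add: reflect_on_def)

text \<open>Once the path has been reflected at \<open>t k\<close>, it still belongs to \<open>A k\<close>, and therefore to none of the
  other events; the remaining steps leave it unchanged.\<close>

lemma reflect_steps_inside: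
  assumes "\<omega> \<in> Omega" "k < N" "\<omega> \<in> A k"
    and A: "\<And>k. A k \<in> sets (Ft (t k))" and t: "\<And>k. 0 \<le> t k"
    and disj: "disjoint_family A"
  shows "reflect_steps t A N \<omega> = reflect (t k) \<omega>"
  using assms(2)
proof (induction N)
  case (Suc N)
  have other: "x \<notin> A j" if "x \<in> A i" "i \<noteq> j" for x i j
    using disj that unfolding disjoint_family_on_def by blast
  show ?case
  proof (cases "k = N")
    case True
    have "reflect (t k) \<omega> \<in> A k" using reflect_keeps_past[OF A assms(1) t] assms(3) by simp
    then have "reflect_steps t A N (reflect (t k) \<omega>) = reflect (t k) \<omega>"
      using True by (intro reflect_steps_outside other) auto
    with True assms(3) show ?thesis by (simp add: reflect_on_def)
  next
    case False
    then have "\<omega> \<notin> A N" using other[OF assms(3)] by blast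
    with False Suc show ?thesis by (simp add: reflect_on_def)
  qed
qed simp

lemma reflect_steps_involution:
  assumes "\<omega> \<in> Omega"
    and A: "\<And>k. A k \<in> sets (Ft (t k))" and t: "\<And>k. 0 \<le> t k"
    and disj: "disjoint_family A"
  shows "reflect_steps t A N (reflect_steps t A N \<omega>) = \<omega>"
proof (cases "\<exists>k<N. \<omega> \<in> A k")
  case True
  then obtain k where k: "k < N" "\<omega> \<in> A k" by blast
  have "reflect (t k) \<omega> \<in> A k" using reflect_keeps_past[OF A assms(1) t] k(2) by simp
  then show ?thesis
    using reflect_steps_inside[OF assms(1) k A t disj] reflect_reflect[OF assms(1) t]
      reflect_steps_inside[OF reflect_in_Omega[OF assms(1) t] k(1) _ A t disj] by simp
next
  case False
  then have "reflect_steps t A N \<omega> = \<omega>" by (intro reflect_steps_outside) blast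
  then show ?thesis by simp
qed

lemma reflect_steps_measurable:
  assumes A: "\<And>k. A k \<in> sets (Ft (t k))" and t: "\<And>k. 0 \<le> t k"
  shows "reflect_steps t A N \<in> measurable Finf Finf"
proof (induction N)
  case 0 then show ?case by (simp add: measurable_ident[unfolded id_def])
next
  case (Suc N)
  have "A N \<in> sets Finf"
    using A[of N] sets_path_algebra_mono[of "{0..t N}" "{0..}"] sets_Finf
    by (auto simp: Ft_eq_path_algebra)
  from measurable_compose[OF reflect_on_measurable[OF this t] Suc.IH] show ?case by simp
qed

lemma optional_time_measurable:
  fixes \<tau> :: "(real \<Rightarrow> real^'d) \<Rightarrow> real"
  assumes "optional_time \<tau>" shows "\<tau> \<in> borel_measurable Finf"
proof (rule borel_measurable_iff_less[THEN iffD2], rule allI)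
  fix a
  show "{\<omega> \<in> space Finf. \<tau> \<omega> < a} \<in> sets Finf"
  proof (cases "0 \<le> a")
    case True
    then have "{\<omega> \<in> Omega. \<tau> \<omega> < a} \<in> sets (path_algebra {0..a})"
      using assms by (simp add: optional_time_def Ft_eq_path_algebra)
    then show ?thesis using sets_path_algebra_mono[of "{0..a}" "{0..}"] sets_Finf by auto
  next
    case False
    then have "{\<omega> \<in> space Finf. \<tau> \<omega> < a} = {}" using assms by (force simp: optional_time_def)
    then show ?thesis using sets.empty_sets by (simp only:)
  qed
qed

text \<open>The stopped path is the limit of evaluations at countably many grid points.\<close>

lemma stopped_path_measurable:
  fixes \<tau> :: "(real \<Rightarrow> real^'d) \<Rightarrow> real"
  assumes \<tau>: "optional_time \<tau>" and s: "0 \<le> s"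
  shows "(\<lambda>\<omega>. \<omega> (min s (\<tau> \<omega>))) \<in> borel_measurable Finf"
proof (rule borel_measurable_LIMSEQ_metric)
  let ?d = "\<lambda>m. inverse (real (Suc m))"
  let ?k = "\<lambda>m \<omega>. nat \<lfloor>\<tau> \<omega> / ?d m\<rfloor>"
  have [measurable]: "\<tau> \<in> borel_measurable Finf" by (rule optional_time_measurable[OF \<tau>])
  have \<tau>0: "0 \<le> \<tau> \<omega>" if "\<omega> \<in> Omega" for \<omega> using \<tau> that by (simp add: optional_time_def)
  show "(\<lambda>\<omega>. \<omega> (min s (real (?k m \<omega>) * ?d m))) \<in> borel_measurable Finf" for m
  proof (rule measurable_compose_countable[where f = "\<lambda>k \<omega>. \<omega> (min s (real k * ?d m))"])
    show "(\<lambda>\<omega> :: real \<Rightarrow> real^'d. \<omega> (min s (real k * ?d m))) \<in> borel_measurable Finf" for k :: nat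
      using s by (intro coordinate_measurable_Finf) simp
    show "?k m \<in> measurable Finf (count_space UNIV)" by measurable
  qed
  fix \<omega> :: "real \<Rightarrow> real^'d" assume "\<omega> \<in> space Finf"
  then have om: "\<omega> \<in> Omega" by simp
  have bounds: "\<tau> \<omega> - ?d m \<le> real (?k m \<omega>) * ?d m" "real (?k m \<omega>) * ?d m \<le> \<tau> \<omega>" for m
  proof -
    have d: "0 < ?d m" by simp
    have fl: "real (?k m \<omega>) = of_int \<lfloor>\<tau> \<omega> / ?d m\<rfloor>" using \<tau>0[OF om] by simp
    have "of_int \<lfloor>\<tau> \<omega> / ?d m\<rfloor> \<le> \<tau> \<omega> / ?d m" "\<tau> \<omega> / ?d m \<le> of_int \<lfloor>\<tau> \<omega> / ?d m\<rfloor> + 1" by linarith+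
    then have "of_int \<lfloor>\<tau> \<omega> / ?d m\<rfloor> * ?d m \<le> \<tau> \<omega>" "\<tau> \<omega> \<le> (of_int \<lfloor>\<tau> \<omega> / ?d m\<rfloor> + 1) * ?d m"
      by (simp_all only: pos_le_divide_eq[OF d] pos_divide_le_eq[OF d])
    then show "\<tau> \<omega> - ?d m \<le> real (?k m \<omega>) * ?d m" "real (?k m \<omega>) * ?d m \<le> \<tau> \<omega>"
      unfolding fl by (simp_all only: distrib_right mult_1_left diff_le_eq)
  qed
  have "(\<lambda>m. \<tau> \<omega> - ?d m) \<longlonglongrightarrow> \<tau> \<omega> - 0" by (intro tendsto_diff tendsto_const LIMSEQ_inverse_real_of_nat)
  then have low: "(\<lambda>m. \<tau> \<omega> - ?d m) \<longlonglongrightarrow> \<tau> \<omega>" by simp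
  have "(\<lambda>m. real (?k m \<omega>) * ?d m) \<longlonglongrightarrow> \<tau> \<omega>"
    by (rule real_tendsto_sandwich[OF _ _ low tendsto_const]) (intro always_eventually allI bounds)+
  then have "(\<lambda>m. min s (real (?k m \<omega>) * ?d m)) \<longlonglongrightarrow> min s (\<tau> \<omega>)" by (intro tendsto_min tendsto_const)
  then show "(\<lambda>m. \<omega> (min s (real (?k m \<omega>) * ?d m))) \<longlonglongrightarrow> \<omega> (min s (\<tau> \<omega>))"
    using s \<tau>0[OF om] by (intro continuous_path_eval[OF om]) simp_all
qed

lemma reflect_optional_measurable:
  fixes \<tau> :: "(real \<Rightarrow> real^'d) \<Rightarrow> real"
  assumes \<tau>: "optional_time \<tau>"
  shows "(\<lambda>\<omega>. reflect (\<tau> \<omega>) \<omega>) \<in> measurable Finf Finf"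
proof (rule measurable_into_Finf)
  show "reflect (\<tau> \<omega>) \<omega> \<in> Omega" if "\<omega> \<in> space Finf" for \<omega>
    using that \<tau> by (simp add: reflect_in_Omega optional_time_def)
  fix s :: real assume s: "0 \<le> s"
  note [measurable] = stopped_path_measurable[OF \<tau> s] coordinate_measurable_Finf[OF s]
  have "(\<lambda>\<omega>. 2 *\<^sub>R \<omega> (min s (\<tau> \<omega>)) - \<omega> s) \<in> borel_measurable Finf" by measurable
  then show "(\<lambda>\<omega>. reflect (\<tau> \<omega>) \<omega> s) \<in> borel_measurable Finf" using s by (simp add: reflect_def)
qed

context g_expectation
begin

lemma dominated_reflect_steps:
  assumes "dominated Q" and A: "\<And>k. A k \<in> sets (Ft (t k))" and t: "\<And>k. 0 \<le> t k"
  shows "dominated (distr Q Finf (reflect_steps t A N))"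
  using assms(1)
proof (induction N arbitrary: Q)
  case 0
  then have "sets Q = sets Finf" using prob_lawsD(2) by (auto simp: dominated_def)
  then have "distr Q Finf (\<lambda>\<omega>. \<omega>) = Q" by (rule distr_id2[OF sym])
  with 0 show ?case by simp
next
  case (Suc N)
  have Ql: "Q \<in> prob_laws" using Suc.prems by (simp add: dominated_def)
  have AF: "A N \<in> sets Finf"
    using A[of N] sets_path_algebra_mono[of "{0..t N}" "{0..}"] sets_Finf
    by (auto simp: Ft_eq_path_algebra)
  have R: "reflect_on (t N) (A N) \<in> measurable Q Finf"
    using reflect_on_measurable[OF AF t] by (simp only: measurable_cong_sets[OF prob_lawsD(2)[OF Ql] refl])
  have "distr (distr Q Finf (reflect_on (t N) (A N))) Finf (reflect_steps t A N) =
      distr Q Finf (reflect_steps t A N \<circ> reflect_on (t N) (A N))"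
    by (rule distr_distr[OF reflect_steps_measurable[OF A t] R])
  also have "reflect_steps t A N \<circ> reflect_on (t N) (A N) = reflect_steps t A (Suc N)"
    by (simp add: fun_eq_iff)
  finally show ?case using Suc.IH[OF dominated_reflect_on[OF Suc.prems A[of N] t[of N]]] by (simp only:)
qed

text \<open>The family of dominated laws is closed under the reflection and the reflection is an
  involution, so both inequalities follow from the same closure property.\<close>

lemma Ehat_reflect_steps:
  assumes X: "X \<in> cylinder {0..}"
    and A: "\<And>k. A k \<in> sets (Ft (t k))" and t: "\<And>k. 0 \<le> t k" and disj: "disjoint_family A"
  shows "Ehat \<P> (\<lambda>\<omega>. X (reflect_steps t A N \<omega>)) = Ehat \<P> X"
proof (rule antisym)
  let ?\<Phi> = "reflect_steps t A N"
  have \<Phi>: "?\<Phi> \<in> measurable Finf Finf" by (rule reflect_steps_measurable[OF A t])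
  have \<Phi>Q: "?\<Phi> \<in> measurable Q Finf" if "Q \<in> prob_laws" for Q
    using \<Phi> by (simp only: measurable_cong_sets[OF prob_lawsD(2)[OF that] refl])
  have Xm: "X \<in> borel_measurable Finf" by (rule cylinder_measurable[OF X])
  obtain M where M: "\<And>\<omega>. \<omega> \<in> Omega \<Longrightarrow> \<bar>X \<omega>\<bar> \<le> M" using cylinder_bounded[OF X] by blast
  have bX: "bounded_measurable (\<lambda>\<omega>. X (?\<Phi> \<omega>))"
  proof (rule bounded_measurableI)
    show "(\<lambda>\<omega>. X (?\<Phi> \<omega>)) \<in> borel_measurable Finf" by (rule measurable_compose[OF \<Phi> Xm])
    show "\<bar>X (?\<Phi> \<omega>)\<bar> \<le> M" if "\<omega> \<in> Omega" for \<omega>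
      using measurable_space[OF \<Phi>, of \<omega>] that by (intro M) simp
  qed
  show "Ehat \<P> (\<lambda>\<omega>. X (?\<Phi> \<omega>)) \<le> Ehat \<P> X"
  proof (rule Ehat_least)
    fix P assume P: "P \<in> \<P>"
    have "(\<integral>\<omega>. X (?\<Phi> \<omega>) \<partial>P) = (\<integral>\<omega>. X \<omega> \<partial>distr P Finf ?\<Phi>)"
      by (rule integral_distr[OF \<Phi>Q[OF laws[OF P]] Xm, symmetric])
    also have "\<dots> \<le> Ehat \<P> X"
      using dominated_reflect_steps[where A = A and t = t and N = N, OF dominated_law[OF P] A t] X
      unfolding dominated_def by blast
    finally show "(\<integral>\<omega>. X (?\<Phi> \<omega>) \<partial>P) \<le> Ehat \<P> X" .
  qed
  show "Ehat \<P> X \<le> Ehat \<P> (\<lambda>\<omega>. X (?\<Phi> \<omega>))"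
  proof (rule Ehat_least)
    fix P assume P: "P \<in> \<P>"
    have "(\<integral>\<omega>. X \<omega> \<partial>P) = (\<integral>\<omega>. X (?\<Phi> (?\<Phi> \<omega>)) \<partial>P)"
      using reflect_steps_involution[OF _ A t disj] prob_lawsD(3)[OF laws[OF P]]
      by (intro Bochner_Integration.integral_cong) simp_all
    also have "\<dots> = (\<integral>\<omega>. X (?\<Phi> \<omega>) \<partial>distr P Finf ?\<Phi>)"
      by (rule integral_distr[OF \<Phi>Q[OF laws[OF P]] bounded_measurable_borel[OF bX], symmetric])
    also have "\<dots> \<le> Ehat \<P> (\<lambda>\<omega>. X (?\<Phi> \<omega>))"
      by (rule dominated_bounded_measurable[OF dominated_reflect_steps[OF dominated_law[OF P] A t] bX])
    finally show "(\<integral>\<omega>. X \<omega> \<partial>P) \<le> Ehat \<P> (\<lambda>\<omega>. X (?\<Phi> \<omega>))" .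
  qed
qed

section \<open>The reflected G-Brownian motion\<close>

text \<open>The reflection principle at an optional time: \<open>\<tau>\<close> is rounded up to a grid of mesh \<open>\<delta>\<close>, and
  the error is controlled by the modulus of continuity. Rounding up makes \<open>{t k - \<delta> \<le> \<tau> < t k}\<close> an event of
  \<open>Ft (t k)\<close> even though \<open>\<tau>\<close> is only an optional time.\<close>

lemma Ehat_reflect_optional:
  assumes X: "X \<in> cylinder {0..}" and \<tau>: "optional_time \<tau>"
  shows "Ehat \<P> (\<lambda>\<omega>. X (reflect (\<tau> \<omega>) \<omega>)) = Ehat \<P> X"
proof -
  obtain S L where S: "finite S" "S \<subseteq> {0..}" and L: "0 \<le> L"
    and XL: "\<And>\<omega> \<omega>'. \<omega> \<in> Omega \<Longrightarrow> \<omega>' \<in> Omega \<Longrightarrow> norm (X \<omega> - X \<omega>') \<le> L * (\<Sum>s\<in>S. norm (\<omega> s - \<omega>' s))"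
    using finitely_LipschitzE[OF cylinder_finitely_Lipschitz[OF X]] by blast
  obtain M where M: "0 \<le> M" "\<And>\<omega>. \<omega> \<in> Omega \<Longrightarrow> \<bar>X \<omega>\<bar> \<le> M" using cylinder_bounded[OF X] by blast
  define T where "T = Max (insert 0 S)"
  have T: "0 \<le> T" "\<And>s. s \<in> S \<Longrightarrow> s \<le> T" using S(1) by (simp_all add: T_def)
  define K where "K = 2 * M + 2 * L * card S"
  have K: "0 \<le> K" using M(1) L by (simp add: K_def)
  have \<tau>0: "0 \<le> \<tau> \<omega>" if "\<omega> \<in> Omega" for \<omega> using \<tau> that by (simp add: optional_time_def)
  have Xm: "X \<in> borel_measurable Finf" by (rule cylinder_measurable[OF X])
  have b\<tau>: "bounded_measurable (\<lambda>\<omega>. X (reflect (\<tau> \<omega>) \<omega>))"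
  proof (rule bounded_measurableI)
    show "(\<lambda>\<omega>. X (reflect (\<tau> \<omega>) \<omega>)) \<in> borel_measurable Finf"
      by (rule measurable_compose[OF reflect_optional_measurable[OF \<tau>] Xm])
    show "\<bar>X (reflect (\<tau> \<omega>) \<omega>)\<bar> \<le> M" if "\<omega> \<in> Omega" for \<omega>
      by (intro M(2) reflect_in_Omega that \<tau>0)
  qed
  have bound: "\<bar>Ehat \<P> X - Ehat \<P> (\<lambda>\<omega>. X (reflect (\<tau> \<omega>) \<omega>))\<bar> \<le>
      K * Ehat \<P> (modulus (T + 1) (inverse (real (Suc m))))" for m
  proof -
    define d where "d = inverse (real (Suc m))"
    \<comment> \<open>The mesh is smaller than \<open>d\<close>, as the modulus for \<open>d\<close> only controls distances strictly below \<open>d\<close>.\<close>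
    define \<delta> where "\<delta> = d / 2"
    have d: "0 < d" "0 < \<delta>" "\<delta> < d" by (simp_all add: d_def \<delta>_def)
    define t where "t k = (real k + 1) * \<delta>" for k :: nat
    define A where "A k = {\<omega> \<in> Omega. real k * \<delta> \<le> \<tau> \<omega> \<and> \<tau> \<omega> < t k}" for k :: nat
    have t0: "0 \<le> t k" for k using d by (simp add: t_def)
    have A: "A k \<in> sets (Ft (t k))" for k
    proof -
      have "{\<omega> \<in> Omega. \<tau> \<omega> < t k} \<in> sets (Ft (t k))" using \<tau> t0 by (simp add: optional_time_def)
      moreover have "{\<omega> \<in> Omega. \<tau> \<omega> < real k * \<delta>} \<in> sets (Ft (t k))"
      proof -
        have "{0..real k * \<delta>} \<subseteq> {0..t k}" using d by (auto simp: t_def distrib_right)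
        from sets_path_algebra_mono[OF this]
        have "sets (Ft (real k * \<delta>)) \<subseteq> sets (Ft (t k) :: (real \<Rightarrow> real^'d) measure)"
          unfolding Ft_eq_path_algebra .
        moreover have "{\<omega> \<in> Omega. \<tau> \<omega> < real k * \<delta>} \<in> sets (Ft (real k * \<delta>))"
          using \<tau> d by (simp add: optional_time_def)
        ultimately show ?thesis by blast
      qed
      moreover have "A k = {\<omega> \<in> Omega. \<tau> \<omega> < t k} - {\<omega> \<in> Omega. \<tau> \<omega> < real k * \<delta>}"
        by (auto simp: A_def)
      ultimately show ?thesis by simp
    qed
    have A_iff: "\<omega> \<in> A k \<longleftrightarrow> \<omega> \<in> Omega \<and> \<lfloor>\<tau> \<omega> / \<delta>\<rfloor> = int k" for \<omega> k
    proof -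
      have "real k * \<delta> \<le> \<tau> \<omega> \<longleftrightarrow> real k \<le> \<tau> \<omega> / \<delta>" "\<tau> \<omega> < t k \<longleftrightarrow> \<tau> \<omega> / \<delta> < real k + 1"
        by (simp_all only: t_def pos_le_divide_eq[OF d(2)] pos_divide_less_eq[OF d(2)])
      then show ?thesis unfolding A_def by (auto simp: floor_eq_iff)
    qed
    have disj: "disjoint_family A" unfolding disjoint_family_on_def using A_iff by auto
    \<comment> \<open>From the \<open>N\<close>-th grid point on, reflection does not affect the times up to \<open>T\<close> that \<open>X\<close> evaluates.\<close>
    obtain N :: nat where N: "T < real N * \<delta>" using ex_less_of_nat_mult[OF d(2)] by blast
    let ?\<Phi> = "reflect_steps t A N" and ?\<mu> = "modulus (T + 1) d :: (real \<Rightarrow> real^'d) \<Rightarrow> real"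
    have \<mu>: "0 \<le> ?\<mu> \<omega>" "?\<mu> \<omega> \<le> 1" for \<omega> using T(1) d by (intro modulus_bounds; simp)+
    have b\<mu>: "bounded_measurable ?\<mu>"
    proof (rule bounded_measurableI)
      show "?\<mu> \<in> borel_measurable Finf" using T(1) d by (intro modulus_measurable) simp_all
      show "\<bar>?\<mu> \<omega>\<bar> \<le> 1" for \<omega> using \<mu>[of \<omega>] by simp
    qed
    have \<Phi>: "?\<Phi> \<in> measurable Finf Finf" by (rule reflect_steps_measurable[OF A t0])
    have \<Phi>O: "?\<Phi> \<omega> \<in> Omega" if "\<omega> \<in> Omega" for \<omega> using measurable_space[OF \<Phi>, of \<omega>] that by simp
    have b\<Phi>: "bounded_measurable (\<lambda>\<omega>. X (?\<Phi> \<omega>))"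
      by (rule bounded_measurableI[OF measurable_compose[OF \<Phi> Xm], of M]) (intro M(2) \<Phi>O)
    have near: "\<bar>X (?\<Phi> \<omega>) - X (reflect (\<tau> \<omega>) \<omega>)\<bar> \<le> K * ?\<mu> \<omega>" if om: "\<omega> \<in> Omega" for \<omega>
    proof (cases "?\<mu> \<omega> < 1")
      case False
      then have \<mu>1: "?\<mu> \<omega> = 1" using \<mu>(2)[of \<omega>] by simp
      have XM: "\<bar>X (?\<Phi> \<omega>)\<bar> \<le> M" "\<bar>X (reflect (\<tau> \<omega>) \<omega>)\<bar> \<le> M"
        by (intro M(2) \<Phi>O om reflect_in_Omega \<tau>0)+
      have "\<bar>X (?\<Phi> \<omega>) - X (reflect (\<tau> \<omega>) \<omega>)\<bar> \<le> M + M"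
        by (rule order_trans[OF abs_triangle_ineq4 add_mono[OF XM]])
      moreover have "0 \<le> 2 * L * card S" using L by simp
      ultimately show ?thesis unfolding \<mu>1 K_def by simp
    next
      case True
      have near_s: "norm (?\<Phi> \<omega> s - reflect (\<tau> \<omega>) \<omega> s) \<le> 2 * ?\<mu> \<omega>" if s: "s \<in> S" for s
      proof -
        have s0: "0 \<le> s" "s \<le> T" using s S(2) T(2) by auto
        define k where "k = nat \<lfloor>\<tau> \<omega> / \<delta>\<rfloor>"
        have k: "\<omega> \<in> A k" unfolding A_iff k_def using om \<tau>0[OF om] d by simp
        show ?thesis
        proof (cases "k < N")
          case True
          have "?\<Phi> \<omega> s - reflect (\<tau> \<omega>) \<omega> s = 2 *\<^sub>R (\<omega> (min s (t k)) - \<omega> (min s (\<tau> \<omega>)))"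
            using reflect_steps_inside[OF om True k A t0 disj] s0 by (simp add: reflect_def scaleR_diff_right)
          then have eq: "norm (?\<Phi> \<omega> s - reflect (\<tau> \<omega>) \<omega> s) = 2 * norm (\<omega> (min s (t k)) - \<omega> (min s (\<tau> \<omega>)))"
            by simp
          have "min 1 (norm (\<omega> (min s (t k)) - \<omega> (min s (\<tau> \<omega>)))) \<le> ?\<mu> \<omega>"
          proof (rule increment_le_modulus[OF om])
            have "\<bar>min s (t k) - min s (\<tau> \<omega>)\<bar> \<le> \<bar>t k - \<tau> \<omega>\<bar>" by (simp add: min_def)
            also have "\<dots> \<le> \<delta>" using k by (simp add: A_def t_def distrib_right)
            finally show "\<bar>min s (t k) - min s (\<tau> \<omega>)\<bar> < d" using d by simp
          qed (use s0 t0 \<tau>0[OF om] in \<open>simp_all add: min.coboundedI1\<close>)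
          with \<open>?\<mu> \<omega> < 1\<close> have "norm (\<omega> (min s (t k)) - \<omega> (min s (\<tau> \<omega>))) \<le> ?\<mu> \<omega>"
            by (simp add: min_def split: if_splits)
          with eq show ?thesis by simp
        next
          case False
          have "?\<Phi> \<omega> = \<omega>"
            using k False disj unfolding disjoint_family_on_def
            by (intro reflect_steps_outside) (metis A_iff of_nat_eq_iff)
          moreover have "s \<le> \<tau> \<omega>"
          proof -
            have "real N * \<delta> \<le> real k * \<delta>" using False d by (intro mult_right_mono) auto
            then show ?thesis using N s0 k by (simp add: A_def)
          qed
          ultimately show ?thesis using s0 \<mu>(1)[of \<omega>] by (simp add: reflect_def min_absorb1 scaleR_2)
        qed
      qed
      have "(\<Sum>s\<in>S. norm (?\<Phi> \<omega> s - reflect (\<tau> \<omega>) \<omega> s)) \<le> card S * (2 * ?\<mu> \<omega>)"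
        by (rule sum_bounded_above[OF near_s])
      then have "L * (\<Sum>s\<in>S. norm (?\<Phi> \<omega> s - reflect (\<tau> \<omega>) \<omega> s)) \<le> L * (card S * (2 * ?\<mu> \<omega>))"
        using L by (rule mult_left_mono)
      moreover have "\<bar>X (?\<Phi> \<omega>) - X (reflect (\<tau> \<omega>) \<omega>)\<bar> \<le> L * (\<Sum>s\<in>S. norm (?\<Phi> \<omega> s - reflect (\<tau> \<omega>) \<omega> s))"
        unfolding real_norm_def[symmetric] by (intro XL \<Phi>O reflect_in_Omega om \<tau>0)
      moreover have "K * ?\<mu> \<omega> = L * (card S * (2 * ?\<mu> \<omega>)) + 2 * M * ?\<mu> \<omega>"
        by (simp add: K_def algebra_simps)
      moreover have "0 \<le> 2 * M * ?\<mu> \<omega>" using M(1) \<mu>(1) by simp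
      ultimately show ?thesis by linarith
    qed
    have "\<bar>Ehat \<P> (\<lambda>\<omega>. X (?\<Phi> \<omega>)) - Ehat \<P> (\<lambda>\<omega>. X (reflect (\<tau> \<omega>) \<omega>))\<bar> \<le> K * Ehat \<P> ?\<mu>"
    proof (rule Ehat_diff_le[OF b\<Phi> b\<tau>])
      fix P assume P: "P \<in> \<P>"
      have "(\<integral>\<omega>. \<bar>X (?\<Phi> \<omega>) - X (reflect (\<tau> \<omega>) \<omega>)\<bar> \<partial>P) \<le> (\<integral>\<omega>. 0 + K * ?\<mu> \<omega> \<partial>P)"
      proof (rule integral_law_mono[OF laws[OF P]])
        show "bounded_measurable (\<lambda>\<omega>. \<bar>X (?\<Phi> \<omega>) - X (reflect (\<tau> \<omega>) \<omega>)\<bar>)"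
        proof (rule bounded_measurableI)
          show "(\<lambda>\<omega>. \<bar>X (?\<Phi> \<omega>) - X (reflect (\<tau> \<omega>) \<omega>)\<bar>) \<in> borel_measurable Finf"
            using bounded_measurable_borel[OF b\<Phi>] bounded_measurable_borel[OF b\<tau>] by measurable
          show "\<bar>\<bar>X (?\<Phi> \<omega>) - X (reflect (\<tau> \<omega>) \<omega>)\<bar>\<bar> \<le> K * 1" if "\<omega> \<in> Omega" for \<omega>
            using order_trans[OF near[OF that] mult_left_mono[OF \<mu>(2) K]] by simp
        qed
        show "bounded_measurable (\<lambda>\<omega>. 0 + K * ?\<mu> \<omega>)"
          by (intro bounded_measurable_add bounded_measurable_mult bounded_measurable_const b\<mu>)
      qed (simp add: near)
      also have "\<dots> = 0 + K * (\<integral>\<omega>. ?\<mu> \<omega> \<partial>P)" by (rule integral_law_affine[OF laws[OF P] b\<mu>])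
      also have "\<dots> \<le> K * Ehat \<P> ?\<mu>"
        using mult_left_mono[OF expectation_le_Ehat[OF P b\<mu>] K] by simp
      finally show "(\<integral>\<omega>. \<bar>X (?\<Phi> \<omega>) - X (reflect (\<tau> \<omega>) \<omega>)\<bar> \<partial>P) \<le> K * Ehat \<P> ?\<mu>" .
    qed
    then show ?thesis unfolding Ehat_reflect_steps[OF X A t0 disj] d_def .
  qed
  have "0 \<le> T + 1" using T(1) by simp
  from tendsto_mult[OF tendsto_const Ehat_modulus_tendsto_zero[OF this], of K]
  have "(\<lambda>m. K * Ehat \<P> (modulus (T + 1) (inverse (real (Suc m))))) \<longlonglongrightarrow> 0" by simp
  then have "\<bar>Ehat \<P> X - Ehat \<P> (\<lambda>\<omega>. X (reflect (\<tau> \<omega>) \<omega>))\<bar> \<le> 0"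
    by (rule LIMSEQ_le_const) (use bound in blast)
  then show ?thesis by simp
qed

text \<open>The second moment of \<open>B 0\<close> vanishes.\<close>

lemma starts_at_zero:
  assumes "P \<in> \<P>" shows "measure P {\<omega> \<in> Omega. \<omega> 0 \<noteq> 0} = 0"
proof -
  have "(\<integral>\<omega>. \<omega> 0 \<bullet> \<omega> 0 \<partial>P) = 0"
    using law_second_moment(2)[OF assms, of 0] by (intro antisym integral_nonneg_AE) auto
  then have "AE \<omega> in P. \<omega> 0 \<bullet> \<omega> 0 = 0"
    using integral_nonneg_eq_0_iff_AE[OF law_second_moment(1)[OF assms, of 0]] by simp
  then have ae: "AE \<omega> in P. \<omega> 0 = 0" by simp
  have "emeasure P {\<omega> \<in> space P. \<not> \<omega> 0 = 0} = 0"
  proof (rule AE_iff_measurable[THEN iffD1, OF _ refl ae])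
    have [measurable]: "(\<lambda>\<omega>. \<omega> 0) \<in> borel_measurable P"
      using coordinate_measurable_Finf[of 0] by (simp add: measurable_cong_sets[OF prob_lawsD(2)[OF laws[OF assms]] refl])
    show "{\<omega> \<in> space P. \<not> \<omega> 0 = 0} \<in> sets P" by measurable
  qed
  then show ?thesis using prob_lawsD(3)[OF laws[OF assms]] by (simp add: measure_def)
qed

text \<open>All conditions that define a G-Brownian motion equate upper expectations of cylinder functions, so
  they carry over from the canonical process. For independence this is used for the joint function,
  for the inner expectation with frozen past, and for the outer expectation.\<close>

theorem reflected_G_Brownian_motion:
  assumes \<tau>: "optional_time \<tau>"
    and Y: "\<And>t \<omega>. 0 \<le> t \<Longrightarrow> Y t \<omega> = reflect (\<tau> \<omega>) \<omega> t"
  shows "G_Brownian_motion H E G \<P> Y"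
  unfolding G_Brownian_motion_def
proof (intro conjI allI impI)
  show "Y t \<in> borel_measurable Finf" if "0 \<le> t" for t
  proof -
    have "(\<lambda>\<omega>. reflect (\<tau> \<omega>) \<omega> t) \<in> borel_measurable Finf"
      by (rule measurable_compose[OF reflect_optional_measurable[OF \<tau>] coordinate_measurable_Finf[OF that]])
    moreover have "Y t = (\<lambda>\<omega>. reflect (\<tau> \<omega>) \<omega> t)" using Y[OF that] by blast
    ultimately show ?thesis by simp
  qed
  have "{\<omega> \<in> Omega. Y 0 \<omega> \<noteq> 0} = {\<omega> \<in> Omega. \<omega> 0 \<noteq> 0}"
    using \<tau> by (auto simp: Y reflect_def optional_time_def min_absorb1 scaleR_2)
  then show "capacity \<P> {\<omega> \<in> Omega. Y 0 \<omega> \<noteq> 0} = 0"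
    unfolding capacity_def using starts_at_zero nonempty by simp
next
  fix t s :: real and n :: nat and u :: "nat \<Rightarrow> real"
  assume t: "0 \<le> t" and s: "0 \<le> s" and "1 \<le> n" and "mono_on {..<n} u \<and> (\<forall>i<n. 0 \<le> u i \<and> u i \<le> t)"
  then have u: "\<And>i. i < n \<Longrightarrow> 0 \<le> u i" "\<And>i. i < n \<Longrightarrow> u i \<le> t" by auto
  have ts: "0 \<le> t + s" using t s by simp
  show "independent_from (Ehat \<P>) (\<lambda>\<omega>. Y (t + s) \<omega> - Y t \<omega>) n (\<lambda>i. Y (u i))"
    unfolding independent_from_def
  proof
    fix \<phi> :: "(nat \<Rightarrow> real^'d) \<Rightarrow> real" assume \<phi>: "\<phi> \<in> Cb_Lip_seq (Suc n)"
    obtain L M where L: "0 \<le> L" "0 \<le> M" "\<And>x. \<bar>\<phi> x\<bar> \<le> M"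
      "\<And>x y. \<bar>\<phi> x - \<phi> y\<bar> \<le> L * (\<Sum>i<Suc n. norm (x i - y i))"
      using Cb_Lip_seq_sum_bound[OF \<phi>] by blast
    have cong: "\<phi> (a(n := y)) = \<phi> (b(n := y))" if "\<And>i. i < n \<Longrightarrow> a i = b i" for a b y
      by (rule Cb_Lip_seq_cong[OF \<phi>]) (use that in \<open>auto simp: less_Suc_eq\<close>)
    define Z where "Z a \<omega> = \<phi> (a(n := \<omega> (t + s) - \<omega> t))" for a and \<omega> :: "real \<Rightarrow> real^'d"
    define \<Psi> where "\<Psi> a = Ehat \<P> (Z a)" for a
    define X where "X \<omega> = Z (\<lambda>i. \<omega> (u i)) \<omega>" for \<omega>
    have Z: "Z a \<in> cylinder {0..}" for a
      unfolding Z_def[abs_def] using t ts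
      by (intro cylinder_Cb_Lip[OF Cb_Lip_seq_slice[OF \<phi>]] finitely_Lipschitz_diff
          finitely_Lipschitz_coordinate) simp_all
    have \<Psi>: "\<Psi> \<in> Cb_Lip_seq n"
      unfolding \<Psi>_def[abs_def]
    proof (rule Cb_Lip_seq_Ehat[OF Z L(1)])
      show "\<bar>Z a \<omega>\<bar> \<le> M" for a \<omega> unfolding Z_def by (rule L(3))
      show "\<bar>Z a \<omega> - Z b \<omega>\<bar> \<le> L * (\<Sum>i<n. norm (a i - b i))" for a b \<omega>
      proof -
        have "(\<Sum>i<Suc n. norm ((a(n := y)) i - (b(n := y)) i)) = (\<Sum>i<n. norm (a i - b i))" for y by simp
        then show ?thesis unfolding Z_def using L(4) by metis
      qed
    qed
    have X: "X \<in> cylinder {0..}"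
    proof -
      have "(\<lambda>\<omega>. \<phi> (\<lambda>i. (if i = n then \<omega> (t + s) - \<omega> t else \<omega> (u i)))) \<in> cylinder {0..}"
      proof (rule cylinder_Cb_Lip_seq[OF \<phi>])
        fix i assume "i < Suc n"
        then show "finitely_Lipschitz {0..} (\<lambda>\<omega> :: real \<Rightarrow> real^'d. if i = n then \<omega> (t + s) - \<omega> t else \<omega> (u i))"
          using t ts u(1)[of i]
          by (cases "i = n") (simp_all add: finitely_Lipschitz_diff finitely_Lipschitz_coordinate)
      qed
      moreover have "(\<lambda>i. if i = n then y else a i) = a(n := y)" for a :: "nat \<Rightarrow> real^'d" and y by auto
      ultimately show ?thesis by (simp only: X_def[abs_def] Z_def)
    qed
    have \<Psi>u: "(\<lambda>\<omega>. \<Psi> (\<lambda>i. \<omega> (u i))) \<in> cylinder {0..}"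
      by (rule cylinder_Cb_Lip_seq[OF \<Psi>]) (simp add: finitely_Lipschitz_coordinate u(1))
    have cond: "cond t X \<omega> = \<Psi> (\<lambda>i. \<omega> (u i))" for \<omega>
    proof -
      have "X (paste t \<omega> \<omega>') = Z (\<lambda>i. \<omega> (u i)) \<omega>'" for \<omega>'
      proof -
        have "paste t \<omega> \<omega>' (t + s) - paste t \<omega> \<omega>' t = \<omega>' (t + s) - \<omega>' t"
          using t s by (simp add: paste_def)
        moreover have "paste t \<omega> \<omega>' (u i) = \<omega> (u i)" if "i < n" for i
          using u[OF that] by (simp add: paste_def min_absorb1 max_absorb2)
        ultimately show ?thesis unfolding X_def Z_def by (simp only:) (rule cong)
      qed
      then show ?thesis unfolding cond_def \<Psi>_def by simp
    qed
    have inner: "Ehat \<P> (\<lambda>\<omega>'. \<phi> (a(n := Y (t + s) \<omega>' - Y t \<omega>'))) = \<Psi> a" for a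
      using Ehat_reflect_optional[OF Z \<tau>, of a] unfolding \<Psi>_def Z_def[abs_def] by (simp only: Y[OF ts] Y[OF t])
    have Yu: "\<Psi> (\<lambda>i. Y (u i) \<omega>) = \<Psi> (\<lambda>i. reflect (\<tau> \<omega>) \<omega> (u i))" for \<omega>
      by (rule Cb_Lip_seq_cong[OF \<Psi>]) (rule Y[OF u(1)])
    have "Ehat \<P> (\<lambda>\<omega>. \<phi> ((\<lambda>i. Y (u i) \<omega>)(n := Y (t + s) \<omega> - Y t \<omega>))) =
        Ehat \<P> (\<lambda>\<omega>. X (reflect (\<tau> \<omega>) \<omega>))"
      unfolding X_def Z_def Y[OF ts] Y[OF t]
      by (intro arg_cong[where f = "Ehat \<P>"] ext cong Y u(1))
    also have "\<dots> = Ehat \<P> (cond t X)" unfolding Ehat_reflect_optional[OF X \<tau>] Ehat_cond[OF X t] ..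
    also have "\<dots> = Ehat \<P> (\<lambda>\<omega>. \<Psi> (\<lambda>i. reflect (\<tau> \<omega>) \<omega> (u i)))"
      unfolding cond[abs_def] by (rule Ehat_reflect_optional[OF \<Psi>u \<tau>, symmetric])
    also have "\<dots> = Ehat \<P> (\<lambda>\<omega>. Ehat \<P> (\<lambda>\<omega>'. \<phi> ((\<lambda>i. Y (u i) \<omega>)(n := Y (t + s) \<omega>' - Y t \<omega>'))))"
      unfolding inner Yu ..
    finally show "Ehat \<P> (\<lambda>\<omega>. \<phi> ((\<lambda>i. Y (u i) \<omega>)(n := Y (t + s) \<omega> - Y t \<omega>))) =
        Ehat \<P> (\<lambda>\<omega>. Ehat \<P> (\<lambda>\<omega>'. \<phi> ((\<lambda>i. Y (u i) \<omega>)(n := Y (t + s) \<omega>' - Y t \<omega>'))))" .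
  qed
next
  have "identically_distributed (Ehat \<P>) (\<lambda>\<omega>. Y (t + s) \<omega> - Y t \<omega>) E (\<lambda>w. sqrt s *\<^sub>R \<xi> 0 w)"
    if t: "0 \<le> t" and s: "0 \<le> s" for t s
    unfolding identically_distributed_def
  proof
    fix \<phi> :: "real^'d \<Rightarrow> real" assume \<phi>: "\<phi> \<in> Cb_Lip"
    have ts: "0 \<le> t + s" using t s by simp
    have "(\<lambda>\<omega>. \<phi> (\<omega> (t + s) - \<omega> t)) \<in> cylinder {0..}"
      using t ts by (intro cylinder_Cb_Lip[OF \<phi>] finitely_Lipschitz_diff finitely_Lipschitz_coordinate) simp_all
    from Ehat_reflect_optional[OF this \<tau>] Ehat_increment[OF \<phi> t s]
    show "Ehat \<P> (\<lambda>\<omega>. \<phi> (Y (t + s) \<omega> - Y t \<omega>)) = E (\<lambda>w. \<phi> (sqrt s *\<^sub>R \<xi> 0 w))"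
      by (simp only: Y[OF ts] Y[OF t])
  qed
  moreover have "G_normal H E G (\<xi> 0)" using iid unfolding iid_G_normal_def by blast
  ultimately show "\<exists>\<xi>. G_normal H E G \<xi> \<and> (\<forall>t\<ge>0. \<forall>s\<ge>0. identically_distributed (Ehat \<P>)
      (\<lambda>\<omega>. Y (t + s) \<omega> - Y t \<omega>) E (\<lambda>w. sqrt s *\<^sub>R \<xi> w))" by blast
qed

end

theorem theorem3p27:
  fixes G :: "real^'d^'d \<Rightarrow> real"
    and H :: "('w \<Rightarrow> real) set" and E :: "('w \<Rightarrow> real) \<Rightarrow> real"
    and \<xi> :: "nat \<Rightarrow> 'w \<Rightarrow> real^'d"
    and \<P> :: "(real \<Rightarrow> real^'d) measure set"
    and \<tau> :: "(real \<Rightarrow> real^'d) \<Rightarrow> real"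
    and B' :: "real \<Rightarrow> (real \<Rightarrow> real^'d) \<Rightarrow> real^'d"
  assumes "monotone_sublinear G"
    and "sublinear_expectation_space H E"
    and "iid_G_normal H E G \<xi>"
    and "represents_G_expectation E \<xi> \<P>"
    and "optional_time \<tau>"
    and B': "\<And>t \<omega>. B' t \<omega> = 2 *\<^sub>R B (min t (\<tau> \<omega>)) \<omega> - B t \<omega>"
  shows "(\<forall>t\<ge>0. \<forall>\<omega>\<in>Omega. B' t \<omega> =
            B (min t (\<tau> \<omega>)) \<omega> - (if t > \<tau> \<omega> then B t \<omega> - B (\<tau> \<omega>) \<omega> else 0)) \<and>
         G_Brownian_motion H E G \<P> B'"
proof
  interpret sublinear_expectation_space H E by fact
  interpret g_expectation H E \<P> G \<xi>
    using assms(3,4) unfolding represents_G_expectation_def by unfold_locales blast+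
  show "\<forall>t\<ge>0. \<forall>\<omega>\<in>Omega. B' t \<omega> =
      B (min t (\<tau> \<omega>)) \<omega> - (if t > \<tau> \<omega> then B t \<omega> - B (\<tau> \<omega>) \<omega> else 0)"
    by (simp add: B' B_def scaleR_2 min_def)
  show "G_Brownian_motion H E G \<P> B'"
    by (rule reflected_G_Brownian_motion[OF assms(5)]) (simp add: B' B_def reflect_def)
qed

end
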